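(* Let $(\mathcal{U},\mathcal{V})$ and $(\mathcal{X},\mathcal{Y})$ be two cotorsion pairs in $R\text{-Mod}$ with $\mathcal{U}\subseteq\mathcal{X}$. If $(\mathcal{U},\mathcal{V})$ is cogenerated by a set $\{A_i\mid i\in I\}$ and $(\mathcal{X},\mathcal{Y})$ is cogenerated by a set $\{B_j\mid j\in J\}$, then the cotorsion pair $({}^{\perp}(\widetilde{\mathcal{Y}}_{\mathcal{V}}),\widetilde{\mathcal{Y}}_{\mathcal{V}})$ in $\mathrm{Ch}(R)$ is cogenerated by the set $$\mathcal{S}=\{S^n(R)\mid n\in\mathbb{Z}\}\cup\{S^n(A_i)\mid n\in\mathbb{Z},\ i\in I\}\cup\{D^n(B_j)\mid n\in\mathbb{Z},\ j\in J\},$$ and so it is complete.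
   Context: $R$ is an associative ring with $1$, $R\text{-Mod}$ is the category of left $R$-modules, and $\mathrm{Ch}(R)$ is the category of ($\mathbb{Z}$-indexed, unbounded) chain complexes $\cdots\to C_{n+1}\xrightarrow{\delta_{n+1}}C_n\xrightarrow{\delta_n}C_{n-1}\to\cdots$ of left $R$-modules. The $n$th cycle module of $C$ is $Z_nC=\mathrm{Ker}(\delta_n)$. A complex is exact if all its homology modules vanish. For a module $M$, $S^n(M)$ is the complex with $M$ in degree $n$ and $0$ elsewhere, and $D^n(M)$ is the complex with $M$ in degrees $n$ and $n-1$, $0$ elsewhere, and $\delta_n=1_M$ its only nonzero differential. For a class $\mathcal{A}$ of objects in an abelian category $\mathcal{C}$, put $\mathcal{A}^{\perp}=\{X : \mathrm{Ext}^1_{\mathcal{C}}(A,X)=0 \text{ for all } A\in\mathcal{A}\}$ and ${}^{\perp}\mathcal{A}=\{X : \mathrm{Ext}^1_{\mathcal{C}}(X,A)=0\text{ for all }A\in\mathcal{A}\}$. A pair $(\mathcal{A},\mathcal{B})$ of classes of objects of $\mathcal{C}$ is a cotorsion pair if $\mathcal{A}={}^{\perp}\mathcal{B}$ and $\mathcal{B}=\mathcal{A}^{\perp}$. It is cogenerated by a set $\mathcal{S}$ if $\mathcal{S}\subseteq\mathcal{A}$ is a set with $\mathcal{S}^{\perp}=\mathcal{B}$. It is complete if for every object $X$ of $\mathcal{C}$ there are short exact sequences $0\to B\to A\to X\to 0$ and $0\to X\to B'\to A'\to 0$ with $A,A'\in\mathcal{A}$ and $B,B'\in\mathcal{B}$.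 The inclusion $\mathcal{U}\subseteq\mathcal{X}$ is equivalent to $\mathcal{Y}\subseteq\mathcal{V}$; $\widetilde{\mathcal{Y}}_{\mathcal{V}}$ denotes the class of all exact chain complexes $Y$ in $\mathrm{Ch}(R)$ with $Y_n\in\mathcal{Y}$ and $Z_nY\in\mathcal{V}$ for every $n\in\mathbb{Z}$. For any two cotorsion pairs with $\mathcal{U}\subseteq\mathcal{X}$, the pair $({}^{\perp}(\widetilde{\mathcal{Y}}_{\mathcal{V}}),\widetilde{\mathcal{Y}}_{\mathcal{V}})$ is a cotorsion pair in $\mathrm{Ch}(R)$. *)

theory Defs
  imports "HOL-Algebra.AbelCoset" "HOL-Algebra.Module"
begin

unbundle cardinal_syntax

section \<open>The universe\<close>

text \<open>
  The categories of all modules and of all complexes need a universe of sets. It is given by a type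
  \<open>'u\<close>: the sets are the small collections, i.e. those of cardinality less than that of \<open>'u\<close>. The
  closure properties below are those of a Grothendieck universe containing an infinite set (they say
  that the cardinality of \<open>'u\<close> is uncountable and strongly inaccessible). Every small set has a copy
  inside \<open>'u\<close>, so it is no restriction to take the elements of all rings and modules from \<open>'u\<close>.
\<close>

definition small :: "'u itself \<Rightarrow> 'a set \<Rightarrow> bool" where
  "small U S \<longleftrightarrow> |S| <o |UNIV :: 'u set|"

definition grothendieck_universe :: "'u itself \<Rightarrow> bool" where
  "grothendieck_universe U \<longleftrightarrow>
     small U (UNIV :: nat set) \<and>
     (\<forall>S :: 'u set. small U S \<longrightarrow> small U (Pow S)) \<and>
     (\<forall>(I :: 'u set) (F :: 'u \<Rightarrow> 'u set).
        small U I \<longrightarrow> (\<forall>i\<in>I. small U (F i)) \<longrightarrow> small U (\<Union>i\<in>I. F i))"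


section \<open>Cotorsion pairs\<close>

text \<open>
  The data of an abelian category used below. Here \<open>Comp C A g f\<close> is the composite of \<open>g\<close> with an
  arrow \<open>f\<close> with source \<open>A\<close>, and \<open>SES C X f E g A\<close> states that
  \<open>0 \<rightarrow> X \<rightarrow> E \<rightarrow> A \<rightarrow> 0\<close>, with arrows \<open>f\<close> and \<open>g\<close>, is a short exact sequence.
\<close>

record ('o, 'm) abelian_cat =
  Obj :: "'o set"
  Arr :: "'o \<Rightarrow> 'o \<Rightarrow> 'm set"
  Comp :: "'o \<Rightarrow> 'm \<Rightarrow> 'm \<Rightarrow> 'm"
  Ident :: "'o \<Rightarrow> 'm"
  SES :: "'o \<Rightarrow> 'm \<Rightarrow> 'o \<Rightarrow> 'm \<Rightarrow> 'o \<Rightarrow> bool"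

definition short_extensions :: "('o, 'm) abelian_cat \<Rightarrow> 'o \<Rightarrow> 'o \<Rightarrow> ('m \<times> 'o \<times> 'm) set" where
  "short_extensions C A X = {(f, E, g). SES C X f E g A}"

text \<open>By the five lemma, the arrow \<open>h\<close> below is automatically an isomorphism.\<close>

definition ext_equiv :: "('o, 'm) abelian_cat \<Rightarrow> 'o \<Rightarrow> 'o
    \<Rightarrow> (('m \<times> 'o \<times> 'm) \<times> ('m \<times> 'o \<times> 'm)) set" where
  "ext_equiv C A X = {((f, E, g), (f', E', g')).
     (f, E, g) \<in> short_extensions C A X \<and> (f', E', g') \<in> short_extensions C A X \<and>
     (\<exists>h \<in> Arr C E E'. Comp C X h f = f' \<and> Comp C E g' h = g)}"

text \<open>Yoneda's description of \<open>Ext\<^sup>1(A, X)\<close>; its zero element is the class of the split extensions.\<close>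

definition Ext1 :: "('o, 'm) abelian_cat \<Rightarrow> 'o \<Rightarrow> 'o \<Rightarrow> ('m \<times> 'o \<times> 'm) set set" where
  "Ext1 C A X = short_extensions C A X // ext_equiv C A X"

definition Ext1_zero :: "('o, 'm) abelian_cat \<Rightarrow> 'o \<Rightarrow> 'o \<Rightarrow> ('m \<times> 'o \<times> 'm) set" where
  "Ext1_zero C A X =
     {(f, E, g) \<in> short_extensions C A X. \<exists>s \<in> Arr C A E. Comp C A g s = Ident C A}"

definition right_perp :: "('o, 'm) abelian_cat \<Rightarrow> 'o set \<Rightarrow> 'o set" where
  "right_perp C \<A> = {X \<in> Obj C. \<forall>A \<in> \<A>. Ext1 C A X = {Ext1_zero C A X}}"

definition left_perp :: "('o, 'm) abelian_cat \<Rightarrow> 'o set \<Rightarrow> 'o set" where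
  "left_perp C \<A> = {X \<in> Obj C. \<forall>A \<in> \<A>. Ext1 C X A = {Ext1_zero C X A}}"

definition cotorsion_pair :: "('o, 'm) abelian_cat \<Rightarrow> 'o set \<Rightarrow> 'o set \<Rightarrow> bool" where
  "cotorsion_pair C \<A> \<B> \<longleftrightarrow> \<A> = left_perp C \<B> \<and> \<B> = right_perp C \<A>"

text \<open>Being a set, as opposed to a proper class, means being small.\<close>

definition cogenerated_by ::
    "'u itself \<Rightarrow> ('o, 'm) abelian_cat \<Rightarrow> 'o set \<Rightarrow> 'o set \<Rightarrow> 'o set \<Rightarrow> bool" where
  "cogenerated_by U C \<A> \<B> \<S> \<longleftrightarrow> small U \<S> \<and> \<S> \<subseteq> \<A> \<and> right_perp C \<S> = \<B>"

definition complete_pair :: "('o, 'm) abelian_cat \<Rightarrow> 'o set \<Rightarrow> 'o set \<Rightarrow> bool" where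
  "complete_pair C \<A> \<B> \<longleftrightarrow> (\<forall>X \<in> Obj C.
     (\<exists>B \<in> \<B>. \<exists>A \<in> \<A>. \<exists>f g. SES C B f A g X) \<and>
     (\<exists>B \<in> \<B>. \<exists>A \<in> \<A>. \<exists>f g. SES C X f B g A))"


section \<open>Left modules\<close>

text \<open>
  The library's locale \<open>module\<close> requires a commutative ring. Its record type is reused here; the fields
  \<open>mult\<close> and \<open>one\<close> of a module carry no information.
\<close>

locale left_module = R?: ring R + M?: abelian_group M
  for R (structure) and M (structure) +
  assumes smult_closed:
      "a \<in> carrier R \<Longrightarrow> x \<in> carrier M \<Longrightarrow> a \<odot>\<^bsub>M\<^esub> x \<in> carrier M"
    and smult_l_distr:
      "a \<in> carrier R \<Longrightarrow> b \<in> carrier R \<Longrightarrow> x \<in> carrier M \<Longrightarrow>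
       (a \<oplus> b) \<odot>\<^bsub>M\<^esub> x = a \<odot>\<^bsub>M\<^esub> x \<oplus>\<^bsub>M\<^esub> b \<odot>\<^bsub>M\<^esub> x"
    and smult_r_distr:
      "a \<in> carrier R \<Longrightarrow> x \<in> carrier M \<Longrightarrow> y \<in> carrier M \<Longrightarrow>
       a \<odot>\<^bsub>M\<^esub> (x \<oplus>\<^bsub>M\<^esub> y) = a \<odot>\<^bsub>M\<^esub> x \<oplus>\<^bsub>M\<^esub> a \<odot>\<^bsub>M\<^esub> y"
    and smult_assoc:
      "a \<in> carrier R \<Longrightarrow> b \<in> carrier R \<Longrightarrow> x \<in> carrier M \<Longrightarrow>
       (a \<otimes> b) \<odot>\<^bsub>M\<^esub> x = a \<odot>\<^bsub>M\<^esub> (b \<odot>\<^bsub>M\<^esub> x)"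
    and smult_one:
      "x \<in> carrier M \<Longrightarrow> \<one> \<odot>\<^bsub>M\<^esub> x = x"

text \<open>
  Homomorphisms are extensional (\<open>undefined\<close> outside the carrier), so that equality of arrows is
  equality of functions.
\<close>

definition left_mod_hom ::
    "'u ring \<Rightarrow> ('u, 'u) module \<Rightarrow> ('u, 'u) module \<Rightarrow> ('u \<Rightarrow> 'u) set" where
  "left_mod_hom R M N = {f \<in> carrier M \<rightarrow>\<^sub>E carrier N.
     (\<forall>x \<in> carrier M. \<forall>y \<in> carrier M. f (x \<oplus>\<^bsub>M\<^esub> y) = f x \<oplus>\<^bsub>N\<^esub> f y) \<and>
     (\<forall>a \<in> carrier R. \<forall>x \<in> carrier M. f (a \<odot>\<^bsub>M\<^esub> x) = a \<odot>\<^bsub>N\<^esub> f x)}"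

definition mod_objects :: "'u ring \<Rightarrow> ('u, 'u) module set" where
  "mod_objects R = {M. left_module R M \<and> small TYPE('u) (carrier M)}"

definition mod_ses :: "'u ring \<Rightarrow> ('u, 'u) module \<Rightarrow> ('u \<Rightarrow> 'u) \<Rightarrow> ('u, 'u) module
    \<Rightarrow> ('u \<Rightarrow> 'u) \<Rightarrow> ('u, 'u) module \<Rightarrow> bool" where
  "mod_ses R X f E g A \<longleftrightarrow>
     X \<in> mod_objects R \<and> E \<in> mod_objects R \<and> A \<in> mod_objects R \<and>
     f \<in> left_mod_hom R X E \<and> g \<in> left_mod_hom R E A \<and>
     inj_on f (carrier X) \<and> f ` carrier X = a_kernel E A g \<and> g ` carrier E = carrier A"

definition R_Mod :: "'u ring \<Rightarrow> (('u, 'u) module, 'u \<Rightarrow> 'u) abelian_cat" where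
  "R_Mod R = \<lparr>Obj = mod_objects R, Arr = left_mod_hom R,
     Comp = (\<lambda>M g f. compose (carrier M) g f), Ident = (\<lambda>M. \<lambda>x \<in> carrier M. x),
     SES = mod_ses R\<rparr>"

definition regular_module :: "'u ring \<Rightarrow> ('u, 'u) module" where
  "regular_module R = \<lparr>carrier = carrier R, monoid.mult = mult R, one = one R,
     zero = zero R, add = add R, smult = mult R\<rparr>"

definition zero_submodule :: "('u, 'u) module \<Rightarrow> ('u, 'u) module" where
  "zero_submodule M = M\<lparr>carrier := {\<zero>\<^bsub>M\<^esub>}\<rparr>"


section \<open>Chain complexes\<close>

text \<open>The differential \<open>diff C n\<close> goes from degree \<open>n\<close> to degree \<open>n - 1\<close>.\<close>

record 'u ch_complex =
  chmod :: "int \<Rightarrow> ('u, 'u) module"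
  diff :: "int \<Rightarrow> 'u \<Rightarrow> 'u"

definition ch_objects :: "'u ring \<Rightarrow> 'u ch_complex set" where
  "ch_objects R = {C. \<forall>n. chmod C n \<in> mod_objects R \<and>
     diff C n \<in> left_mod_hom R (chmod C n) (chmod C (n - 1)) \<and>
     (\<forall>x \<in> carrier (chmod C n). diff C (n - 1) (diff C n x) = \<zero>\<^bsub>chmod C (n - 2)\<^esub>)}"

definition chain_maps :: "'u ring \<Rightarrow> 'u ch_complex \<Rightarrow> 'u ch_complex \<Rightarrow> (int \<Rightarrow> 'u \<Rightarrow> 'u) set" where
  "chain_maps R C D = {f. \<forall>n. f n \<in> left_mod_hom R (chmod C n) (chmod D n) \<and>
     (\<forall>x \<in> carrier (chmod C n). f (n - 1) (diff C n x) = diff D n (f n x))}"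

definition ch_ses :: "'u ring \<Rightarrow> 'u ch_complex \<Rightarrow> (int \<Rightarrow> 'u \<Rightarrow> 'u) \<Rightarrow> 'u ch_complex
    \<Rightarrow> (int \<Rightarrow> 'u \<Rightarrow> 'u) \<Rightarrow> 'u ch_complex \<Rightarrow> bool" where
  "ch_ses R X f E g A \<longleftrightarrow>
     X \<in> ch_objects R \<and> E \<in> ch_objects R \<and> A \<in> ch_objects R \<and>
     f \<in> chain_maps R X E \<and> g \<in> chain_maps R E A \<and>
     (\<forall>n. mod_ses R (chmod X n) (f n) (chmod E n) (g n) (chmod A n))"

definition Ch :: "'u ring \<Rightarrow> ('u ch_complex, int \<Rightarrow> 'u \<Rightarrow> 'u) abelian_cat" where
  "Ch R = \<lparr>Obj = ch_objects R, Arr = chain_maps R,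
     Comp = (\<lambda>C g f n. compose (carrier (chmod C n)) (g n) (f n)),
     Ident = (\<lambda>C n. \<lambda>x \<in> carrier (chmod C n). x),
     SES = ch_ses R\<rparr>"

definition cycles :: "'u ch_complex \<Rightarrow> int \<Rightarrow> ('u, 'u) module" where
  "cycles C n = (chmod C n)\<lparr>carrier := a_kernel (chmod C n) (chmod C (n - 1)) (diff C n)\<rparr>"

definition boundaries :: "'u ch_complex \<Rightarrow> int \<Rightarrow> 'u set" where
  "boundaries C n = diff C (n + 1) ` carrier (chmod C (n + 1))"

text \<open>
  The underlying group of the homology module; its vanishing does not involve the scalar
  multiplication.
\<close>

definition homology :: "'u ch_complex \<Rightarrow> int \<Rightarrow> 'u set monoid" where
  "homology C n = cycles C n A_Mod boundaries C n"

definition exact_complex :: "'u ch_complex \<Rightarrow> bool" where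
  "exact_complex C \<longleftrightarrow> (\<forall>n. carrier (homology C n) = {\<one>\<^bsub>homology C n\<^esub>})"

text \<open>The zero modules in \<open>S\<^sup>n(M)\<close> and \<open>D\<^sup>n(M)\<close> are taken to be the zero submodule of \<open>M\<close>.\<close>

definition sphere :: "int \<Rightarrow> ('u, 'u) module \<Rightarrow> 'u ch_complex" where
  "sphere n M = (let N = (\<lambda>k. if k = n then M else zero_submodule M) in
     \<lparr>chmod = N, diff = (\<lambda>k. \<lambda>x \<in> carrier (N k). \<zero>\<^bsub>M\<^esub>)\<rparr>)"

definition disk :: "int \<Rightarrow> ('u, 'u) module \<Rightarrow> 'u ch_complex" where
  "disk n M = (let N = (\<lambda>k. if k = n \<or> k = n - 1 then M else zero_submodule M) in
     \<lparr>chmod = N, diff = (\<lambda>k. \<lambda>x \<in> carrier (N k). if k = n then x else \<zero>\<^bsub>M\<^esub>)\<rparr>)"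

definition tilde_class ::
    "'u ring \<Rightarrow> ('u, 'u) module set \<Rightarrow> ('u, 'u) module set \<Rightarrow> 'u ch_complex set" where
  "tilde_class R \<Y> \<V> = {C \<in> ch_objects R.
     exact_complex C \<and> (\<forall>n. chmod C n \<in> \<Y> \<and> cycles C n \<in> \<V>)}"

end

theory Submission
  imports Defs
begin

text \<open>
  If \<open>P \<rightarrow> S\<close> is surjective with kernel \<open>K\<close> and \<open>Ext\<^sup>1(S, X) = 0\<close>, every map \<open>K \<rightarrow> X\<close> extends to
  \<open>P\<close>. Applied to \<open>D\<^bsup>n+1\<^esup>(R) \<rightarrow> S\<^bsup>n+1\<^esup>(R)\<close>, \<open>S\<^sup>n(M) \<rightarrow> S\<^sup>n(A)\<close> and \<open>D\<^sup>n(M) \<rightarrow> D\<^sup>n(B)\<close>, where \<open>M\<close> is an extension of \<open>A\<close>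
  by \<open>Z\<^sub>nX\<close> or of \<open>B\<close> by \<open>X\<^sub>n\<close>, this gives the exactness of \<open>X\<close>, \<open>Z\<^sub>nX \<in> \<V>\<close> and \<open>X\<^sub>n \<in> \<Y>\<close> for every
  \<open>X\<close> in \<open>\<S>\<^sup>\<bottom>\<close>. Conversely, extensions by an exact complex of \<open>S\<^sup>n(M)\<close> and \<open>D\<^sup>n(M)\<close> are split by splitting the
  sequence of cycles, respectively of terms, in degree \<open>n\<close>. Hence \<open>\<S>\<^sup>\<bottom>\<close> is the class in question, and
  the pair is a cotorsion pair because \<open>\<S>\<close> is contained in its left half. Completeness is
  the theorem of Eklof and Trlifaj, by the small object argument: a projective presentation \<open>K \<rightarrow> P\<close> of each
  \<open>S \<in> \<S>\<close> is pushed out along all maps from \<open>K\<close>, transfinitely often, the length being a regular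
  cardinal that exceeds the sizes of all the \<open>K\<close>.
\<close>

section \<open>Small sets\<close>

text \<open>The transfinite construction is shaped by the fixed element type. All carriers lie in
  \<open>'u\<close>, so a stage can contain the previous one literally: \<open>csub\<close> is
  agreement of operations on a smaller carrier, and the colimit at a limit step is a plain union,
  with no transition maps to keep coherent. The price is paid in the quotients: in a pushout the
  classes of elements of \<open>W\<close> must keep their names, and all other classes need names
  outside \<open>W\<close>. The size of the universe provides these names and keeps the unions
  small. Completeness does not go through filtrations by cokernels. The invariant is that an
  inclusion lifts against every epimorphism with kernel in the right-hand class. Pushouts and unions
  preserve it, and it puts the cokernel into the left-hand class. A round of pushouts is itself a
  tower, indexed by the extension problems, rather than one pushout along a direct sum, so the same
  union construction serves both levels. Ext is a set of Yoneda classes; for both categories its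
  vanishing is first converted into the splitting of every short exact sequence.\<close>

lemma small_subset: "small U S \<Longrightarrow> T \<subseteq> S \<Longrightarrow> small U T"
  unfolding small_def by (meson card_of_mono1 ordLeq_ordLess_trans)

lemma small_image: "small U S \<Longrightarrow> small U (f ` S)"
  unfolding small_def by (meson card_of_image ordLeq_ordLess_trans)

lemma small_inj_on: "inj_on f S \<Longrightarrow> small U (f ` S) \<Longrightarrow> small U S"
  using small_image[of U "f ` S" "inv_into S f"] by simp

locale universe =
  fixes U :: "'u itself"
  assumes universe: "grothendieck_universe U"
begin

lemma infinite_UNIV: "infinite (UNIV :: 'u set)"
proof -
  have "|UNIV :: nat set| \<le>o |UNIV :: 'u set|"
    using universe unfolding grothendieck_universe_def small_def by (meson ordLess_imp_ordLeq)
  then show ?thesis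
    using card_of_ordLeq_infinite infinite_UNIV_nat by blast
qed

lemma small_finite: "finite S \<Longrightarrow> small U S"
  unfolding small_def using infinite_UNIV
  by (intro finite_ordLess_infinite card_of_Well_order) (simp_all add: Field_card_of)

lemma small_encode:
  assumes "small U S" obtains f :: "'a \<Rightarrow> 'u" where "inj_on f S"
proof -
  have "|S| \<le>o |UNIV :: 'u set|" using assms unfolding small_def by (rule ordLess_imp_ordLeq)
  then show thesis using that unfolding card_of_ordLeq[symmetric] by blast
qed

lemma small_Un:
  assumes "small U A" "small U B" shows "small U (A \<union> B)"
  using assms card_of_Un_ordLess_infinite[OF infinite_UNIV] unfolding small_def by blast

lemma small_Times:
  assumes "small U A" "small U B" shows "small U (A \<times> B)"
proof (cases "finite (A <+> B)")
  case True
  then show ?thesis by (intro small_finite) simp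
next
  case False
  then have "|A \<times> B| \<le>o |A <+> B|"
    by (intro card_of_Times_ordLeq_infinite_Field card_of_Plus1 card_of_Plus2 card_of_Card_order)
      (simp add: Field_card_of)
  moreover have "|A <+> B| <o |UNIV :: 'u set|"
    using assms card_of_Plus_ordLess_infinite[OF infinite_UNIV] unfolding small_def by blast
  ultimately show ?thesis unfolding small_def by (rule ordLeq_ordLess_trans)
qed

text \<open>Supplies names for new elements that do not collide with the names \<open>W\<close>
  already in use. The complement of a small set has the full cardinality of \<open>'u\<close>, as
  otherwise \<open>'u\<close> would be a union of two small sets.\<close>

lemma small_encode_avoiding:
  assumes "small U (S :: 'a set)" "small U (W :: 'u set)"
  obtains f :: "'a \<Rightarrow> 'u" where "inj_on f S" "f ` S \<inter> W = {}"
proof -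
  have "\<not> small U (UNIV - W)"
  proof
    assume "small U (UNIV - W)"
    from small_Un[OF this assms(2)] have "small U (UNIV :: 'u set)" by simp
    then show False unfolding small_def using ordLess_irreflexive by blast
  qed
  then have "|UNIV :: 'u set| \<le>o |UNIV - W|"
    unfolding small_def by (simp add: card_of_Well_order not_ordLess_iff_ordLeq)
  then have "|S| \<le>o |UNIV - W|"
    using assms(1) unfolding small_def
    by (meson ordLess_imp_ordLeq ordLess_ordLeq_trans)
  then obtain f where "inj_on f S" "f ` S \<subseteq> UNIV - W"
    unfolding card_of_ordLeq[symmetric] by blast
  then show thesis using that by blast
qed

lemma small_Pow: assumes "small U S" shows "small U (Pow S)"
proof -
  obtain f :: "'a \<Rightarrow> 'u" where f: "inj_on f S" using assms small_encode by blast
  have "small U (Pow (f ` S))"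
    using universe small_image[OF assms] unfolding grothendieck_universe_def by blast
  moreover have "(`) f ` Pow S = Pow (f ` S)" by (rule image_Pow_surj) simp
  ultimately show ?thesis
    using small_inj_on[OF inj_on_image_Pow[OF f]] by simp
qed

text \<open>The universe axiom only covers families of subsets of \<open>'u\<close> indexed inside
  \<open>'u\<close>, so the index set and the members are first encoded there.\<close>

lemma small_UN:
  assumes "small U I" "\<And>i. i \<in> I \<Longrightarrow> small U (F i)" shows "small U (\<Union>i\<in>I. F i)"
proof -
  obtain f :: "'a \<Rightarrow> 'u" where f: "inj_on f I" using assms small_encode by blast
  define g where "g = inv_into I f"
  have g: "g (f i) = i" if "i \<in> I" for i using f that by (simp add: g_def)
  have "\<exists>h :: 'b \<Rightarrow> 'u. inj_on h (F i)" if "i \<in> I" for i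
    using small_encode[OF assms(2)[OF that]] by blast
  then obtain h :: "'a \<Rightarrow> 'b \<Rightarrow> 'u" where h: "\<And>i. i \<in> I \<Longrightarrow> inj_on (h i) (F i)" by metis
  define T where "T = (\<Union>j\<in>f ` I. h (g j) ` F (g j))"
  have "\<forall>j\<in>f ` I. small U (h (g j) ` F (g j))"
    using g assms(2) by (auto intro: small_image)
  then have T: "small U T"
    using universe[unfolded grothendieck_universe_def] small_image[OF assms(1), of f]
    unfolding T_def by meson
  \<comment> \<open>Codes of elements of different members may coincide in \<open>T\<close>, so an
    element is decoded from its code together with its index.\<close>
  have "(\<Union>i\<in>I. F i) \<subseteq> (\<lambda>(i, t). inv_into (F i) (h i) t) ` (I \<times> T)"
  proof
    fix x assume "x \<in> (\<Union>i\<in>I. F i)"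
    then obtain i where i: "i \<in> I" "x \<in> F i" by blast
    then have "x = inv_into (F i) (h i) (h i x)" using h by simp
    moreover have "h i x \<in> T" unfolding T_def using i g by auto
    ultimately show "x \<in> (\<lambda>(i, t). inv_into (F i) (h i) t) ` (I \<times> T)"
      using i by (intro image_eqI[of _ _ "(i, h i x)"]) auto
  qed
  then show ?thesis
    by (rule small_subset[OF small_image[OF small_Times[OF assms(1) T]]])
qed

lemma small_nat: "small U (UNIV :: nat set)"
  using universe unfolding grothendieck_universe_def by blast

lemma small_int: "small U (S :: int set)"
proof -
  have "S \<subseteq> (int ` UNIV) \<union> ((\<lambda>n. - int n - 1) ` UNIV)"
  proof
    fix x assume "x \<in> S"
    show "x \<in> (int ` UNIV) \<union> ((\<lambda>n. - int n - 1) ` UNIV)"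
    proof (cases x rule: int_cases)
      case (neg n)
      then have "x = - int n - 1" by simp
      then show ?thesis by blast
    qed blast
  qed
  moreover have "small U ((int ` UNIV) \<union> ((\<lambda>n. - int n - 1) ` UNIV))"
    by (intro small_Un small_image small_nat)
  ultimately show ?thesis by (rule small_subset[rotated])
qed

text \<open>Counts the attaching maps of the small object argument. A family of extensional maps is
  determined by its total graph, which is a subset of a small set of triples.\<close>

lemma small_graded_maps:
  fixes K :: "int \<Rightarrow> 'a set" and X :: "int \<Rightarrow> 'b set"
  assumes "\<And>n. small U (K n)" "\<And>n. small U (X n)"
  shows "small U {h. \<forall>n. h n \<in> K n \<rightarrow>\<^sub>E X n}"
proof -
  let ?H = "{h. \<forall>n. h n \<in> K n \<rightarrow>\<^sub>E X n}"
  let ?G = "\<lambda>h :: int \<Rightarrow> 'a \<Rightarrow> 'b. {(n, x, h n x) | n x. x \<in> K n}"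
  have "small U (\<Union>n\<in>UNIV. Pair n ` (K n \<times> X n))"
    using assms small_int by (intro small_UN small_image small_Times)
  from small_Pow[OF this] have "small U (?G ` ?H)"
    by (rule small_subset) fastforce
  moreover have "inj_on ?G ?H"
  proof (rule inj_onI)
    fix h h' assume h: "h \<in> ?H" "h' \<in> ?H" and eq: "?G h = ?G h'"
    have "h n x = h' n x" for n x
    proof (cases "x \<in> K n")
      case True
      then have "(n, x, h n x) \<in> ?G h'" unfolding eq[symmetric] by blast
      then show ?thesis by simp
    next
      case False
      then show ?thesis using h by (auto simp: PiE_def extensional_def)
    qed
    then show "h = h'" by blast
  qed
  ultimately show ?thesis using small_inj_on by blast
qed

end

section \<open>Vanishing of Ext\<close>

text \<open>Phrased for an arbitrary \<open>abelian_cat\<close> record so that it serves modules and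
  complexes alike. By \<open>ident\<close> every extension lies in its own class, hence in
  \<open>Ext1_zero\<close> if that is the only class. Conversely \<open>split\<close> makes any two
  split extensions equivalent, and \<open>nonempty\<close> ensures that there is a class at
  all.\<close>

lemma Ext1_eq_zero_iff:
  assumes ident: "\<And>f E g. SES C X f E g A \<Longrightarrow> \<exists>h\<in>Arr C E E. Comp C X h f = f \<and> Comp C E g h = g"
    and split: "\<And>f E g s f' E' g' s'. SES C X f E g A \<Longrightarrow> SES C X f' E' g' A \<Longrightarrow>
      s \<in> Arr C A E \<Longrightarrow> Comp C A g s = Ident C A \<Longrightarrow>
      s' \<in> Arr C A E' \<Longrightarrow> Comp C A g' s' = Ident C A \<Longrightarrow>
      \<exists>h\<in>Arr C E E'. Comp C X h f = f' \<and> Comp C E g' h = g"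
    and nonempty: "\<exists>f E g. SES C X f E g A"
  shows "Ext1 C A X = {Ext1_zero C A X} \<longleftrightarrow>
    (\<forall>f E g. SES C X f E g A \<longrightarrow> (\<exists>s\<in>Arr C A E. Comp C A g s = Ident C A))"
proof
  assume L: "Ext1 C A X = {Ext1_zero C A X}"
  show "\<forall>f E g. SES C X f E g A \<longrightarrow> (\<exists>s\<in>Arr C A E. Comp C A g s = Ident C A)"
  proof (intro allI impI)
    fix f E g assume ses: "SES C X f E g A"
    then have "ext_equiv C A X `` {(f, E, g)} \<in> Ext1 C A X"
      unfolding Ext1_def short_extensions_def by (auto intro: quotientI)
    moreover have "(f, E, g) \<in> ext_equiv C A X `` {(f, E, g)}"
      unfolding ext_equiv_def short_extensions_def using ses ident[OF ses] by simp
    ultimately have "(f, E, g) \<in> Ext1_zero C A X" using L by auto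
    then show "\<exists>s\<in>Arr C A E. Comp C A g s = Ident C A" unfolding Ext1_zero_def by simp
  qed
next
  assume R: "\<forall>f E g. SES C X f E g A \<longrightarrow> (\<exists>s\<in>Arr C A E. Comp C A g s = Ident C A)"
  have zero: "Ext1_zero C A X = short_extensions C A X"
    unfolding Ext1_zero_def short_extensions_def using R by auto
  have "ext_equiv C A X `` {e} = short_extensions C A X" if e_in: "e \<in> short_extensions C A X" for e
  proof -
    obtain f E g where e: "e = (f, E, g)" "SES C X f E g A"
      using e_in unfolding short_extensions_def by blast
    then obtain s where s: "s \<in> Arr C A E" "Comp C A g s = Ident C A" using R by blast
    have "\<exists>h\<in>Arr C E E'. Comp C X h f = f' \<and> Comp C E g' h = g" if "SES C X f' E' g' A" for f' E' g'
      using R that split[OF e(2) that s] by blast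
    then show ?thesis
      unfolding ext_equiv_def using e by (auto simp: short_extensions_def)
  qed
  moreover have "short_extensions C A X \<noteq> {}"
    using nonempty unfolding short_extensions_def by auto
  ultimately show "Ext1 C A X = {Ext1_zero C A X}"
    unfolding Ext1_def quotient_def zero by auto
qed

section \<open>Modules\<close>

text \<open>Unlike the arrows of \<open>R_Mod R\<close>, homomorphisms are not required to be extensional here.\<close>

definition mhom :: "'u ring \<Rightarrow> ('u, 'a) module \<Rightarrow> ('u, 'b) module \<Rightarrow> ('a \<Rightarrow> 'b) \<Rightarrow> bool" where
  "mhom R M N f \<longleftrightarrow> (\<forall>x\<in>carrier M. f x \<in> carrier N) \<and>
     (\<forall>x\<in>carrier M. \<forall>y\<in>carrier M. f (x \<oplus>\<^bsub>M\<^esub> y) = f x \<oplus>\<^bsub>N\<^esub> f y) \<and>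
     (\<forall>a\<in>carrier R. \<forall>x\<in>carrier M. f (a \<odot>\<^bsub>M\<^esub> x) = a \<odot>\<^bsub>N\<^esub> f x)"

definition smod :: "'u ring \<Rightarrow> ('u, 'a) module \<Rightarrow> 'a set \<Rightarrow> bool" where
  "smod R M N \<longleftrightarrow> N \<subseteq> carrier M \<and> \<zero>\<^bsub>M\<^esub> \<in> N \<and> (\<forall>x\<in>N. \<forall>y\<in>N. x \<oplus>\<^bsub>M\<^esub> y \<in> N) \<and>
     (\<forall>a\<in>carrier R. \<forall>x\<in>N. a \<odot>\<^bsub>M\<^esub> x \<in> N)"

text \<open>The inclusion is the identity function, which is what later turns unions of chains into
  colimits. Only the data that matter for a module are compared: the fields \<open>mult\<close> and
  \<open>one\<close> may differ.\<close>

definition msub :: "'u ring \<Rightarrow> ('u, 'a) module \<Rightarrow> ('u, 'a) module \<Rightarrow> bool" where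
  "msub R M N \<longleftrightarrow> carrier M \<subseteq> carrier N \<and> \<zero>\<^bsub>M\<^esub> = \<zero>\<^bsub>N\<^esub> \<and>
     (\<forall>x\<in>carrier M. \<forall>y\<in>carrier M. x \<oplus>\<^bsub>M\<^esub> y = x \<oplus>\<^bsub>N\<^esub> y) \<and>
     (\<forall>a\<in>carrier R. \<forall>x\<in>carrier M. a \<odot>\<^bsub>M\<^esub> x = a \<odot>\<^bsub>N\<^esub> x)"

lemma left_moduleI:
  fixes R :: "'u ring" and M :: "('u, 'a) module"
  assumes "ring R"
    and "\<And>x y. x \<in> carrier M \<Longrightarrow> y \<in> carrier M \<Longrightarrow> x \<oplus>\<^bsub>M\<^esub> y \<in> carrier M"
    and "\<zero>\<^bsub>M\<^esub> \<in> carrier M"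
    and "\<And>x y z. x \<in> carrier M \<Longrightarrow> y \<in> carrier M \<Longrightarrow> z \<in> carrier M \<Longrightarrow>
      (x \<oplus>\<^bsub>M\<^esub> y) \<oplus>\<^bsub>M\<^esub> z = x \<oplus>\<^bsub>M\<^esub> (y \<oplus>\<^bsub>M\<^esub> z)"
    and "\<And>x y. x \<in> carrier M \<Longrightarrow> y \<in> carrier M \<Longrightarrow> x \<oplus>\<^bsub>M\<^esub> y = y \<oplus>\<^bsub>M\<^esub> x"
    and "\<And>x. x \<in> carrier M \<Longrightarrow> \<zero>\<^bsub>M\<^esub> \<oplus>\<^bsub>M\<^esub> x = x"
    and "\<And>x. x \<in> carrier M \<Longrightarrow> \<exists>y\<in>carrier M. y \<oplus>\<^bsub>M\<^esub> x = \<zero>\<^bsub>M\<^esub>"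
    and "\<And>a x. a \<in> carrier R \<Longrightarrow> x \<in> carrier M \<Longrightarrow> a \<odot>\<^bsub>M\<^esub> x \<in> carrier M"
    and "\<And>a b x. a \<in> carrier R \<Longrightarrow> b \<in> carrier R \<Longrightarrow> x \<in> carrier M \<Longrightarrow>
       (a \<oplus>\<^bsub>R\<^esub> b) \<odot>\<^bsub>M\<^esub> x = a \<odot>\<^bsub>M\<^esub> x \<oplus>\<^bsub>M\<^esub> b \<odot>\<^bsub>M\<^esub> x"
    and "\<And>a x y. a \<in> carrier R \<Longrightarrow> x \<in> carrier M \<Longrightarrow> y \<in> carrier M \<Longrightarrow>
       a \<odot>\<^bsub>M\<^esub> (x \<oplus>\<^bsub>M\<^esub> y) = a \<odot>\<^bsub>M\<^esub> x \<oplus>\<^bsub>M\<^esub> a \<odot>\<^bsub>M\<^esub> y"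
    and "\<And>a b x. a \<in> carrier R \<Longrightarrow> b \<in> carrier R \<Longrightarrow> x \<in> carrier M \<Longrightarrow>
       (a \<otimes>\<^bsub>R\<^esub> b) \<odot>\<^bsub>M\<^esub> x = a \<odot>\<^bsub>M\<^esub> (b \<odot>\<^bsub>M\<^esub> x)"
    and "\<And>x. x \<in> carrier M \<Longrightarrow> \<one>\<^bsub>R\<^esub> \<odot>\<^bsub>M\<^esub> x = x"
  shows "left_module R M"
  by (intro left_module.intro left_module_axioms.intro abelian_groupI) (use assms in auto)

context left_module
begin

lemma a_inv_zero: "\<ominus>\<^bsub>M\<^esub> \<zero>\<^bsub>M\<^esub> = \<zero>\<^bsub>M\<^esub>"
  by (rule M.minus_equality) simp_all

lemma smult_zero: assumes "a \<in> carrier R" shows "a \<odot>\<^bsub>M\<^esub> \<zero>\<^bsub>M\<^esub> = \<zero>\<^bsub>M\<^esub>"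
proof -
  have "a \<odot>\<^bsub>M\<^esub> \<zero>\<^bsub>M\<^esub> \<oplus>\<^bsub>M\<^esub> a \<odot>\<^bsub>M\<^esub> \<zero>\<^bsub>M\<^esub> = a \<odot>\<^bsub>M\<^esub> \<zero>\<^bsub>M\<^esub>"
    using smult_r_distr[OF assms, of "\<zero>\<^bsub>M\<^esub>" "\<zero>\<^bsub>M\<^esub>"] by simp
  then show ?thesis using smult_closed[OF assms, of "\<zero>\<^bsub>M\<^esub>"] M.add.l_cancel_one by simp
qed

lemma zero_smult: assumes "x \<in> carrier M" shows "\<zero> \<odot>\<^bsub>M\<^esub> x = \<zero>\<^bsub>M\<^esub>"
proof -
  have "\<zero> \<odot>\<^bsub>M\<^esub> x \<oplus>\<^bsub>M\<^esub> \<zero> \<odot>\<^bsub>M\<^esub> x = \<zero> \<odot>\<^bsub>M\<^esub> x"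
    using smult_l_distr[of \<zero> \<zero> x] assms by simp
  then show ?thesis using smult_closed[of \<zero> x] assms M.add.l_cancel_one by simp
qed

lemma minus_one_smult: assumes "x \<in> carrier M" shows "(\<ominus> \<one>) \<odot>\<^bsub>M\<^esub> x = \<ominus>\<^bsub>M\<^esub> x"
proof -
  have "(\<ominus> \<one>) \<odot>\<^bsub>M\<^esub> x \<oplus>\<^bsub>M\<^esub> x = (\<ominus> \<one> \<oplus> \<one>) \<odot>\<^bsub>M\<^esub> x"
    using assms smult_l_distr[of "\<ominus> \<one>" \<one> x] by (simp add: smult_one)
  also have "\<dots> = \<zero>\<^bsub>M\<^esub>" using assms by (simp add: R.l_neg zero_smult)
  finally show ?thesis
    using assms M.minus_equality smult_closed by (metis R.a_inv_closed R.one_closed)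
qed

lemma smult_minus:
  assumes "a \<in> carrier R" "x \<in> carrier M" shows "a \<odot>\<^bsub>M\<^esub> (\<ominus>\<^bsub>M\<^esub> x) = \<ominus>\<^bsub>M\<^esub> (a \<odot>\<^bsub>M\<^esub> x)"
proof -
  have "a \<odot>\<^bsub>M\<^esub> (\<ominus>\<^bsub>M\<^esub> x) \<oplus>\<^bsub>M\<^esub> a \<odot>\<^bsub>M\<^esub> x = \<zero>\<^bsub>M\<^esub>"
    using assms smult_r_distr[of a "\<ominus>\<^bsub>M\<^esub> x" x] by (simp add: M.l_neg smult_zero)
  then show ?thesis using assms M.minus_equality smult_closed by simp
qed

end

text \<open>Negation is the action of minus one, which is why \<open>smod\<close> does not list
  it.\<close>

lemma smod_minus:
  assumes "left_module R M" "smod R M N" "x \<in> N" shows "\<ominus>\<^bsub>M\<^esub> x \<in> N"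
proof -
  interpret M: left_module R M by fact
  show ?thesis
    using M.minus_one_smult[of x] assms(2,3) unfolding smod_def
    by (metis M.R.a_inv_closed M.R.one_closed subsetD)
qed

lemma left_module_restrict:
  assumes "left_module R M" "smod R M N" shows "left_module R (M\<lparr>carrier := N\<rparr>)"
proof -
  interpret M: left_module R M by fact
  have N: "\<And>x. x \<in> N \<Longrightarrow> x \<in> carrier M" using assms unfolding smod_def by blast
  show ?thesis
  proof (rule left_moduleI)
    fix x assume "x \<in> carrier (M\<lparr>carrier := N\<rparr>)"
    then show "\<exists>y\<in>carrier (M\<lparr>carrier := N\<rparr>). y \<oplus>\<^bsub>M\<lparr>carrier := N\<rparr>\<^esub> x = \<zero>\<^bsub>M\<lparr>carrier := N\<rparr>\<^esub>"
      using smod_minus[OF assms] N by (intro bexI[of _ "\<ominus>\<^bsub>M\<^esub> x"]) (auto simp: M.M.l_neg)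
  qed (use assms(2) in \<open>auto simp: smod_def N M.M.a_assoc M.smult_l_distr
        M.smult_r_distr M.smult_assoc M.smult_one left_module.axioms(1)[OF assms(1)] intro!: M.M.a_comm\<close>)
qed

lemma mhomD:
  assumes "mhom R M N f"
  shows "x \<in> carrier M \<Longrightarrow> f x \<in> carrier N"
    and "x \<in> carrier M \<Longrightarrow> y \<in> carrier M \<Longrightarrow> f (x \<oplus>\<^bsub>M\<^esub> y) = f x \<oplus>\<^bsub>N\<^esub> f y"
    and "a \<in> carrier R \<Longrightarrow> x \<in> carrier M \<Longrightarrow> f (a \<odot>\<^bsub>M\<^esub> x) = a \<odot>\<^bsub>N\<^esub> f x"
  using assms unfolding mhom_def by auto

lemma mhom_zero:
  assumes "mhom R M N f" "left_module R M" "left_module R N" shows "f \<zero>\<^bsub>M\<^esub> = \<zero>\<^bsub>N\<^esub>"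
proof -
  interpret M: left_module R M by fact
  interpret N: left_module R N by fact
  have "f \<zero>\<^bsub>M\<^esub> \<oplus>\<^bsub>N\<^esub> f \<zero>\<^bsub>M\<^esub> = f \<zero>\<^bsub>M\<^esub>"
    using mhomD(2)[OF assms(1), of "\<zero>\<^bsub>M\<^esub>" "\<zero>\<^bsub>M\<^esub>"] by simp
  then show ?thesis using mhomD(1)[OF assms(1), of "\<zero>\<^bsub>M\<^esub>"] N.add.l_cancel_one by simp
qed

lemma mhom_a_inv:
  assumes "mhom R M N f" "left_module R M" "left_module R N" "x \<in> carrier M"
  shows "f (\<ominus>\<^bsub>M\<^esub> x) = \<ominus>\<^bsub>N\<^esub> f x"
proof -
  interpret M: left_module R M by fact
  interpret N: left_module R N by fact
  show ?thesis
    using mhomD[OF assms(1)] assms(4) M.minus_one_smult[symmetric] N.minus_one_smult[symmetric] by simp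
qed

lemma mhom_minus:
  assumes "mhom R M N f" "left_module R M" "left_module R N" "x \<in> carrier M" "y \<in> carrier M"
  shows "f (x \<ominus>\<^bsub>M\<^esub> y) = f x \<ominus>\<^bsub>N\<^esub> f y"
proof -
  interpret M: left_module R M by fact
  interpret N: left_module R N by fact
  show ?thesis
    using mhomD[OF assms(1)] mhom_a_inv[OF assms(1-3)] assms(4,5) by (simp add: M.M.minus_eq N.M.minus_eq)
qed

lemma mhom_ident: "mhom R M M (\<lambda>x. x)"
  unfolding mhom_def by simp

lemma mhom_comp: "mhom R M N f \<Longrightarrow> mhom R N L g \<Longrightarrow> mhom R M L (\<lambda>x. g (f x))"
  unfolding mhom_def by simp

lemma mhom_const_zero: "left_module R N \<Longrightarrow> mhom R M N (\<lambda>x. \<zero>\<^bsub>N\<^esub>)"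
proof -
  assume "left_module R N"
  then interpret N: left_module R N .
  show ?thesis unfolding mhom_def by (simp add: N.smult_zero)
qed

lemma mhom_add:
  assumes "left_module R N" "mhom R M N f" "mhom R M N g"
  shows "mhom R M N (\<lambda>x. f x \<oplus>\<^bsub>N\<^esub> g x)"
proof -
  interpret N: left_module R N by fact
  show ?thesis
    using assms(2,3) unfolding mhom_def by (simp add: N.smult_r_distr N.M.a_ac)
qed

lemma mhom_uminus:
  assumes "left_module R N" "mhom R M N f" shows "mhom R M N (\<lambda>x. \<ominus>\<^bsub>N\<^esub> f x)"
proof -
  interpret N: left_module R N by fact
  show ?thesis
    using assms(2) unfolding mhom_def by (simp add: N.smult_minus N.M.minus_add)
qed

lemma mhom_diff:
  assumes "left_module R N" "mhom R M N f" "mhom R M N g"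
  shows "mhom R M N (\<lambda>x. f x \<ominus>\<^bsub>N\<^esub> g x)"
  unfolding a_minus_def using assms by (intro mhom_add mhom_uminus)

lemma mhom_cong: "mhom R M N f \<Longrightarrow> left_module R M \<Longrightarrow> (\<And>x. x \<in> carrier M \<Longrightarrow> f x = g x) \<Longrightarrow> mhom R M N g"
proof -
  assume f: "mhom R M N f" and "left_module R M" and eq: "\<And>x. x \<in> carrier M \<Longrightarrow> f x = g x"
  interpret M: left_module R M by fact
  show ?thesis using f unfolding mhom_def by (simp add: eq[symmetric] M.smult_closed)
qed

lemma mhom_into_restrict:
  "mhom R M N f \<Longrightarrow> (\<And>x. x \<in> carrier M \<Longrightarrow> f x \<in> A) \<Longrightarrow> mhom R M (N\<lparr>carrier := A\<rparr>) f"
  unfolding mhom_def by simp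

lemma mhom_from_restrict: "mhom R M N f \<Longrightarrow> A \<subseteq> carrier M \<Longrightarrow> mhom R (M\<lparr>carrier := A\<rparr>) N f"
  unfolding mhom_def by (simp add: subset_iff)

lemma left_mod_homD: "f \<in> left_mod_hom R M N \<Longrightarrow> mhom R M N f"
  unfolding left_mod_hom_def mhom_def by auto

lemma left_mod_hom_restrict:
  assumes "mhom R M N f" "left_module R M" shows "restrict f (carrier M) \<in> left_mod_hom R M N"
proof -
  interpret M: left_module R M by fact
  show ?thesis using assms(1) unfolding left_mod_hom_def mhom_def by (auto simp: M.smult_closed)
qed

lemma kernel_smod:
  assumes "mhom R M N f" "left_module R M" "left_module R N"
  shows "smod R M {x \<in> carrier M. f x = \<zero>\<^bsub>N\<^esub>}"
proof -
  interpret M: left_module R M by fact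
  interpret N: left_module R N by fact
  show ?thesis
    using mhomD[OF assms(1)] mhom_zero[OF assms]
    unfolding smod_def by (auto simp: M.smult_closed N.smult_zero)
qed

text \<open>Two preimages under \<open>p\<close> differ by an element that \<open>t\<close> kills,
  so \<open>t\<close> may be evaluated at an arbitrarily chosen preimage.\<close>

lemma mhom_factor_epi:
  assumes "mhom R P S p" "mhom R P E t" "left_module R P" "left_module R S" "left_module R E"
    and surj: "p ` carrier P = carrier S"
    and ker: "\<And>x. x \<in> carrier P \<Longrightarrow> p x = \<zero>\<^bsub>S\<^esub> \<Longrightarrow> t x = \<zero>\<^bsub>E\<^esub>"
  obtains s where "mhom R S E s" "\<And>x. x \<in> carrier P \<Longrightarrow> s (p x) = t x"
proof -
  interpret P: left_module R P by fact
  interpret S: left_module R S by fact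
  interpret E: left_module R E by fact
  note p = mhomD[OF assms(1)] and t = mhomD[OF assms(2)]
  have eq: "t x = t y" if "x \<in> carrier P" "y \<in> carrier P" "p x = p y" for x y
  proof -
    have "p (x \<ominus>\<^bsub>P\<^esub> y) = \<zero>\<^bsub>S\<^esub>"
      using that p by (simp add: mhom_minus[OF assms(1,3,4)] S.M.r_neg S.M.minus_eq)
    then have "t x \<ominus>\<^bsub>E\<^esub> t y = \<zero>\<^bsub>E\<^esub>"
      using ker[of "x \<ominus>\<^bsub>P\<^esub> y"] that by (simp add: mhom_minus[OF assms(2,3,5)])
    then show ?thesis using that t by (simp add: E.M.minus_eq E.M.add.inv_solve_right' E.M.add.inv_closed flip: E.M.minus_equality)
  qed
  define s where "s y = t (inv_into (carrier P) p y)" for y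
  have s: "s (p x) = t x" if "x \<in> carrier P" for x
    unfolding s_def using that by (intro eq) (auto intro: inv_into_into f_inv_into_f)
  have "mhom R S E s"
    unfolding mhom_def surj[symmetric]
    using s p t by (auto simp: P.smult_closed simp flip: p(2,3))
  then show thesis using s that by blast
qed

lemma mhom_lift_mono:
  assumes "mhom R X E f" "mhom R P E t" "left_module R P" "left_module R X"
    and inj: "inj_on f (carrier X)" and im: "t ` carrier P \<subseteq> f ` carrier X"
  obtains u where "mhom R P X u" "\<And>x. x \<in> carrier P \<Longrightarrow> f (u x) = t x"
proof -
  interpret P: left_module R P by fact
  interpret X: left_module R X by fact
  note f = mhomD[OF assms(1)] and t = mhomD[OF assms(2)]
  define u where "u y = inv_into (carrier X) f (t y)" for y
  have u: "u x \<in> carrier X" "f (u x) = t x" if "x \<in> carrier P" for x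
  proof -
    have "t x \<in> f ` carrier X" using that im by blast
    then show "u x \<in> carrier X" "f (u x) = t x"
      unfolding u_def by (rule inv_into_into, rule f_inv_into_f)
  qed
  have "mhom R P X u"
    unfolding mhom_def
    using u f t by (auto simp: P.smult_closed X.smult_closed intro!: inj_onD[OF inj])
  then show thesis using u that by blast
qed


section \<open>Quotients and pushouts of modules\<close>

locale module_universe = universe "TYPE('u)" + ring R for R :: "'u ring" (structure) +
  assumes small_ring: "small TYPE('u) (carrier R)"
begin

lemma mod_objectsD: "M \<in> mod_objects R \<Longrightarrow> left_module R M" "M \<in> mod_objects R \<Longrightarrow> small TYPE('u) (carrier M)"
  unfolding mod_objects_def by auto

lemma mod_objects_restrict:
  assumes "M \<in> mod_objects R" "smod R M N" shows "M\<lparr>carrier := N\<rparr> \<in> mod_objects R"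
  using left_module_restrict[OF mod_objectsD(1)[OF assms(1)] assms(2)]
    small_subset[OF mod_objectsD(2)[OF assms(1)], of N] assms(2)
  unfolding mod_objects_def smod_def by simp

text \<open>The map \<open>e\<close> prescribes the names of some elements of the quotient.\<close>

lemma quotient_exists:
  fixes D :: "('u, 'a) module" and e :: "'a \<Rightarrow> 'u"
  assumes D: "left_module R D" and N: "smod R D N" and small: "small TYPE('u) (carrier D)"
    and W: "W \<subseteq> carrier D" and inj: "inj_on e W"
    and disj: "\<forall>w\<in>W. \<forall>w'\<in>W. \<forall>n\<in>N. w = n \<oplus>\<^bsub>D\<^esub> w' \<longrightarrow> w = w'"
  obtains Q q where "Q \<in> mod_objects R" "mhom R D Q q" "q ` carrier D = carrier Q"
    "\<And>x y. x \<in> carrier D \<Longrightarrow> y \<in> carrier D \<Longrightarrow> q x = q y \<longleftrightarrow> (\<exists>n\<in>N. x = n \<oplus>\<^bsub>D\<^esub> y)"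
    "\<And>x. x \<in> carrier D \<Longrightarrow> q x = \<zero>\<^bsub>Q\<^esub> \<longleftrightarrow> x \<in> N"
    "\<And>w. w \<in> W \<Longrightarrow> q w = e w"
proof -
  interpret D: left_module R D by fact
  have NC: "\<And>n. n \<in> N \<Longrightarrow> n \<in> carrier D" and N0: "\<zero>\<^bsub>D\<^esub> \<in> N"
    and Nadd: "\<And>m n. m \<in> N \<Longrightarrow> n \<in> N \<Longrightarrow> m \<oplus>\<^bsub>D\<^esub> n \<in> N"
    and Nsm: "\<And>a n. a \<in> carrier R \<Longrightarrow> n \<in> N \<Longrightarrow> a \<odot>\<^bsub>D\<^esub> n \<in> N"
    using N unfolding smod_def by auto
  note Nminus = smod_minus[OF D N]
  define rel where "rel x y \<longleftrightarrow> (\<exists>n\<in>N. x = n \<oplus>\<^bsub>D\<^esub> y)" for x y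
  have rel_refl: "rel x x" if "x \<in> carrier D" for x
    unfolding rel_def using that N0 by (metis D.M.l_zero)
  have rel_sym: "rel y x" if "rel x y" "y \<in> carrier D" for x y
  proof -
    obtain n where n: "n \<in> N" "x = n \<oplus>\<^bsub>D\<^esub> y" using \<open>rel x y\<close> unfolding rel_def by blast
    then have "y = (\<ominus>\<^bsub>D\<^esub> n) \<oplus>\<^bsub>D\<^esub> x" using that NC by (simp add: D.M.r_neg1)
    then show ?thesis unfolding rel_def using Nminus n by blast
  qed
  have rel_trans: "rel x z" if r: "rel x y" "rel y z" "z \<in> carrier D" for x y z
  proof -
    obtain m n where "m \<in> N" "x = m \<oplus>\<^bsub>D\<^esub> y" "n \<in> N" "y = n \<oplus>\<^bsub>D\<^esub> z"
      using r unfolding rel_def by blast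
    then have "x = (m \<oplus>\<^bsub>D\<^esub> n) \<oplus>\<^bsub>D\<^esub> z" using that NC by (simp add: D.M.a_assoc)
    then show ?thesis unfolding rel_def using Nadd \<open>m \<in> N\<close> \<open>n \<in> N\<close> by blast
  qed
  have rel_add: "rel (x \<oplus>\<^bsub>D\<^esub> x') (y \<oplus>\<^bsub>D\<^esub> y')"
    if r: "rel x y" "rel x' y'" "y \<in> carrier D" "y' \<in> carrier D" for x x' y y'
  proof -
    obtain m n where "m \<in> N" "x = m \<oplus>\<^bsub>D\<^esub> y" "n \<in> N" "x' = n \<oplus>\<^bsub>D\<^esub> y'"
      using r unfolding rel_def by blast
    then have "x \<oplus>\<^bsub>D\<^esub> x' = (m \<oplus>\<^bsub>D\<^esub> n) \<oplus>\<^bsub>D\<^esub> (y \<oplus>\<^bsub>D\<^esub> y')" using that NC by (simp add: D.M.a_ac)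
    then show ?thesis unfolding rel_def using Nadd \<open>m \<in> N\<close> \<open>n \<in> N\<close> by blast
  qed
  have rel_smult: "rel (a \<odot>\<^bsub>D\<^esub> x) (a \<odot>\<^bsub>D\<^esub> y)"
    if "rel x y" "a \<in> carrier R" "y \<in> carrier D" for a x y
    using that Nsm NC unfolding rel_def by (metis D.smult_r_distr)
  define cls where "cls x = {y \<in> carrier D. rel x y}" for x
  have cls_eq: "cls x = cls y \<longleftrightarrow> rel x y" if xy: "x \<in> carrier D" "y \<in> carrier D" for x y
  proof
    assume "cls x = cls y"
    moreover have "y \<in> cls y" unfolding cls_def using rel_refl xy by simp
    ultimately show "rel x y" unfolding cls_def by blast
  next
    assume r: "rel x y"
    then have "rel y x" using rel_sym xy by blast
    then show "cls x = cls y" using r rel_trans xy unfolding cls_def by blast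
  qed
  have clsW: "inj_on cls W"
    using W disj cls_eq unfolding rel_def by (intro inj_onI) (metis subsetD)
  have "small TYPE('u) (cls ` carrier D)" "small TYPE('u) (e ` W)"
    using small small_image small_subset[OF small W] by blast+
  then obtain j :: "'a set \<Rightarrow> 'u" where j: "inj_on j (cls ` carrier D)" "j ` (cls ` carrier D) \<inter> e ` W = {}"
    using small_encode_avoiding by blast
  \<comment> \<open>Classes of members of \<open>W\<close> receive the prescribed name, all others a
    code outside the image of \<open>W\<close> under \<open>e\<close>.\<close>
  define f where "f c = (if c \<in> cls ` W then e (inv_into W cls c) else j c)" for c
  have f_inj: "inj_on f (cls ` carrier D)"
  proof (rule inj_onI)
    fix c c' assume c: "c \<in> cls ` carrier D" "c' \<in> cls ` carrier D" and eq: "f c = f c'"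
    show "c = c'"
    proof (cases "c \<in> cls ` W"; cases "c' \<in> cls ` W")
      assume "c \<in> cls ` W" "c' \<in> cls ` W"
      then obtain w w' where "w \<in> W" "w' \<in> W" "c = cls w" "c' = cls w'" by blast
      then show ?thesis using eq clsW inj_onD[OF inj, of w w'] unfolding f_def by simp
    next
      assume "c \<in> cls ` W" "c' \<notin> cls ` W"
      then obtain w where "w \<in> W" "c = cls w" by blast
      then have "j c' = e w" using eq clsW \<open>c' \<notin> cls ` W\<close> unfolding f_def by simp
      then have "j c' \<in> e ` W" using \<open>w \<in> W\<close> by simp
      then show ?thesis using j c by blast
    next
      assume "c \<notin> cls ` W" "c' \<in> cls ` W"
      then obtain w where "w \<in> W" "c' = cls w" by blast
      then have "j c = e w" using eq clsW \<open>c \<notin> cls ` W\<close> unfolding f_def by simp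
      then have "j c \<in> e ` W" using \<open>w \<in> W\<close> by simp
      then show ?thesis using j c by blast
    next
      assume "c \<notin> cls ` W" "c' \<notin> cls ` W"
      then show ?thesis using eq inj_onD[OF j(1)] c unfolding f_def by simp
    qed
  qed
  define q where "q x = f (cls x)" for x
  have q_eq: "q x = q y \<longleftrightarrow> rel x y" if "x \<in> carrier D" "y \<in> carrier D" for x y
    unfolding q_def using inj_on_eq_iff[OF f_inj] cls_eq that by auto
  have qW: "q w = e w" if "w \<in> W" for w
    unfolding q_def f_def using that clsW by simp
  define pre where "pre = inv_into (carrier D) q"
  define Q :: "('u, 'u) module" where "Q = \<lparr>carrier = q ` carrier D, monoid.mult = undefined, one = undefined,
    zero = q \<zero>\<^bsub>D\<^esub>, add = (\<lambda>x y. q (pre x \<oplus>\<^bsub>D\<^esub> pre y)), smult = (\<lambda>a x. q (a \<odot>\<^bsub>D\<^esub> pre x))\<rparr>"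
  have pre: "pre (q x) \<in> carrier D" "rel (pre (q x)) x" if "x \<in> carrier D" for x
  proof -
    have "q x \<in> q ` carrier D" using that by blast
    from inv_into_into[OF this] f_inv_into_f[OF this]
    show "pre (q x) \<in> carrier D" "rel (pre (q x)) x"
      using q_eq that unfolding pre_def by blast+
  qed
  have q_add: "q x \<oplus>\<^bsub>Q\<^esub> q y = q (x \<oplus>\<^bsub>D\<^esub> y)" if "x \<in> carrier D" "y \<in> carrier D" for x y
    using that pre rel_add by (simp add: Q_def q_eq)
  have q_smult: "a \<odot>\<^bsub>Q\<^esub> q x = q (a \<odot>\<^bsub>D\<^esub> x)" if "a \<in> carrier R" "x \<in> carrier D" for a x
    using that pre rel_smult by (simp add: Q_def q_eq D.smult_closed)
  have Q_zero: "\<zero>\<^bsub>Q\<^esub> = q \<zero>\<^bsub>D\<^esub>" and Q_carrier: "carrier Q = q ` carrier D"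
    by (simp_all add: Q_def)
  have "left_module R Q"
  proof (rule left_moduleI)
    fix x assume "x \<in> carrier Q"
    then obtain x' where x': "x' \<in> carrier D" "x = q x'" using Q_carrier by blast
    then have "q (\<ominus>\<^bsub>D\<^esub> x') \<oplus>\<^bsub>Q\<^esub> x = \<zero>\<^bsub>Q\<^esub>" by (simp add: q_add Q_zero D.M.l_neg)
    then show "\<exists>y\<in>carrier Q. y \<oplus>\<^bsub>Q\<^esub> x = \<zero>\<^bsub>Q\<^esub>" using x' Q_carrier by auto
  qed (auto simp: Q_carrier Q_zero q_add q_smult D.smult_closed D.M.a_ac D.smult_l_distr
      D.smult_r_distr D.smult_assoc D.smult_one ring_axioms)
  then have "Q \<in> mod_objects R"
    unfolding mod_objects_def using small_image[OF small] Q_carrier by simp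
  moreover have "mhom R D Q q"
    unfolding mhom_def by (simp add: Q_carrier q_add q_smult)
  moreover have "q x = \<zero>\<^bsub>Q\<^esub> \<longleftrightarrow> x \<in> N" if "x \<in> carrier D" for x
    unfolding Q_zero using that q_eq[of x "\<zero>\<^bsub>D\<^esub>"] NC unfolding rel_def by (auto intro!: bexI[of _ x])
  moreover have "q x = q y \<longleftrightarrow> (\<exists>n\<in>N. x = n \<oplus>\<^bsub>D\<^esub> y)" if "x \<in> carrier D" "y \<in> carrier D" for x y
    using q_eq[OF that] unfolding rel_def .
  ultimately show thesis
    by (intro that[of Q q] Q_carrier[symmetric] qW)
qed

text \<open>\<open>Z\<close> is the pushout of \<open>P\<close> and \<open>W\<close> along \<open>K \<subseteq> P\<close> and \<open>\<phi>: K \<rightarrow> W\<close>, chosen such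
  that \<open>W\<close> is a submodule of \<open>Z\<close>.\<close>

definition pushout where
  "pushout W P K \<phi> Z \<psi> \<longleftrightarrow> W \<in> mod_objects R \<and> P \<in> mod_objects R \<and> Z \<in> mod_objects R \<and>
     smod R P K \<and> mhom R (P\<lparr>carrier := K\<rparr>) W \<phi> \<and> msub R W Z \<and> mhom R P Z \<psi> \<and>
     (\<forall>k\<in>K. \<psi> k = \<phi> k) \<and>
     (\<forall>z\<in>carrier Z. \<exists>w\<in>carrier W. \<exists>p\<in>carrier P. z = w \<oplus>\<^bsub>Z\<^esub> \<psi> p) \<and>
     (\<forall>p\<in>carrier P. \<psi> p \<in> carrier W \<longrightarrow> p \<in> K)"

text \<open>\<open>Z\<close> is the direct sum of \<open>W\<close> and \<open>P\<close> modulo the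
  copy of \<open>K\<close> formed by the pairs (-\<phi> k, k). This copy meets the summand
  \<open>W\<close> only in zero, so the quotient can be given the names of \<open>W\<close>
  itself.\<close>

lemma pushout_exists:
  assumes W: "W \<in> mod_objects R" and P: "P \<in> mod_objects R" and K: "smod R P K"
    and phi: "mhom R (P\<lparr>carrier := K\<rparr>) W \<phi>"
  obtains Z \<psi> where "pushout W P K \<phi> Z \<psi>"
proof -
  interpret W: left_module R W using W by (rule mod_objectsD)
  interpret P: left_module R P using P by (rule mod_objectsD)
  have KC: "\<And>n. n \<in> K \<Longrightarrow> n \<in> carrier P" and K0: "\<zero>\<^bsub>P\<^esub> \<in> K"
    and Kadd: "\<And>m n. m \<in> K \<Longrightarrow> n \<in> K \<Longrightarrow> m \<oplus>\<^bsub>P\<^esub> n \<in> K"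
    and Ksm: "\<And>a n. a \<in> carrier R \<Longrightarrow> n \<in> K \<Longrightarrow> a \<odot>\<^bsub>P\<^esub> n \<in> K"
    using K unfolding smod_def by auto
  have ph: "\<And>k. k \<in> K \<Longrightarrow> \<phi> k \<in> carrier W"
    "\<And>k l. k \<in> K \<Longrightarrow> l \<in> K \<Longrightarrow> \<phi> (k \<oplus>\<^bsub>P\<^esub> l) = \<phi> k \<oplus>\<^bsub>W\<^esub> \<phi> l"
    "\<And>a k. a \<in> carrier R \<Longrightarrow> k \<in> K \<Longrightarrow> \<phi> (a \<odot>\<^bsub>P\<^esub> k) = a \<odot>\<^bsub>W\<^esub> \<phi> k"
    using mhomD[OF phi] by auto
  have ph0: "\<phi> \<zero>\<^bsub>P\<^esub> = \<zero>\<^bsub>W\<^esub>"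
    using mhom_zero[OF phi left_module_restrict[OF P.left_module_axioms K] W.left_module_axioms] by simp
  define D :: "('u, 'u \<times> 'u) module" where
    "D = \<lparr>carrier = carrier W \<times> carrier P, monoid.mult = undefined, one = undefined,
       zero = (\<zero>\<^bsub>W\<^esub>, \<zero>\<^bsub>P\<^esub>), add = (\<lambda>(w, p) (w', p'). (w \<oplus>\<^bsub>W\<^esub> w', p \<oplus>\<^bsub>P\<^esub> p')),
       smult = (\<lambda>a (w, p). (a \<odot>\<^bsub>W\<^esub> w, a \<odot>\<^bsub>P\<^esub> p))\<rparr>"
  have Dm: "left_module R D"
  proof (rule left_moduleI)
    fix x assume "x \<in> carrier D"
    then obtain w p where "x = (w, p)" "w \<in> carrier W" "p \<in> carrier P" unfolding D_def by auto
    then show "\<exists>y\<in>carrier D. y \<oplus>\<^bsub>D\<^esub> x = \<zero>\<^bsub>D\<^esub>"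
      by (intro bexI[of _ "(\<ominus>\<^bsub>W\<^esub> w, \<ominus>\<^bsub>P\<^esub> p)"]) (auto simp: D_def W.M.l_neg P.M.l_neg)
  qed (auto simp: D_def W.M.a_ac P.M.a_ac W.smult_closed P.smult_closed
      W.smult_l_distr P.smult_l_distr W.smult_r_distr P.smult_r_distr W.smult_assoc P.smult_assoc
      W.smult_one P.smult_one ring_axioms)
  define N where "N = {(\<ominus>\<^bsub>W\<^esub> \<phi> k, k) | k. k \<in> K}"
  have N: "smod R D N"
    unfolding smod_def
  proof (intro conjI ballI)
    show "N \<subseteq> carrier D" unfolding N_def D_def using KC ph by auto
    show "\<zero>\<^bsub>D\<^esub> \<in> N" unfolding N_def D_def using K0 ph0 by (auto simp: W.a_inv_zero intro!: exI[of _ "\<zero>\<^bsub>P\<^esub>"])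
    fix x y assume "x \<in> N" "y \<in> N"
    then obtain k l where "k \<in> K" "l \<in> K" "x = (\<ominus>\<^bsub>W\<^esub> \<phi> k, k)" "y = (\<ominus>\<^bsub>W\<^esub> \<phi> l, l)"
      unfolding N_def by blast
    then show "x \<oplus>\<^bsub>D\<^esub> y \<in> N" unfolding N_def D_def
      using Kadd ph by (auto intro!: exI[of _ "k \<oplus>\<^bsub>P\<^esub> l"] simp: W.M.minus_add)
  next
    fix a x assume "a \<in> carrier R" "x \<in> N"
    then show "a \<odot>\<^bsub>D\<^esub> x \<in> N" unfolding N_def D_def
      using Ksm ph by (auto simp: W.smult_minus)
  qed
  define V where "V = carrier W \<times> {\<zero>\<^bsub>P\<^esub>}"
  have small: "small TYPE('u) (carrier D)"
    unfolding D_def using small_Times[OF mod_objectsD(2)[OF W] mod_objectsD(2)[OF P]] by simp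
  have VD: "V \<subseteq> carrier D" unfolding V_def D_def by auto
  have Vinj: "inj_on fst V" unfolding V_def inj_on_def by auto
  \<comment> \<open>A member of \<open>N\<close> is determined by its second component, and here
    that component is zero.\<close>
  have "w = w'" if w: "w \<in> V" "w' \<in> V" "n \<in> N" "w = n \<oplus>\<^bsub>D\<^esub> w'" for w w' n
  proof -
    obtain k where k: "k \<in> K" "n = (\<ominus>\<^bsub>W\<^esub> \<phi> k, k)" using w unfolding N_def by blast
    then have "k = \<zero>\<^bsub>P\<^esub>" using w KC unfolding V_def D_def by auto
    then show ?thesis using w k ph0 unfolding V_def D_def by (auto simp: W.a_inv_zero)
  qed
  then have Vdisj: "\<forall>w\<in>V. \<forall>w'\<in>V. \<forall>n\<in>N. w = n \<oplus>\<^bsub>D\<^esub> w' \<longrightarrow> w = w'" by blast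
  obtain Z q where Z: "Z \<in> mod_objects R" and q: "mhom R D Z q" "q ` carrier D = carrier Z"
    and qN: "\<And>x y. x \<in> carrier D \<Longrightarrow> y \<in> carrier D \<Longrightarrow> q x = q y \<longleftrightarrow> (\<exists>n\<in>N. x = n \<oplus>\<^bsub>D\<^esub> y)"
    and "\<And>x. x \<in> carrier D \<Longrightarrow> q x = \<zero>\<^bsub>Z\<^esub> \<longleftrightarrow> x \<in> N"
    and qV: "\<And>w. w \<in> V \<Longrightarrow> q w = fst w"
    by (rule quotient_exists[OF Dm N small VD Vinj Vdisj]) (rule that; assumption)
  interpret Z: left_module R Z using Z by (rule mod_objectsD)
  note qD = mhomD[OF q(1)]
  have qW: "q (w, \<zero>\<^bsub>P\<^esub>) = w" if "w \<in> carrier W" for w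
    using qV that unfolding V_def by simp
  have pair: "(w, p) \<in> carrier D \<longleftrightarrow> w \<in> carrier W \<and> p \<in> carrier P" for w p
    unfolding D_def by simp
  define \<psi> where "\<psi> p = q (\<zero>\<^bsub>W\<^esub>, p)" for p
  have "msub R W Z"
    unfolding msub_def
  proof (intro conjI ballI)
    have *: "w \<in> carrier Z" if "w \<in> carrier W" for w using qD(1)[of "(w, \<zero>\<^bsub>P\<^esub>)"] qW that pair by simp
    then show "carrier W \<subseteq> carrier Z" by blast
    show "\<zero>\<^bsub>W\<^esub> = \<zero>\<^bsub>Z\<^esub>"
      using mhom_zero[OF q(1) Dm Z.left_module_axioms] qW[of "\<zero>\<^bsub>W\<^esub>"] by (simp add: D_def)
    fix x y assume "x \<in> carrier W" "y \<in> carrier W"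
    then show "x \<oplus>\<^bsub>W\<^esub> y = x \<oplus>\<^bsub>Z\<^esub> y"
      using qD(2)[of "(x, \<zero>\<^bsub>P\<^esub>)" "(y, \<zero>\<^bsub>P\<^esub>)"] qW[of "x \<oplus>\<^bsub>W\<^esub> y"] qW[of x] qW[of y] by (simp add: D_def)
  next
    fix a x assume "a \<in> carrier R" "x \<in> carrier W"
    then show "a \<odot>\<^bsub>W\<^esub> x = a \<odot>\<^bsub>Z\<^esub> x"
      using qD(3)[of a "(x, \<zero>\<^bsub>P\<^esub>)"] qW[of "a \<odot>\<^bsub>W\<^esub> x"] qW[of x]
      by (simp add: D_def W.smult_closed P.smult_zero)
  qed
  moreover have "mhom R P Z \<psi>"
    unfolding mhom_def \<psi>_def
  proof (intro conjI ballI)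
    fix x y assume "x \<in> carrier P" "y \<in> carrier P"
    then show "q (\<zero>\<^bsub>W\<^esub>, x \<oplus>\<^bsub>P\<^esub> y) = q (\<zero>\<^bsub>W\<^esub>, x) \<oplus>\<^bsub>Z\<^esub> q (\<zero>\<^bsub>W\<^esub>, y)"
      using qD(2)[of "(\<zero>\<^bsub>W\<^esub>, x)" "(\<zero>\<^bsub>W\<^esub>, y)"] by (simp add: D_def)
  next
    fix a x assume "a \<in> carrier R" "x \<in> carrier P"
    then show "q (\<zero>\<^bsub>W\<^esub>, a \<odot>\<^bsub>P\<^esub> x) = a \<odot>\<^bsub>Z\<^esub> q (\<zero>\<^bsub>W\<^esub>, x)"
      using qD(3)[of a "(\<zero>\<^bsub>W\<^esub>, x)"] by (simp add: D_def W.smult_zero)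
  qed (use qD(1) pair in auto)
  moreover have "\<psi> k = \<phi> k" if "k \<in> K" for k
  proof -
    have "(\<zero>\<^bsub>W\<^esub>, k) = (\<ominus>\<^bsub>W\<^esub> \<phi> k, k) \<oplus>\<^bsub>D\<^esub> (\<phi> k, \<zero>\<^bsub>P\<^esub>)"
      using that ph KC by (simp add: D_def W.M.l_neg)
    moreover have "(\<ominus>\<^bsub>W\<^esub> \<phi> k, k) \<in> N" unfolding N_def using that by blast
    ultimately have "\<exists>n\<in>N. (\<zero>\<^bsub>W\<^esub>, k) = n \<oplus>\<^bsub>D\<^esub> (\<phi> k, \<zero>\<^bsub>P\<^esub>)" by blast
    then have "q (\<zero>\<^bsub>W\<^esub>, k) = q (\<phi> k, \<zero>\<^bsub>P\<^esub>)"
      using qN[of "(\<zero>\<^bsub>W\<^esub>, k)" "(\<phi> k, \<zero>\<^bsub>P\<^esub>)"] that ph KC pair by simp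
    then show ?thesis unfolding \<psi>_def using qW ph that by simp
  qed
  moreover have "\<exists>w\<in>carrier W. \<exists>p\<in>carrier P. z = w \<oplus>\<^bsub>Z\<^esub> \<psi> p" if "z \<in> carrier Z" for z
  proof -
    obtain w p where wp: "z = q (w, p)" "w \<in> carrier W" "p \<in> carrier P"
      using \<open>z \<in> carrier Z\<close> pair unfolding q(2)[symmetric] by auto
    then have "z = q (w, \<zero>\<^bsub>P\<^esub>) \<oplus>\<^bsub>Z\<^esub> q (\<zero>\<^bsub>W\<^esub>, p)"
      using qD(2)[of "(w, \<zero>\<^bsub>P\<^esub>)" "(\<zero>\<^bsub>W\<^esub>, p)"] by (simp add: D_def)
    then show ?thesis using wp qW unfolding \<psi>_def by auto
  qed
  \<comment> \<open>If \<psi> p lies in \<open>W\<close>, then (0, p) and (\<psi> p, 0) have the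
    same class, and the member of \<open>N\<close> relating them has second component
    \<open>p\<close>.\<close>
  moreover have "p \<in> K" if p: "p \<in> carrier P" "\<psi> p \<in> carrier W" for p
  proof -
    have "q (\<zero>\<^bsub>W\<^esub>, p) = q (\<psi> p, \<zero>\<^bsub>P\<^esub>)" using qW that unfolding \<psi>_def by simp
    then obtain k where "k \<in> K" "(\<zero>\<^bsub>W\<^esub>, p) = (\<ominus>\<^bsub>W\<^esub> \<phi> k, k) \<oplus>\<^bsub>D\<^esub> (\<psi> p, \<zero>\<^bsub>P\<^esub>)"
      using qN[of "(\<zero>\<^bsub>W\<^esub>, p)" "(\<psi> p, \<zero>\<^bsub>P\<^esub>)"] p pair unfolding N_def by auto
    then show "p \<in> K" using KC by (simp add: D_def)
  qed
  ultimately show thesis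
    by (intro that[of Z \<psi>, unfolded pushout_def] conjI ballI impI W P Z K phi)
qed

text \<open>Every element of \<open>Z\<close> has the form w + \<psi> p, so the value must be a w +
  b p; what needs an argument is that it does not depend on the presentation.\<close>

lemma pushout_universal:
  assumes po: "pushout W P K \<phi> Z \<psi>" and E: "left_module R E"
    and a: "mhom R W E a" and b: "mhom R P E b" and ab: "\<And>k. k \<in> K \<Longrightarrow> b k = a (\<phi> k)"
  obtains c where "mhom R Z E c" "\<And>w. w \<in> carrier W \<Longrightarrow> c w = a w"
    "\<And>p. p \<in> carrier P \<Longrightarrow> c (\<psi> p) = b p"
proof -
  note po = po[unfolded pushout_def]
  interpret W: left_module R W using po mod_objectsD by blast
  interpret P: left_module R P using po mod_objectsD by blast
  interpret Z: left_module R Z using po mod_objectsD by blast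
  interpret E: left_module R E by fact
  have K: "smod R P K" and WZ: "msub R W Z" and psi: "mhom R P Z \<psi>" using po by auto
  note aD = mhomD[OF a] and bD = mhomD[OF b] and pD = mhomD[OF psi]
  note lW = W.left_module_axioms and lP = P.left_module_axioms and lZ = Z.left_module_axioms
  have a0: "a \<zero>\<^bsub>W\<^esub> = \<zero>\<^bsub>E\<^esub>" by (rule mhom_zero[OF a lW E])
  have b0: "b \<zero>\<^bsub>P\<^esub> = \<zero>\<^bsub>E\<^esub>" by (rule mhom_zero[OF b lP E])
  have p0: "\<psi> \<zero>\<^bsub>P\<^esub> = \<zero>\<^bsub>Z\<^esub>" by (rule mhom_zero[OF psi lP lZ])
  have WC: "\<And>w. w \<in> carrier W \<Longrightarrow> w \<in> carrier Z" using WZ unfolding msub_def by blast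
  have Wadd: "\<And>w w'. w \<in> carrier W \<Longrightarrow> w' \<in> carrier W \<Longrightarrow> w \<oplus>\<^bsub>W\<^esub> w' = w \<oplus>\<^bsub>Z\<^esub> w'"
    and Wsm: "\<And>r w. r \<in> carrier R \<Longrightarrow> w \<in> carrier W \<Longrightarrow> r \<odot>\<^bsub>W\<^esub> w = r \<odot>\<^bsub>Z\<^esub> w"
    and W0: "\<zero>\<^bsub>W\<^esub> = \<zero>\<^bsub>Z\<^esub>"
    using WZ unfolding msub_def by auto
  have Wminus: "\<ominus>\<^bsub>W\<^esub> w = \<ominus>\<^bsub>Z\<^esub> w" if "w \<in> carrier W" for w
    using Wsm[of "\<ominus>\<^bsub>R\<^esub> \<one>\<^bsub>R\<^esub>" w, OF _ that] W.minus_one_smult[OF that] Z.minus_one_smult[OF WC[OF that]]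
    by simp
  have wd: "a w \<oplus>\<^bsub>E\<^esub> b p = a w' \<oplus>\<^bsub>E\<^esub> b p'"
    if w: "w \<in> carrier W" "w' \<in> carrier W" and p: "p \<in> carrier P" "p' \<in> carrier P"
      and eq: "w \<oplus>\<^bsub>Z\<^esub> \<psi> p = w' \<oplus>\<^bsub>Z\<^esub> \<psi> p'" for w w' p p'
  proof -
    \<comment> \<open>\<psi> sends this difference into \<open>W\<close>, so by the last clause of
      \<open>pushout\<close> it lies in \<open>K\<close>, where \<open>b\<close> is the composite of
      \<open>a\<close> with \<phi>.\<close>
    let ?k = "p \<ominus>\<^bsub>P\<^esub> p'"
    have "\<psi> ?k = \<psi> p \<ominus>\<^bsub>Z\<^esub> \<psi> p'"
      by (rule mhom_minus[OF psi lP lZ p])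
    moreover have "\<psi> p = (\<ominus>\<^bsub>Z\<^esub> w) \<oplus>\<^bsub>Z\<^esub> (w' \<oplus>\<^bsub>Z\<^esub> \<psi> p')"
      using w p pD WC by (simp flip: eq add: Z.M.r_neg1)
    ultimately have k: "\<psi> ?k = (\<ominus>\<^bsub>Z\<^esub> w) \<oplus>\<^bsub>Z\<^esub> w'"
      using w p pD WC by (simp add: Z.M.minus_eq Z.M.a_assoc Z.M.r_neg)
    also have "\<dots> = (\<ominus>\<^bsub>W\<^esub> w) \<oplus>\<^bsub>W\<^esub> w'" using w by (simp flip: Wadd Wminus)
    finally have kW: "\<psi> ?k = (\<ominus>\<^bsub>W\<^esub> w) \<oplus>\<^bsub>W\<^esub> w'" .
    then have kK: "?k \<in> K" using po p w by simp
    then have "b ?k = a ((\<ominus>\<^bsub>W\<^esub> w) \<oplus>\<^bsub>W\<^esub> w')" using ab po kW by metis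
    also have "\<dots> = (\<ominus>\<^bsub>E\<^esub> a w) \<oplus>\<^bsub>E\<^esub> a w'"
      using w aD mhom_a_inv[OF a W.left_module_axioms E] by simp
    finally have bk: "b ?k = (\<ominus>\<^bsub>E\<^esub> a w) \<oplus>\<^bsub>E\<^esub> a w'" .
    have "b p = b ?k \<oplus>\<^bsub>E\<^esub> b p'"
      using p bD by (simp flip: bD(2) add: P.M.minus_eq P.M.a_assoc P.M.l_neg)
    also have "a w \<oplus>\<^bsub>E\<^esub> \<dots> = a w' \<oplus>\<^bsub>E\<^esub> b p'"
      using bk aD bD w p by (simp add: E.M.a_assoc E.M.r_neg2)
    finally show ?thesis .
  qed
  define c where "c z = (let (w, p) = (SOME (w, p). w \<in> carrier W \<and> p \<in> carrier P \<and> z = w \<oplus>\<^bsub>Z\<^esub> \<psi> p)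
    in a w \<oplus>\<^bsub>E\<^esub> b p)" for z
  have c: "c (w \<oplus>\<^bsub>Z\<^esub> \<psi> p) = a w \<oplus>\<^bsub>E\<^esub> b p" if "w \<in> carrier W" "p \<in> carrier P" for w p
  proof -
    let ?Q = "\<lambda>(w', p'). w' \<in> carrier W \<and> p' \<in> carrier P \<and> w \<oplus>\<^bsub>Z\<^esub> \<psi> p = w' \<oplus>\<^bsub>Z\<^esub> \<psi> p'"
    have "?Q (Eps ?Q)" by (rule someI[of _ "(w, p)"]) (simp add: that)
    moreover obtain w' p' where e: "Eps ?Q = (w', p')" by fastforce
    ultimately show ?thesis unfolding c_def e using wd[OF that(1) _ that(2), of w' p'] by simp
  qed
  have form: "\<exists>w p. w \<in> carrier W \<and> p \<in> carrier P \<and> z = w \<oplus>\<^bsub>Z\<^esub> \<psi> p" if "z \<in> carrier Z" for z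
    using po that by blast
  have "mhom R Z E c"
    unfolding mhom_def
  proof (intro conjI ballI)
    fix x assume "x \<in> carrier Z"
    then show "c x \<in> carrier E" using form[of x] c aD bD by auto
  next
    fix x y assume "x \<in> carrier Z" "y \<in> carrier Z"
    then obtain w p w' p' where *: "w \<in> carrier W" "p \<in> carrier P" "x = w \<oplus>\<^bsub>Z\<^esub> \<psi> p"
      "w' \<in> carrier W" "p' \<in> carrier P" "y = w' \<oplus>\<^bsub>Z\<^esub> \<psi> p'" using form by metis
    then have "x \<oplus>\<^bsub>Z\<^esub> y = (w \<oplus>\<^bsub>W\<^esub> w') \<oplus>\<^bsub>Z\<^esub> \<psi> (p \<oplus>\<^bsub>P\<^esub> p')"
      using WC pD by (simp add: Wadd Z.M.a_ac)
    then have "c (x \<oplus>\<^bsub>Z\<^esub> y) = a (w \<oplus>\<^bsub>W\<^esub> w') \<oplus>\<^bsub>E\<^esub> b (p \<oplus>\<^bsub>P\<^esub> p')"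
      using * c[of "w \<oplus>\<^bsub>W\<^esub> w'" "p \<oplus>\<^bsub>P\<^esub> p'"] by simp
    then show "c (x \<oplus>\<^bsub>Z\<^esub> y) = c x \<oplus>\<^bsub>E\<^esub> c y"
      using * aD bD by (simp add: c E.M.a_ac)
  next
    fix r x assume r: "r \<in> carrier R" and "x \<in> carrier Z"
    then obtain w p where *: "w \<in> carrier W" "p \<in> carrier P" "x = w \<oplus>\<^bsub>Z\<^esub> \<psi> p" using form by metis
    then have "r \<odot>\<^bsub>Z\<^esub> x = (r \<odot>\<^bsub>W\<^esub> w) \<oplus>\<^bsub>Z\<^esub> \<psi> (r \<odot>\<^bsub>P\<^esub> p)"
      using WC pD r by (simp add: Wsm Z.smult_r_distr)
    then show "c (r \<odot>\<^bsub>Z\<^esub> x) = r \<odot>\<^bsub>E\<^esub> c x"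
      using * aD bD r by (simp add: c W.smult_closed P.smult_closed E.smult_r_distr)
  qed
  moreover have "c w = a w" if "w \<in> carrier W" for w
    using c[of w "\<zero>\<^bsub>P\<^esub>"] that WC aD by (simp add: p0 b0)
  moreover have "c (\<psi> p) = b p" if "p \<in> carrier P" for p
    using c[OF W.M.zero_closed that] pD(1)[OF that] bD(1)[OF that] by (simp add: a0) (simp add: W0)
  ultimately show thesis by (intro that[of c])
qed


section \<open>Free modules\<close>

lemma smult_finsum:
  assumes "left_module R N" "finite A" "a \<in> carrier R" "f \<in> A \<rightarrow> carrier N"
  shows "a \<odot>\<^bsub>N\<^esub> finsum N f A = finsum N (\<lambda>g. a \<odot>\<^bsub>N\<^esub> f g) A"
proof -
  interpret N: left_module R N by fact
  show ?thesis
    using assms(2,4)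
  proof (induction A)
    case empty
    then show ?case using assms(3) by (simp add: N.smult_zero)
  next
    case (insert x A)
    then show ?case using assms(3)
      by (simp add: N.smult_r_distr N.smult_closed Pi_def)
  qed
qed

text \<open>The targets range over modules with elements in \<open>'u\<close> because a definition
  cannot quantify over types. The uniqueness clause plays the role of generation by the image of
  \<iota>.\<close>

definition free_on :: "'g set \<Rightarrow> ('u, 'u) module \<Rightarrow> ('g \<Rightarrow> 'u) \<Rightarrow> bool" where
  "free_on G F \<iota> \<longleftrightarrow> F \<in> mod_objects R \<and> (\<forall>g\<in>G. \<iota> g \<in> carrier F) \<and>
     (\<forall>(N :: ('u, 'u) module) u. left_module R N \<longrightarrow> (\<forall>g\<in>G. u g \<in> carrier N) \<longrightarrow>
       (\<exists>h. mhom R F N h \<and> (\<forall>g\<in>G. h (\<iota> g) = u g))) \<and>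
     (\<forall>(N :: ('u, 'u) module) h h'. left_module R N \<longrightarrow> mhom R F N h \<longrightarrow> mhom R F N h' \<longrightarrow>
       (\<forall>g\<in>G. h (\<iota> g) = h' (\<iota> g)) \<longrightarrow> (\<forall>x\<in>carrier F. h x = h' x))"

text \<open>The model consists of the finitely supported functions from \<open>G\<close> to the
  ring, with the indicator functions \<delta> as basis.\<close>

lemma free_module_exists:
  fixes G :: "'g set"
  assumes G: "small TYPE('u) G"
  shows "\<exists>F \<iota>. free_on G F \<iota>"
proof -
  define sp where "sp f = {g. f g \<noteq> \<zero>}" for f :: "'g \<Rightarrow> 'u"
  define D :: "('u, 'g \<Rightarrow> 'u) module" where
    "D = \<lparr>carrier = {f. (\<forall>g. f g \<in> carrier R) \<and> finite (sp f) \<and> sp f \<subseteq> G},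
       monoid.mult = undefined, one = undefined, zero = (\<lambda>g. \<zero>), add = (\<lambda>f f' g. f g \<oplus> f' g),
       smult = (\<lambda>a f g. a \<otimes> f g)\<rparr>"
  have sp_add: "sp (\<lambda>g. f g \<oplus> f' g) \<subseteq> sp f \<union> sp f'" for f f' by (auto simp: sp_def)
  have sp_smult: "sp (\<lambda>g. a \<otimes> f g) \<subseteq> sp f" if "a \<in> carrier R" for a f
    using that by (auto simp: sp_def)
  have sp_minus: "sp (\<lambda>g. \<ominus> f g) \<subseteq> sp f" for f
    by (auto simp: sp_def)
  have sp_zero: "sp (\<lambda>g. \<zero>) = {}"
    by (simp add: sp_def)
  have Dm: "left_module R D"
  proof (rule left_moduleI)
    fix f assume f: "f \<in> carrier D"
    then have "finite (sp (\<lambda>g. \<ominus> f g))" "sp (\<lambda>g. \<ominus> f g) \<subseteq> G"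
      using finite_subset[OF sp_minus] sp_minus[of f] by (auto simp: D_def)
    then show "\<exists>y\<in>carrier D. y \<oplus>\<^bsub>D\<^esub> f = \<zero>\<^bsub>D\<^esub>"
      using f by (intro bexI[of _ "\<lambda>g. \<ominus> f g"]) (auto simp: D_def l_neg)
  next
    fix f f' assume "f \<in> carrier D" "f' \<in> carrier D"
    then show "f \<oplus>\<^bsub>D\<^esub> f' \<in> carrier D"
      using finite_subset[OF sp_add[of f f']] sp_add[of f f'] by (auto simp: D_def)
  next
    fix a f assume "a \<in> carrier R" "f \<in> carrier D"
    then show "a \<odot>\<^bsub>D\<^esub> f \<in> carrier D"
      using finite_subset[OF sp_smult[of a f]] sp_smult[of a f] by (auto simp: D_def)
  qed (auto simp: D_def a_ac m_assoc l_distr r_distr ring_axioms sp_zero)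
  interpret D: left_module R D by (rule Dm)
  have "small TYPE('u) (carrier D)"
  proof (rule small_inj_on)
    \<comment> \<open>A function is recovered from its graph over its support, which is a subset of
      a small product.\<close>
    show "inj_on (\<lambda>f. {(g, f g) | g. g \<in> sp f}) (carrier D)"
    proof (rule inj_onI)
      fix f f' assume eq: "{(g, f g) | g. g \<in> sp f} = {(g, f' g) | g. g \<in> sp f'}"
      show "f = f'"
      proof
        fix g
        have "(g, y) \<in> {(g, f g) | g. g \<in> sp f} \<longleftrightarrow> y = f g \<and> f g \<noteq> \<zero>"
          "(g, y) \<in> {(g, f' g) | g. g \<in> sp f'} \<longleftrightarrow> y = f' g \<and> f' g \<noteq> \<zero>" for y by (auto simp: sp_def)
        then have "(y = f g \<and> f g \<noteq> \<zero>) \<longleftrightarrow> (y = f' g \<and> f' g \<noteq> \<zero>)" for y unfolding eq by simp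
        then show "f g = f' g" by metis
      qed
    qed
    show "small TYPE('u) ((\<lambda>f. {(g, f g) | g. g \<in> sp f}) ` carrier D)"
      by (rule small_subset[OF small_Pow[OF small_Times[OF G small_ring]]]) (auto simp: D_def)
  qed
  \<comment> \<open>Dividing by the zero submodule changes only the names: it transports
    \<open>D\<close> from a type of functions to \<open>'u\<close>.\<close>
  moreover have "smod R D {\<zero>\<^bsub>D\<^esub>}" unfolding smod_def by (simp add: D.smult_zero)
  ultimately obtain F q where F: "F \<in> mod_objects R" and q: "mhom R D F q" "q ` carrier D = carrier F"
    and q0: "\<And>x y. x \<in> carrier D \<Longrightarrow> y \<in> carrier D \<Longrightarrow> q x = q y \<longleftrightarrow> (\<exists>n\<in>{\<zero>\<^bsub>D\<^esub>}. x = n \<oplus>\<^bsub>D\<^esub> y)"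
    using quotient_exists[OF Dm, of "{\<zero>\<^bsub>D\<^esub>}" "{}" undefined thesis] by simp
  have q_inj: "inj_on q (carrier D)"
    using q0 by (intro inj_onI) auto
  define \<delta> where "\<delta> g = (\<lambda>g'. if g' = g then \<one> else \<zero>)" for g :: 'g
  have \<delta>: "\<delta> g \<in> carrier D" if "g \<in> G" for g
  proof -
    have "sp (\<delta> g) \<subseteq> {g}" unfolding sp_def \<delta>_def by auto
    then show ?thesis using that finite_subset by (fastforce simp: D_def \<delta>_def)
  qed
  have univ: "\<exists>h. mhom R F N h \<and> (\<forall>g\<in>G. h (q (\<delta> g)) = u g)"
    if N: "left_module R N" and u: "\<And>g. g \<in> G \<Longrightarrow> u g \<in> carrier N" for N :: "('u, 'u) module" and u
  proof -
    interpret N: left_module R N by fact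
    define ev where "ev f = finsum N (\<lambda>g. f g \<odot>\<^bsub>N\<^esub> u g) (sp f)" for f
    have tm: "f g \<odot>\<^bsub>N\<^esub> u g \<in> carrier N" if "f \<in> carrier D" "g \<in> G" for f g
      using that u by (auto simp: D_def intro!: N.smult_closed)
    \<comment> \<open>The sum may be taken over any larger finite subset of \<open>G\<close>, so two
      functions can be evaluated over a common index set.\<close>
    have ev: "ev f = finsum N (\<lambda>g. f g \<odot>\<^bsub>N\<^esub> u g) A"
      if "f \<in> carrier D" "finite A" "A \<subseteq> G" "sp f \<subseteq> A" for f A
      unfolding ev_def
    proof (rule N.M.add.finprod_mono_neutral_cong_left)
      show "f g \<odot>\<^bsub>N\<^esub> u g = \<zero>\<^bsub>N\<^esub>" if "g \<in> A - sp f" for g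
        using that \<open>A \<subseteq> G\<close> u by (auto simp: sp_def N.zero_smult)
      show "(\<lambda>g. f g \<odot>\<^bsub>N\<^esub> u g) \<in> A \<rightarrow> carrier N" using that tm by blast
    qed (use that in auto)
    have hom: "mhom R D N ev"
      unfolding mhom_def
    proof (intro conjI ballI)
      fix f assume f: "f \<in> carrier D"
      then show "ev f \<in> carrier N" unfolding ev_def
        using tm by (intro N.M.finsum_closed) (auto simp: D_def)
    next
      fix f f' assume f: "f \<in> carrier D" "f' \<in> carrier D"
      let ?A = "sp f \<union> sp f'"
      have A: "finite ?A" "?A \<subseteq> G" using f by (auto simp: D_def)
      have t: "(\<lambda>g. f g \<odot>\<^bsub>N\<^esub> u g) \<in> ?A \<rightarrow> carrier N" "(\<lambda>g. f' g \<odot>\<^bsub>N\<^esub> u g) \<in> ?A \<rightarrow> carrier N"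
        using f A tm by blast+
      have "ev (f \<oplus>\<^bsub>D\<^esub> f') = finsum N (\<lambda>g. (f \<oplus>\<^bsub>D\<^esub> f') g \<odot>\<^bsub>N\<^esub> u g) ?A"
        using f A sp_add[of f f'] by (intro ev D.M.a_closed) (auto simp: D_def)
      also have "\<dots> = finsum N (\<lambda>g. f g \<odot>\<^bsub>N\<^esub> u g \<oplus>\<^bsub>N\<^esub> f' g \<odot>\<^bsub>N\<^esub> u g) ?A"
      proof (rule N.M.finsum_cong')
        show "(\<lambda>g. f g \<odot>\<^bsub>N\<^esub> u g \<oplus>\<^bsub>N\<^esub> f' g \<odot>\<^bsub>N\<^esub> u g) \<in> ?A \<rightarrow> carrier N" using t by (simp add: Pi_def)
        show "(f \<oplus>\<^bsub>D\<^esub> f') g \<odot>\<^bsub>N\<^esub> u g = f g \<odot>\<^bsub>N\<^esub> u g \<oplus>\<^bsub>N\<^esub> f' g \<odot>\<^bsub>N\<^esub> u g" if "g \<in> ?A" for g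
          using f A(2) u that by (auto simp: D_def intro!: N.smult_l_distr)
      qed simp
      also have "\<dots> = ev f \<oplus>\<^bsub>N\<^esub> ev f'"
        using f A t by (simp add: N.M.finsum_addf ev[of _ ?A])
      finally show "ev (f \<oplus>\<^bsub>D\<^esub> f') = ev f \<oplus>\<^bsub>N\<^esub> ev f'" .
    next
      fix a f assume a: "a \<in> carrier R" and f: "f \<in> carrier D"
      let ?A = "sp f"
      have A: "finite ?A" "?A \<subseteq> G" using f by (auto simp: D_def)
      have t: "(\<lambda>g. f g \<odot>\<^bsub>N\<^esub> u g) \<in> ?A \<rightarrow> carrier N" using f A tm by blast
      have "ev (a \<odot>\<^bsub>D\<^esub> f) = finsum N (\<lambda>g. (a \<odot>\<^bsub>D\<^esub> f) g \<odot>\<^bsub>N\<^esub> u g) ?A"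
        using f a A sp_smult[OF a, of f] by (intro ev D.smult_closed) (auto simp: D_def)
      also have "\<dots> = finsum N (\<lambda>g. a \<odot>\<^bsub>N\<^esub> (f g \<odot>\<^bsub>N\<^esub> u g)) ?A"
      proof (rule N.M.finsum_cong')
        show "(\<lambda>g. a \<odot>\<^bsub>N\<^esub> (f g \<odot>\<^bsub>N\<^esub> u g)) \<in> ?A \<rightarrow> carrier N"
          using t a by (simp add: Pi_def N.smult_closed)
        show "(a \<odot>\<^bsub>D\<^esub> f) g \<odot>\<^bsub>N\<^esub> u g = a \<odot>\<^bsub>N\<^esub> (f g \<odot>\<^bsub>N\<^esub> u g)" if "g \<in> ?A" for g
          using f a A(2) u that by (auto simp: D_def intro!: N.smult_assoc)
      qed simp
      also have "\<dots> = a \<odot>\<^bsub>N\<^esub> ev f"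
        using smult_finsum[OF N A(1) a t] by (simp add: ev_def)
      finally show "ev (a \<odot>\<^bsub>D\<^esub> f) = a \<odot>\<^bsub>N\<^esub> ev f" .
    qed
    obtain h where h: "mhom R F N h" "\<And>x. x \<in> carrier D \<Longrightarrow> h (q x) = ev x"
    proof -
      define h where "h y = ev (inv_into (carrier D) q y)" for y
      have hq: "h (q x) = ev x" if "x \<in> carrier D" for x using q_inj that by (simp add: h_def)
      note qD = mhomD[OF q(1)] and eD = mhomD[OF hom]
      have "mhom R F N h"
        unfolding mhom_def q(2)[symmetric]
        using hq eD by (auto simp: D.smult_closed simp flip: qD(2,3))
      then show thesis using hq by (rule that)
    qed
    have "ev (\<delta> g) = u g" if "g \<in> G" for g
    proof -
      have "ev (\<delta> g) = finsum N (\<lambda>x. \<delta> g x \<odot>\<^bsub>N\<^esub> u x) {g}"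
        using \<delta> that by (intro ev) (auto simp: sp_def \<delta>_def)
      then show ?thesis using u[OF that] by (simp add: \<delta>_def N.smult_one)
    qed
    then show ?thesis using h \<delta> by auto
  qed
  have unique: "h x = h' x"
    if N: "left_module R N" and h: "mhom R F N h" "mhom R F N h'"
      and eq: "\<And>g. g \<in> G \<Longrightarrow> h (q (\<delta> g)) = h' (q (\<delta> g))" and x: "x \<in> carrier F"
    for N :: "('u, 'u) module" and h h' x
  proof -
    define k k' where "k f = h (q f)" and "k' f = h' (q f)" for f
    have k: "mhom R D N k" "mhom R D N k'"
      unfolding k_def k'_def using h q(1) by (auto intro: mhom_comp)
    \<comment> \<open>Induction on a finite set containing the support: replacing one value by zero
      splits off a multiple of a basis element.\<close>
    have "k f = k' f" if "finite A" "f \<in> carrier D" "sp f \<subseteq> A" for A f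
      using that
    proof (induction A arbitrary: f)
      case empty
      then have "f = \<zero>\<^bsub>D\<^esub>" by (auto simp: D_def sp_def)
      then show ?case using mhom_zero[OF k(1) Dm N] mhom_zero[OF k(2) Dm N] by simp
    next
      case (insert y A)
      show ?case
      proof (cases "y \<in> sp f")
        case False
        then show ?thesis using insert by blast
      next
        case True
        then have y: "y \<in> G" "f y \<in> carrier R" using insert.prems(1) by (auto simp: D_def)
        let ?f = "f(y := \<zero>)"
        have sp: "sp ?f \<subseteq> sp f" "sp ?f \<subseteq> A" using insert.prems(2) by (auto simp: sp_def)
        have f: "?f \<in> carrier D"
          using insert.prems(1) sp(1) finite_subset by (auto simp: D_def)
        have d: "f y \<odot>\<^bsub>D\<^esub> \<delta> y \<in> carrier D" using D.smult_closed y \<delta> by blast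
        have "f = ?f \<oplus>\<^bsub>D\<^esub> f y \<odot>\<^bsub>D\<^esub> \<delta> y"
          using insert.prems(1) by (auto simp: D_def \<delta>_def fun_eq_iff)
        then have "k f = k ?f \<oplus>\<^bsub>N\<^esub> f y \<odot>\<^bsub>N\<^esub> k (\<delta> y)" "k' f = k' ?f \<oplus>\<^bsub>N\<^esub> f y \<odot>\<^bsub>N\<^esub> k' (\<delta> y)"
          using mhomD(2)[OF k(1) f d] mhomD(3)[OF k(1) y(2) \<delta>[OF y(1)]]
            mhomD(2)[OF k(2) f d] mhomD(3)[OF k(2) y(2) \<delta>[OF y(1)]] by simp_all
        then show ?thesis using insert.IH[OF f sp(2)] eq[OF y(1)]
          unfolding k_def k'_def by argo
      qed
    qed
    then have "k f = k' f" if "f \<in> carrier D" for f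
      using that by (auto simp: D_def)
    then show ?thesis using x unfolding q(2)[symmetric] k_def k'_def by blast
  qed
  have "free_on G F (\<lambda>g. q (\<delta> g))"
    unfolding free_on_def
  proof (intro conjI allI impI ballI)
    show "q (\<delta> g) \<in> carrier F" if "g \<in> G" for g using \<delta>[OF that] q(2) by blast
    show "\<exists>h. mhom R F N h \<and> (\<forall>g\<in>G. h (q (\<delta> g)) = u g)"
      if "left_module R N" "\<forall>g\<in>G. u g \<in> carrier N" for N :: "('u, 'u) module" and u
      by (rule univ) (use that in auto)
    show "h x = h' x" if "left_module R N" "mhom R F N h" "mhom R F N h'"
      "\<forall>g\<in>G. h (q (\<delta> g)) = h' (q (\<delta> g))" "x \<in> carrier F" for N :: "('u, 'u) module" and h h' x
      by (rule unique[OF that(1-3) _ that(5)]) (use that(4) in auto)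
  qed (rule F)
  then show ?thesis by blast
qed

end

section \<open>Short exact sequences of modules\<close>

lemma a_kernel_eq: "a_kernel M N f = {x \<in> carrier M. f x = \<zero>\<^bsub>N\<^esub>}"
  unfolding a_kernel_def kernel_def by simp

lemma mod_sesD:
  assumes "mod_ses R X f E g A"
  shows "left_module R X" "left_module R E" "left_module R A" "mhom R X E f" "mhom R E A g"
    "inj_on f (carrier X)" "f ` carrier X = {x \<in> carrier E. g x = \<zero>\<^bsub>A\<^esub>}" "g ` carrier E = carrier A"
  using assms unfolding mod_ses_def mod_objects_def a_kernel_eq by (auto intro: left_mod_homD)

lemma mod_sesI:
  assumes "X \<in> mod_objects R" "E \<in> mod_objects R" "A \<in> mod_objects R" "mhom R X E f" "mhom R E A g"
    "inj_on f (carrier X)" "f ` carrier X = {x \<in> carrier E. g x = \<zero>\<^bsub>A\<^esub>}" "g ` carrier E = carrier A"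
  shows "mod_ses R X (restrict f (carrier X)) E (restrict g (carrier E)) A"
proof -
  have l: "left_module R X" "left_module R E" using assms(1,2) unfolding mod_objects_def by auto
  have "restrict f (carrier X) ` carrier X = f ` carrier X"
    "restrict g (carrier E) ` carrier E = g ` carrier E" by auto
  moreover have "{x \<in> carrier E. restrict g (carrier E) x = \<zero>\<^bsub>A\<^esub>} = {x \<in> carrier E. g x = \<zero>\<^bsub>A\<^esub>}" by auto
  moreover have "inj_on (restrict f (carrier X)) (carrier X)" using assms(6) by (auto simp: inj_on_def)
  ultimately show ?thesis
    unfolding mod_ses_def a_kernel_eq using assms l by (simp add: left_mod_hom_restrict)
qed

lemma left_module_diff_eq_zero:
  assumes "left_module R M" "x \<in> carrier M" "y \<in> carrier M"
  shows "x \<ominus>\<^bsub>M\<^esub> y = \<zero>\<^bsub>M\<^esub> \<longleftrightarrow> x = y"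
proof -
  interpret M: left_module R M by fact
  show ?thesis using assms by (metis M.M.minus_eq M.M.r_neg M.M.minus_equality M.M.minus_minus M.M.a_inv_closed)
qed

lemma left_module_diff_add:
  assumes "left_module R M" "x \<in> carrier M" "y \<in> carrier M"
  shows "(x \<ominus>\<^bsub>M\<^esub> y) \<oplus>\<^bsub>M\<^esub> y = x"
proof -
  interpret M: left_module R M by fact
  show ?thesis using assms by (simp add: M.M.minus_eq M.M.a_assoc M.M.l_neg)
qed

section \<open>Complexes\<close>

abbreviation elts :: "'u ch_complex \<Rightarrow> int \<Rightarrow> 'u set" where
  "elts C n \<equiv> carrier (chmod C n)"

definition chom :: "'u ring \<Rightarrow> 'u ch_complex \<Rightarrow> 'u ch_complex \<Rightarrow> (int \<Rightarrow> 'u \<Rightarrow> 'u) \<Rightarrow> bool" where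
  "chom R C D f \<longleftrightarrow> (\<forall>n. mhom R (chmod C n) (chmod D n) (f n) \<and>
     (\<forall>x \<in> elts C n. f (n - 1) (diff C n x) = diff D n (f n x)))"

definition csub :: "'u ring \<Rightarrow> 'u ch_complex \<Rightarrow> 'u ch_complex \<Rightarrow> bool" where
  "csub R C D \<longleftrightarrow> (\<forall>n. msub R (chmod C n) (chmod D n) \<and>
     (\<forall>x \<in> elts C n. diff C n x = diff D n x))"

definition gsub :: "'u ring \<Rightarrow> 'u ch_complex \<Rightarrow> (int \<Rightarrow> 'u set) \<Rightarrow> bool" where
  "gsub R C N \<longleftrightarrow> (\<forall>n. smod R (chmod C n) (N n) \<and> (\<forall>x\<in>N n. diff C n x \<in> N (n - 1)))"

definition subcx :: "'u ch_complex \<Rightarrow> (int \<Rightarrow> 'u set) \<Rightarrow> 'u ch_complex" where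
  "subcx C N = \<lparr>chmod = (\<lambda>n. (chmod C n)\<lparr>carrier := N n\<rparr>), diff = (\<lambda>n. restrict (diff C n) (N n))\<rparr>"

definition cx_kernel :: "'u ch_complex \<Rightarrow> 'u ch_complex \<Rightarrow> (int \<Rightarrow> 'u \<Rightarrow> 'u) \<Rightarrow> int \<Rightarrow> 'u set" where
  "cx_kernel P S p n = {x \<in> elts P n. p n x = \<zero>\<^bsub>chmod S n\<^esub>}"

lemma ch_objectsD:
  assumes "C \<in> ch_objects R"
  shows "left_module R (chmod C n)" "chmod C n \<in> mod_objects R"
    "mhom R (chmod C n) (chmod C (n - 1)) (diff C n)"
    "x \<in> elts C n \<Longrightarrow> diff C (n - 1) (diff C n x) = \<zero>\<^bsub>chmod C (n - 2)\<^esub>"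
    "diff C n \<in> extensional (elts C n)"
  using assms unfolding ch_objects_def mod_objects_def
  by (auto intro: left_mod_homD simp: left_mod_hom_def PiE_def)

lemma ch_objectsI:
  assumes "\<And>n. chmod C n \<in> mod_objects R" "\<And>n. mhom R (chmod C n) (chmod C (n - 1)) (diff C n)"
    "\<And>n. diff C n \<in> extensional (elts C n)"
    "\<And>n x. x \<in> elts C n \<Longrightarrow> diff C (n - 1) (diff C n x) = \<zero>\<^bsub>chmod C (n - 2)\<^esub>"
  shows "C \<in> ch_objects R"
  using assms unfolding ch_objects_def left_mod_hom_def mhom_def by (auto simp: PiE_def)

lemma chomI:
  assumes "\<And>n. mhom R (chmod C n) (chmod D n) (f n)"
    "\<And>n x. x \<in> elts C n \<Longrightarrow> f (n - 1) (diff C n x) = diff D n (f n x)"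
  shows "chom R C D f"
  using assms unfolding chom_def by blast

lemma chomD:
  assumes "chom R C D f"
  shows "mhom R (chmod C n) (chmod D n) (f n)"
    "x \<in> elts C n \<Longrightarrow> f (n - 1) (diff C n x) = diff D n (f n x)"
    "x \<in> elts C n \<Longrightarrow> f n x \<in> elts D n"
  using assms unfolding chom_def mhom_def by auto

lemma diff_closed:
  "C \<in> ch_objects R \<Longrightarrow> x \<in> elts C n \<Longrightarrow> diff C n x \<in> elts C (n - 1)"
  using mhomD(1)[OF ch_objectsD(3)] .

lemma chom_ident: "chom R C C (\<lambda>n x. x)"
  unfolding chom_def by (simp add: mhom_ident)

lemma chom_comp: "chom R C D f \<Longrightarrow> chom R D E g \<Longrightarrow> chom R C E (\<lambda>n x. g n (f n x))"
  by (intro chomI) (auto intro: mhom_comp dest: chomD simp: chomD(2,3))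

lemma chom_const_zero:
  assumes "D \<in> ch_objects R" shows "chom R C D (\<lambda>n x. \<zero>\<^bsub>chmod D n\<^esub>)"
  by (intro chomI) (simp_all add: mhom_const_zero ch_objectsD(1)[OF assms]
      mhom_zero[OF ch_objectsD(3)[OF assms]])

lemma chom_add:
  assumes "D \<in> ch_objects R" "chom R C D f" "chom R C D g"
  shows "chom R C D (\<lambda>n x. f n x \<oplus>\<^bsub>chmod D n\<^esub> g n x)"
  by (intro chomI mhom_add)
    (simp_all add: ch_objectsD(1)[OF assms(1)] chomD(1)[OF assms(2)] chomD(1)[OF assms(3)]
      chomD(2,3)[OF assms(2)] chomD(2,3)[OF assms(3)] mhomD(2)[OF ch_objectsD(3)[OF assms(1)]])

lemma chom_diff:
  assumes "D \<in> ch_objects R" "chom R C D f" "chom R C D g"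
  shows "chom R C D (\<lambda>n x. f n x \<ominus>\<^bsub>chmod D n\<^esub> g n x)"
  by (intro chomI mhom_diff)
    (simp_all add: ch_objectsD(1)[OF assms(1)] chomD(1)[OF assms(2)] chomD(1)[OF assms(3)]
      chomD(2,3)[OF assms(2)] chomD(2,3)[OF assms(3)] mhom_minus[OF ch_objectsD(3)[OF assms(1)]])

lemma chom_cong:
  assumes "chom R C D f" "C \<in> ch_objects R" "\<And>n x. x \<in> elts C n \<Longrightarrow> f n x = g n x"
  shows "chom R C D g"
proof (rule chomI)
  show "mhom R (chmod C n) (chmod D n) (g n)" for n
    using mhom_cong[OF chomD(1)[OF assms(1)] ch_objectsD(1)[OF assms(2)]] assms(3) by blast
  show "g (n - 1) (diff C n x) = diff D n (g n x)" if "x \<in> elts C n" for n x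
    using chomD(2)[OF assms(1) that] assms(3)[OF that] assms(3)[OF diff_closed[OF assms(2) that]] by simp
qed

lemma chain_mapsD: "f \<in> chain_maps R C D \<Longrightarrow> chom R C D f"
  unfolding chain_maps_def chom_def by (auto intro: left_mod_homD)

lemma chain_maps_restrict:
  assumes "chom R C D f" "C \<in> ch_objects R"
  shows "(\<lambda>n. restrict (f n) (elts C n)) \<in> chain_maps R C D"
  using assms diff_closed[OF assms(2)] unfolding chain_maps_def
  by (simp add: left_mod_hom_restrict chomD ch_objectsD)

lemma cx_kernel_gsub:
  assumes "chom R P S p" "P \<in> ch_objects R" "S \<in> ch_objects R" shows "gsub R P (cx_kernel P S p)"
  unfolding gsub_def
proof (intro allI conjI ballI)
  show "smod R (chmod P n) (cx_kernel P S p n)" for n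
    unfolding cx_kernel_def using kernel_smod[OF chomD(1)[OF assms(1)]] assms(2,3) ch_objectsD(1) by blast
  show "diff P n x \<in> cx_kernel P S p (n - 1)" if "x \<in> cx_kernel P S p n" for n x
    using that chomD(2)[OF assms(1), of x n] diff_closed[OF assms(2), of x n]
      mhom_zero[OF ch_objectsD(3)[OF assms(3)] ch_objectsD(1)[OF assms(3)] ch_objectsD(1)[OF assms(3)]]
    unfolding cx_kernel_def by simp
qed

lemma subcx_simps [simp]:
  "elts (subcx C N) n = N n" "x \<oplus>\<^bsub>chmod (subcx C N) n\<^esub> y = x \<oplus>\<^bsub>chmod C n\<^esub> y"
  "\<zero>\<^bsub>chmod (subcx C N) n\<^esub> = \<zero>\<^bsub>chmod C n\<^esub>" "a \<odot>\<^bsub>chmod (subcx C N) n\<^esub> x = a \<odot>\<^bsub>chmod C n\<^esub> x"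
  "x \<in> N n \<Longrightarrow> diff (subcx C N) n x = diff C n x"
  by (simp_all add: subcx_def)

lemma chmod_subcx: "chmod (subcx C N) n = (chmod C n)\<lparr>carrier := N n\<rparr>"
  by (simp add: subcx_def)

lemma gsubD:
  assumes "gsub R C N" shows "smod R (chmod C n) (N n)" "x \<in> N n \<Longrightarrow> diff C n x \<in> N (n - 1)"
    "x \<in> N n \<Longrightarrow> x \<in> elts C n"
  using assms unfolding gsub_def smod_def by auto

lemma csub_subcx: "gsub R C N \<Longrightarrow> csub R (subcx C N) C"
  unfolding csub_def msub_def by (auto dest: gsubD)

lemma csubD:
  assumes "csub R C D"
  shows "msub R (chmod C n) (chmod D n)" "x \<in> elts C n \<Longrightarrow> diff C n x = diff D n x"
    "x \<in> elts C n \<Longrightarrow> x \<in> elts D n" "\<zero>\<^bsub>chmod C n\<^esub> = \<zero>\<^bsub>chmod D n\<^esub>"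
    "x \<in> elts C n \<Longrightarrow> y \<in> elts C n \<Longrightarrow> x \<oplus>\<^bsub>chmod C n\<^esub> y = x \<oplus>\<^bsub>chmod D n\<^esub> y"
    "a \<in> carrier R \<Longrightarrow> x \<in> elts C n \<Longrightarrow> a \<odot>\<^bsub>chmod C n\<^esub> x = a \<odot>\<^bsub>chmod D n\<^esub> x"
  using assms unfolding csub_def msub_def by auto

lemma csub_refl: "csub R C C"
  unfolding csub_def msub_def by simp

lemma csub_trans: "csub R C D \<Longrightarrow> csub R D E \<Longrightarrow> csub R C E"
  unfolding csub_def msub_def by (simp add: subset_iff)

lemma chom_csub: "csub R C D \<Longrightarrow> chom R C D (\<lambda>n x. x)"
  unfolding chom_def csub_def msub_def mhom_def by auto

lemma chom_into_csub: "chom R B C f \<Longrightarrow> csub R C D \<Longrightarrow> chom R B D f"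
  using chom_comp[OF _ chom_csub] by blast

lemma chom_from_csub: "chom R D B f \<Longrightarrow> csub R C D \<Longrightarrow> chom R C B f"
  using chom_comp[OF chom_csub] by blast

lemma gsub_csub:
  assumes "csub R C D" "C \<in> ch_objects R" shows "gsub R D (\<lambda>n. elts C n)"
  unfolding gsub_def smod_def
proof (intro allI conjI ballI subsetI)
  fix n
  interpret C: left_module R "chmod C n" using assms(2) by (rule ch_objectsD)
  note [simp] = csubD(2,4,5,6)[OF assms(1), symmetric]
  show "x \<in> elts D n" if "x \<in> elts C n" for x
    using csubD(3)[OF assms(1) that] .
  show "\<zero>\<^bsub>chmod D n\<^esub> \<in> elts C n" by simp
  show "diff D n x \<in> elts C (n - 1)" if "x \<in> elts C n" for x
    using that diff_closed[OF assms(2) that] by simp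
  show "x \<oplus>\<^bsub>chmod D n\<^esub> y \<in> elts C n"
    if "x \<in> elts C n" "y \<in> elts C n" for x y
    using that by simp
  show "a \<odot>\<^bsub>chmod D n\<^esub> x \<in> elts C n"
    if "a \<in> carrier R" "x \<in> elts C n" for a x
    using that C.smult_closed by simp
qed

text \<open>The factorization exists in each degree; commutation with the differentials is checked
  on preimages under \<open>p\<close>.\<close>

lemma chom_factor_epi:
  assumes p: "chom R P S p" and t: "chom R P E t"
    and obj: "P \<in> ch_objects R" "S \<in> ch_objects R" "E \<in> ch_objects R"
    and surj: "\<And>n. p n ` elts P n = elts S n"
    and ker: "\<And>n x. x \<in> elts P n \<Longrightarrow> p n x = \<zero>\<^bsub>chmod S n\<^esub> \<Longrightarrow> t n x = \<zero>\<^bsub>chmod E n\<^esub>"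
  obtains s where "chom R S E s" "\<And>n x. x \<in> elts P n \<Longrightarrow> s n (p n x) = t n x"
proof -
  have "\<exists>s. mhom R (chmod S n) (chmod E n) s \<and> (\<forall>x\<in>elts P n. s (p n x) = t n x)" for n
    using mhom_factor_epi[OF chomD(1)[OF p, of n] chomD(1)[OF t, of n] ch_objectsD(1)[OF obj(1)]
      ch_objectsD(1)[OF obj(2)] ch_objectsD(1)[OF obj(3)] surj ker] by metis
  then obtain s where s: "\<And>n. mhom R (chmod S n) (chmod E n) (s n)"
    "\<And>n x. x \<in> elts P n \<Longrightarrow> s n (p n x) = t n x" by metis
  have "chom R S E s"
  proof (rule chomI)
    fix n y assume "y \<in> elts S n"
    then obtain x where x: "x \<in> elts P n" "y = p n x" using surj by blast
    then show "s (n - 1) (diff S n y) = diff E n (s n y)"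
      using s(2) chomD(2)[OF p x(1)] chomD(2)[OF t x(1)] diff_closed[OF obj(1) x(1)]
      by (metis (no_types))
  qed (rule s)
  then show thesis using s(2) by (rule that)
qed

text \<open>Commutation with the differentials may be tested after the injective \<open>f\<close>,
  where it is that of \<open>t\<close>.\<close>

lemma chom_lift_mono:
  assumes f: "chom R X E f" and t: "chom R P E t"
    and obj: "P \<in> ch_objects R" "X \<in> ch_objects R"
    and inj: "\<And>n. inj_on (f n) (elts X n)"
    and im: "\<And>n x. x \<in> elts P n \<Longrightarrow> t n x \<in> f n ` elts X n"
  obtains u where "chom R P X u" "\<And>n x. x \<in> elts P n \<Longrightarrow> f n (u n x) = t n x"
proof -
  have "\<exists>u. mhom R (chmod P n) (chmod X n) u \<and> (\<forall>x\<in>elts P n. f n (u x) = t n x)" for n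
    using mhom_lift_mono[OF chomD(1)[OF f, of n] chomD(1)[OF t, of n] ch_objectsD(1)[OF obj(1)]
      ch_objectsD(1)[OF obj(2)] inj] im by (metis image_subsetI)
  then obtain u where u: "\<And>n. mhom R (chmod P n) (chmod X n) (u n)"
    "\<And>n x. x \<in> elts P n \<Longrightarrow> f n (u n x) = t n x" by metis
  have "chom R P X u"
  proof (rule chomI)
    fix n x assume x: "x \<in> elts P n"
    have ux: "u n x \<in> elts X n" using mhomD(1)[OF u(1) x] .
    have "f (n - 1) (u (n - 1) (diff P n x)) = f (n - 1) (diff X n (u n x))"
      using u(2)[OF x] u(2)[OF diff_closed[OF obj(1) x]] chomD(2)[OF t x] chomD(2)[OF f ux] by simp
    then show "u (n - 1) (diff P n x) = diff X n (u n x)"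
      using inj_onD[OF inj] mhomD(1)[OF u(1) diff_closed[OF obj(1) x]] diff_closed[OF obj(2) ux] by blast
  qed (rule u)
  then show thesis using u(2) by (rule that)
qed

lemma ch_sesD:
  assumes "ch_ses R X f E g A"
  shows "X \<in> ch_objects R" "E \<in> ch_objects R" "A \<in> ch_objects R" "chom R X E f" "chom R E A g"
    "inj_on (f n) (elts X n)"
    "f n ` elts X n = {x \<in> elts E n. g n x = \<zero>\<^bsub>chmod A n\<^esub>}"
    "g n ` elts E n = elts A n"
  using assms mod_sesD[of R "chmod X n" "f n" "chmod E n" "g n" "chmod A n"]
  unfolding ch_ses_def by (auto intro: chain_mapsD)

lemma ch_sesI:
  assumes "X \<in> ch_objects R" "E \<in> ch_objects R" "A \<in> ch_objects R" "chom R X E f" "chom R E A g"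
    "\<And>n. inj_on (f n) (elts X n)"
    "\<And>n. f n ` elts X n = {x \<in> elts E n. g n x = \<zero>\<^bsub>chmod A n\<^esub>}"
    "\<And>n. g n ` elts E n = elts A n"
  shows "ch_ses R X (\<lambda>n. restrict (f n) (elts X n)) E
    (\<lambda>n. restrict (g n) (elts E n)) A"
  unfolding ch_ses_def
  by (intro conjI allI assms(1-3) chain_maps_restrict mod_sesI ch_objectsD(2)[OF assms(1)]
      ch_objectsD(2)[OF assms(2)] ch_objectsD(2)[OF assms(3)] chomD(1)[OF assms(4)]
      chomD(1)[OF assms(5)] assms(4-8))

context module_universe
begin

lemma subcx_objects:
  assumes "C \<in> ch_objects R" "gsub R C N" shows "subcx C N \<in> ch_objects R"
proof (rule ch_objectsI)
  show "chmod (subcx C N) n \<in> mod_objects R" for n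
    unfolding chmod_subcx by (rule mod_objects_restrict[OF ch_objectsD(2)[OF assms(1)] gsubD(1)[OF assms(2)]])
  show "mhom R (chmod (subcx C N) n) (chmod (subcx C N) (n - 1)) (diff (subcx C N) n)" for n
  proof (rule mhom_cong)
    show "mhom R (chmod (subcx C N) n) (chmod (subcx C N) (n - 1)) (diff C n)"
      unfolding chmod_subcx
      by (intro mhom_into_restrict mhom_from_restrict ch_objectsD(3)[OF assms(1)])
        (use gsubD[OF assms(2)] in auto)
    show "left_module R (chmod (subcx C N) n)"
      unfolding chmod_subcx
      by (rule left_module_restrict[OF ch_objectsD(1)[OF assms(1)] gsubD(1)[OF assms(2)]])
  qed simp
  show "diff (subcx C N) n \<in> extensional (elts (subcx C N) n)" for n
    by (simp add: subcx_def)
  show "diff (subcx C N) (n - 1) (diff (subcx C N) n x) = \<zero>\<^bsub>chmod (subcx C N) (n - 2)\<^esub>"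
    if "x \<in> elts (subcx C N) n" for n x
    using that gsubD[OF assms(2)] ch_objectsD(4)[OF assms(1)] by simp
qed

section \<open>Pushouts of complexes\<close>

definition cpushout where
  "cpushout W P K \<phi> Z \<psi> \<longleftrightarrow> W \<in> ch_objects R \<and> P \<in> ch_objects R \<and> Z \<in> ch_objects R \<and> gsub R P K \<and>
     csub R W Z \<and> chom R P Z \<psi> \<and>
     (\<forall>n. pushout (chmod W n) (chmod P n) (K n) (\<phi> n) (chmod Z n) (\<psi> n))"

lemma cpushoutD:
  assumes "cpushout W P K \<phi> Z \<psi>"
  shows "W \<in> ch_objects R" "P \<in> ch_objects R" "Z \<in> ch_objects R" "gsub R P K" "csub R W Z" "chom R P Z \<psi>"
    "pushout (chmod W n) (chmod P n) (K n) (\<phi> n) (chmod Z n) (\<psi> n)"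
    "k \<in> K n \<Longrightarrow> \<psi> n k = \<phi> n k" "p \<in> elts P n \<Longrightarrow> \<psi> n p \<in> elts W n \<Longrightarrow> p \<in> K n"
  using assms unfolding cpushout_def pushout_def by auto

lemma cpushout_form:
  assumes "cpushout W P K \<phi> Z \<psi>" "z \<in> elts Z n"
  obtains w p where "w \<in> elts W n" "p \<in> elts P n" "z = w \<oplus>\<^bsub>chmod Z n\<^esub> \<psi> n p"
  using assms unfolding cpushout_def pushout_def by metis

lemma cpushout_universal:
  assumes po: "cpushout W P K \<phi> Z \<psi>" and E: "E \<in> ch_objects R"
    and a: "chom R W E a" and b: "chom R P E b" and ab: "\<And>n k. k \<in> K n \<Longrightarrow> b n k = a n (\<phi> n k)"
  obtains c where "chom R Z E c" "\<And>n w. w \<in> elts W n \<Longrightarrow> c n w = a n w"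
    "\<And>n p. p \<in> elts P n \<Longrightarrow> c n (\<psi> n p) = b n p"
proof -
  note poD = cpushoutD[OF po]
  have "\<exists>c. mhom R (chmod Z n) (chmod E n) c \<and> (\<forall>w\<in>elts W n. c w = a n w) \<and>
      (\<forall>p\<in>elts P n. c (\<psi> n p) = b n p)" for n
    using pushout_universal[OF poD(7) ch_objectsD(1)[OF E] chomD(1)[OF a] chomD(1)[OF b] ab] by metis
  then obtain c where c: "\<And>n. mhom R (chmod Z n) (chmod E n) (c n)"
    "\<And>n w. w \<in> elts W n \<Longrightarrow> c n w = a n w"
    "\<And>n p. p \<in> elts P n \<Longrightarrow> c n (\<psi> n p) = b n p" by metis
  have "chom R Z E c"
  proof (rule chomI)
    fix n z assume "z \<in> elts Z n"
    then obtain w p where wp: "w \<in> elts W n" "p \<in> elts P n"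
      "z = w \<oplus>\<^bsub>chmod Z n\<^esub> \<psi> n p" by (rule cpushout_form[OF po])
    have Z: "w \<in> elts Z n" "\<psi> n p \<in> elts Z n"
      using csubD(3)[OF poD(5) wp(1)] chomD(3)[OF poD(6) wp(2)] .
    have dw: "diff W n w \<in> elts W (n - 1)" and dp: "diff P n p \<in> elts P (n - 1)"
      using diff_closed[OF poD(1) wp(1)] diff_closed[OF poD(2) wp(2)] .
    have "diff Z n z = diff W n w \<oplus>\<^bsub>chmod Z (n - 1)\<^esub> \<psi> (n - 1) (diff P n p)"
      using wp Z mhomD(2)[OF ch_objectsD(3)[OF poD(3)] Z] csubD(2)[OF poD(5) wp(1)]
        chomD(2)[OF poD(6) wp(2)] by simp
    also have "c (n - 1) \<dots> = a (n - 1) (diff W n w) \<oplus>\<^bsub>chmod E (n - 1)\<^esub> b (n - 1) (diff P n p)"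
      using mhomD(2)[OF c(1) csubD(3)[OF poD(5) dw] chomD(3)[OF poD(6) dp]] c(2)[OF dw] c(3)[OF dp] by simp
    also have "\<dots> = diff E n (a n w) \<oplus>\<^bsub>chmod E (n - 1)\<^esub> diff E n (b n p)"
      using chomD(2)[OF a wp(1)] chomD(2)[OF b wp(2)] by simp
    also have "\<dots> = diff E n (c n z)"
      using mhomD(2)[OF ch_objectsD(3)[OF E] chomD(3)[OF a wp(1)] chomD(3)[OF b wp(2)]]
        mhomD(2)[OF c(1) Z] c(2)[OF wp(1)] c(3)[OF wp(2)] wp(3) by simp
    finally show "c (n - 1) (diff Z n z) = diff E n (c n z)" .
  qed (rule c)
  then show thesis using c(2,3) by (rule that)
qed

text \<open>Pushouts are formed degreewise. The differential is induced by those of \<open>W\<close>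
  and \<open>P\<close>, which are compatible on \<open>K\<close> because \<phi> is a chain
  map.\<close>

lemma cpushout_exists:
  assumes W: "W \<in> ch_objects R" and P: "P \<in> ch_objects R" and K: "gsub R P K"
    and phi: "chom R (subcx P K) W \<phi>"
  obtains Z \<psi> where "cpushout W P K \<phi> Z \<psi>"
proof -
  have "\<exists>Z \<psi>. pushout (chmod W n) (chmod P n) (K n) (\<phi> n) Z \<psi>" for n
    using pushout_exists[OF ch_objectsD(2)[OF W] ch_objectsD(2)[OF P] gsubD(1)[OF K]]
      chomD(1)[OF phi, of n] unfolding chmod_subcx by metis
  then obtain Z \<psi> where Z: "\<And>n. pushout (chmod W n) (chmod P n) (K n) (\<phi> n) (Z n) (\<psi> n)" by metis
  have ZO: "Z n \<in> mod_objects R" and WZ: "msub R (chmod W n) (Z n)" and psi: "mhom R (chmod P n) (Z n) (\<psi> n)"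
    and ext: "k \<in> K n \<Longrightarrow> \<psi> n k = \<phi> n k" for n k
    using Z[of n] unfolding pushout_def by auto
  note ZM = mod_objectsD(1)[OF ZO]
  have WZ_hom: "mhom R (chmod W n) (Z n) (\<lambda>x. x)" for n
    using WZ[of n] unfolding msub_def mhom_def by auto
  have "\<exists>d. mhom R (Z n) (Z (n - 1)) d \<and> (\<forall>w\<in>elts W n. d w = diff W n w) \<and>
      (\<forall>p\<in>elts P n. d (\<psi> n p) = \<psi> (n - 1) (diff P n p))" for n
  proof -
    have "\<psi> (n - 1) (diff P n k) = diff W n (\<phi> n k)" if "k \<in> K n" for k
      using chomD(2)[OF phi, of k n] that gsubD(2)[OF K that] ext by simp
    from pushout_universal[OF Z ZM mhom_comp[OF ch_objectsD(3)[OF W] WZ_hom]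
        mhom_comp[OF ch_objectsD(3)[OF P] psi] this]
    show ?thesis by metis
  qed
  then obtain d where d: "\<And>n. mhom R (Z n) (Z (n - 1)) (d n)"
    "\<And>n w. w \<in> elts W n \<Longrightarrow> d n w = diff W n w"
    "\<And>n p. p \<in> elts P n \<Longrightarrow> d n (\<psi> n p) = \<psi> (n - 1) (diff P n p)" by metis
  define C where "C = \<lparr>chmod = Z, diff = (\<lambda>n. restrict (d n) (carrier (Z n)))\<rparr>"
  have WC: "x \<in> carrier (Z n)" if "x \<in> elts W n" for n x
    using WZ[of n] that unfolding msub_def by blast
  have psiC: "\<psi> n x \<in> carrier (Z n)" if "x \<in> elts P n" for n x
    using mhomD(1)[OF psi that] .
  have dC: "d n x \<in> carrier (Z (n - 1))" if "x \<in> carrier (Z n)" for n x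
    using mhomD(1)[OF d(1) that] .
  have "C \<in> ch_objects R"
  proof (rule ch_objectsI)
    show "chmod C n \<in> mod_objects R" for n using ZO by (simp add: C_def)
    show "mhom R (chmod C n) (chmod C (n - 1)) (diff C n)" for n
      using mhom_cong[OF d(1) ZM] by (simp add: C_def)
    show "diff C n \<in> extensional (elts C n)" for n by (simp add: C_def)
    fix n z assume z: "z \<in> elts C n"
    then obtain w p where wp: "w \<in> elts W n" "p \<in> elts P n"
      "z = w \<oplus>\<^bsub>Z n\<^esub> \<psi> n p" using Z[of n] unfolding pushout_def C_def by auto
    have dw: "diff W n w \<in> elts W (n - 1)" and dp: "diff P n p \<in> elts P (n - 1)"
      using diff_closed[OF W wp(1)] diff_closed[OF P wp(2)] .
    have dz: "d n z = diff W n w \<oplus>\<^bsub>Z (n - 1)\<^esub> \<psi> (n - 1) (diff P n p)"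
      using mhomD(2)[OF d(1) WC psiC] d(2,3) wp by simp
    interpret Z2: left_module R "Z (n - 2)" by (rule ZM)
    have "d (n - 1) (d n z) = diff W (n - 1) (diff W n w) \<oplus>\<^bsub>Z (n - 2)\<^esub> \<psi> (n - 2) (diff P (n - 1) (diff P n p))"
      using mhomD(2)[OF d(1) WC[OF dw] psiC[OF dp]] d(2)[OF dw] d(3)[OF dp] unfolding dz by simp
    also have "\<dots> = \<zero>\<^bsub>chmod W (n - 2)\<^esub> \<oplus>\<^bsub>Z (n - 2)\<^esub> \<psi> (n - 2) \<zero>\<^bsub>chmod P (n - 2)\<^esub>"
      using ch_objectsD(4)[OF W wp(1)] ch_objectsD(4)[OF P wp(2)] by simp
    also have "\<dots> = \<zero>\<^bsub>Z (n - 2)\<^esub>"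
      using mhom_zero[OF psi ch_objectsD(1)[OF P] ZM] WZ[of "n - 2"] unfolding msub_def by simp
    finally show "diff C (n - 1) (diff C n z) = \<zero>\<^bsub>chmod C (n - 2)\<^esub>"
      using z dC by (simp add: C_def)
  qed
  moreover have "csub R W C"
    unfolding csub_def C_def using WZ WC d(2) by simp
  moreover have "chom R P C \<psi>"
    by (rule chomI) (use psi psiC d(3) in \<open>simp_all add: C_def\<close>)
  ultimately have "cpushout W P K \<phi> C \<psi>"
    unfolding cpushout_def using W P K Z by (simp add: C_def)
  then show thesis by (rule that)
qed

end

section \<open>Extensions, projective presentations and lifting\<close>

lemma compose_eq_iff:
  "f' \<in> extensional A \<Longrightarrow> compose A g f = f' \<longleftrightarrow> (\<forall>x\<in>A. g (f x) = f' x)"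
  by (auto simp: compose_def fun_eq_iff extensional_def)

lemma left_mod_hom_extensional: "f \<in> left_mod_hom R M N \<Longrightarrow> f \<in> extensional (carrier M)"
  unfolding left_mod_hom_def by (simp add: PiE_def)

lemma chain_maps_extensional: "f \<in> chain_maps R C D \<Longrightarrow> f n \<in> extensional (elts C n)"
  unfolding chain_maps_def by (auto dest: left_mod_hom_extensional)

section \<open>Yoneda extensions of complexes\<close>

context module_universe
begin

text \<open>The map is zero on \<open>W\<close> and \<open>p\<close> on \<open>P\<close>. If it
  kills w + \<psi> x, then \<open>x\<close> lies in the kernel of \<open>p\<close>, where \<psi> is
  \<phi> and takes values in \<open>W\<close>.\<close>

lemma cpushout_cokernel:
  assumes po: "cpushout W P (cx_kernel P S p) \<phi> Z \<psi>" and S: "S \<in> ch_objects R" and p: "chom R P S p"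
    and surj: "\<And>n. p n ` elts P n = elts S n"
  obtains g where "chom R Z S g" "\<And>n x. x \<in> elts P n \<Longrightarrow> g n (\<psi> n x) = p n x"
    "\<And>n. g n ` elts Z n = elts S n"
    "\<And>n. elts W n = {z \<in> elts Z n. g n z = \<zero>\<^bsub>chmod S n\<^esub>}"
proof -
  note poD = cpushoutD[OF po]
  obtain g where g: "chom R Z S g" "\<And>n w. w \<in> elts W n \<Longrightarrow> g n w = \<zero>\<^bsub>chmod S n\<^esub>"
    "\<And>n x. x \<in> elts P n \<Longrightarrow> g n (\<psi> n x) = p n x"
    using cpushout_universal[OF po S chom_const_zero[OF S] p] unfolding cx_kernel_def by (smt (verit) mem_Collect_eq)
  have "g n ` elts Z n = elts S n" for n
  proof
    show "g n ` elts Z n \<subseteq> elts S n" using chomD(3)[OF g(1)] by blast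
    show "elts S n \<subseteq> g n ` elts Z n"
      unfolding surj[symmetric] using g(3) chomD(3)[OF poD(6)] by (metis image_eqI image_subsetI)
  qed
  moreover have "elts W n = {z \<in> elts Z n. g n z = \<zero>\<^bsub>chmod S n\<^esub>}" for n
  proof (intro equalityI subsetI CollectI conjI)
    fix z assume "z \<in> {z \<in> elts Z n. g n z = \<zero>\<^bsub>chmod S n\<^esub>}"
    then have z: "z \<in> elts Z n" "g n z = \<zero>\<^bsub>chmod S n\<^esub>" by auto
    obtain w x where wx: "w \<in> elts W n" "x \<in> elts P n" "z = w \<oplus>\<^bsub>chmod Z n\<^esub> \<psi> n x"
      using cpushout_form[OF po z(1)] .
    interpret S: left_module R "chmod S n" using S by (rule ch_objectsD)
    interpret W: left_module R "chmod W n" using poD(1) by (rule ch_objectsD)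
    have "g n z = \<zero>\<^bsub>chmod S n\<^esub> \<oplus>\<^bsub>chmod S n\<^esub> p n x"
      using mhomD(2)[OF chomD(1)[OF g(1)] csubD(3)[OF poD(5) wx(1)] chomD(3)[OF poD(6) wx(2)]]
        g(2)[OF wx(1)] g(3)[OF wx(2)] wx(3) by simp
    then have "x \<in> cx_kernel P S p n" using z(2) wx(2) chomD(3)[OF p wx(2)] unfolding cx_kernel_def by simp
    then have "\<psi> n x \<in> elts W n" and "z = w \<oplus>\<^bsub>chmod W n\<^esub> \<psi> n x"
    proof -
      assume x: "x \<in> cx_kernel P S p n"
      have "mhom R ((chmod P n)\<lparr>carrier := cx_kernel P S p n\<rparr>) (chmod W n) (\<phi> n)"
        using poD(7)[of n] unfolding pushout_def by blast
      from mhomD(1)[OF this, of x] show *: "\<psi> n x \<in> elts W n"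
        using poD(8)[OF x] x by simp
      show "z = w \<oplus>\<^bsub>chmod W n\<^esub> \<psi> n x" using csubD(5)[OF poD(5) wx(1) *] wx(3) by simp
    qed
    then show "z \<in> elts W n" using wx(1) by simp
  qed (use csubD(3)[OF poD(5)] g(2) in auto)
  ultimately show thesis using g(1,3) by (intro that[of g])
qed

text \<open>The kernel of the identity is zero, so this pushout is a direct sum. It provides the
  premise \<open>nonempty\<close> of \<open>Ext1_eq_zero_iff\<close>.\<close>

lemma ch_ses_exists:
  assumes X: "X \<in> ch_objects R" and A: "A \<in> ch_objects R" shows "\<exists>f E g. ch_ses R X f E g A"
proof -
  let ?K = "cx_kernel A A (\<lambda>n x. x)"
  have K: "gsub R A ?K" by (rule cx_kernel_gsub[OF chom_ident A A])
  obtain Z \<psi> where po: "cpushout X A ?K (\<lambda>n x. \<zero>\<^bsub>chmod X n\<^esub>) Z \<psi>"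
    using cpushout_exists[OF X A K chom_const_zero[OF X]] .
  obtain g where g: "chom R Z A g" "\<And>n x. x \<in> elts A n \<Longrightarrow> g n (\<psi> n x) = x"
    "\<And>n. g n ` elts Z n = elts A n"
    "\<And>n. elts X n = {z \<in> elts Z n. g n z = \<zero>\<^bsub>chmod A n\<^esub>}"
    by (rule cpushout_cokernel[OF po A chom_ident]) simp_all
  have "ch_ses R X (\<lambda>n. restrict (\<lambda>x. x) (elts X n)) Z
      (\<lambda>n. restrict (g n) (elts Z n)) A"
    by (rule ch_sesI[OF X cpushoutD(3)[OF po] A chom_csub[OF cpushoutD(5)[OF po]] g(1)])
      (simp_all add: g(3) flip: g(4))
  then show ?thesis by blast
qed

text \<open>The endomorphism e - s (g e) has its values in the kernel of \<open>g\<close>, which is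
  the image of \<open>f\<close>; lifted through \<open>f\<close> it becomes the retraction.\<close>

lemma chom_splitting:
  assumes ses: "ch_ses R X f E g A" and s: "chom R A E s"
    and gs: "\<And>n a. a \<in> elts A n \<Longrightarrow> g n (s n a) = a"
  obtains r where "chom R E X r"
    "\<And>n e. e \<in> elts E n \<Longrightarrow> f n (r n e) = e \<ominus>\<^bsub>chmod E n\<^esub> s n (g n e)"
    "\<And>n x. x \<in> elts X n \<Longrightarrow> r n (f n x) = x"
proof -
  note D = ch_sesD[OF ses]
  have t: "chom R E E (\<lambda>n e. e \<ominus>\<^bsub>chmod E n\<^esub> s n (g n e))"
    by (rule chom_diff[OF D(2) chom_ident chom_comp[OF D(5) s]])
  have im: "e \<ominus>\<^bsub>chmod E n\<^esub> s n (g n e) \<in> f n ` elts X n"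
    if e: "e \<in> elts E n" for n e
  proof -
    interpret E: left_module R "chmod E n" using D(2) by (rule ch_objectsD)
    interpret A: left_module R "chmod A n" using D(3) by (rule ch_objectsD)
    have sg: "s n (g n e) \<in> elts E n" using chomD(3)[OF s] chomD(3)[OF D(5)] e by blast
    have "g n (e \<ominus>\<^bsub>chmod E n\<^esub> s n (g n e)) = g n e \<ominus>\<^bsub>chmod A n\<^esub> g n e"
      using mhom_minus[OF chomD(1)[OF D(5)] E.left_module_axioms A.left_module_axioms e sg]
        gs[OF chomD(3)[OF D(5) e]] by simp
    then show ?thesis unfolding D(7)
      using e sg chomD(3)[OF D(5) e] by (simp add: A.M.r_neg A.M.minus_eq)
  qed
  obtain r where r: "chom R E X r"
    "\<And>n e. e \<in> elts E n \<Longrightarrow> f n (r n e) = e \<ominus>\<^bsub>chmod E n\<^esub> s n (g n e)"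
    using chom_lift_mono[OF D(4) t D(2) D(1) D(6) im] by blast
  have "r n (f n x) = x" if x: "x \<in> elts X n" for n x
  proof -
    interpret E: left_module R "chmod E n" using D(2) by (rule ch_objectsD)
    have fx: "f n x \<in> elts E n" and "g n (f n x) = \<zero>\<^bsub>chmod A n\<^esub>"
      using D(7)[of n] x by auto
    then have "s n (g n (f n x)) = \<zero>\<^bsub>chmod E n\<^esub>"
      using mhom_zero[OF chomD(1)[OF s] ch_objectsD(1)[OF D(3)] E.left_module_axioms] by simp
    then have "f n (r n (f n x)) = f n x"
      using r(2)[OF fx] fx by (simp add: E.M.minus_eq E.a_inv_zero)
    then show ?thesis using inj_onD[OF D(6)] chomD(3)[OF r(1) fx] x by blast
  qed
  with r show thesis by (rule that)
qed

lemma Ext1_Ch: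
  assumes X: "X \<in> ch_objects R" and A: "A \<in> ch_objects R"
  shows "Ext1 (Ch R) A X = {Ext1_zero (Ch R) A X} \<longleftrightarrow>
    (\<forall>f E g. ch_ses R X f E g A \<longrightarrow>
      (\<exists>s. chom R A E s \<and> (\<forall>n. \<forall>a\<in>elts A n. g n (s n a) = a)))"
proof -
  have comp: "Comp (Ch R) C g f = h \<longleftrightarrow> (\<forall>n. \<forall>x\<in>elts C n. g n (f n x) = h n x)"
    if "\<And>n. h n \<in> extensional (elts C n)" for C g f h
    using compose_eq_iff[OF that] unfolding Ch_def fun_eq_iff[of _ h] abelian_cat.simps by blast
  have ext: "f n \<in> extensional (elts X n)" "g n \<in> extensional (elts E n)"
    if "ch_ses R X f E g A" for f E g n
    using that unfolding ch_ses_def by (auto dest: chain_maps_extensional)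
  \<comment> \<open>Arrows are extensional and \<open>chom\<close> is not; restricting a section to
    the carriers passes from one notion to the other.\<close>
  have sec: "(\<exists>s\<in>Arr (Ch R) A E. Comp (Ch R) A g s = Ident (Ch R) A) \<longleftrightarrow>
      (\<exists>s. chom R A E s \<and> (\<forall>n. \<forall>a\<in>elts A n. g n (s n a) = a))" for E g
  proof
    assume "\<exists>s\<in>Arr (Ch R) A E. Comp (Ch R) A g s = Ident (Ch R) A"
    then obtain s where "s \<in> chain_maps R A E" "Comp (Ch R) A g s = Ident (Ch R) A"
      by (auto simp: Ch_def)
    then show "\<exists>s. chom R A E s \<and> (\<forall>n. \<forall>a\<in>elts A n. g n (s n a) = a)"
      using comp[of "Ident (Ch R) A" A g s] by (auto simp: Ch_def intro!: exI[of _ s] chain_mapsD)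
  next
    assume "\<exists>s. chom R A E s \<and> (\<forall>n. \<forall>a\<in>elts A n. g n (s n a) = a)"
    then obtain s where s: "chom R A E s" "\<forall>n. \<forall>a\<in>elts A n. g n (s n a) = a" by blast
    then show "\<exists>s\<in>Arr (Ch R) A E. Comp (Ch R) A g s = Ident (Ch R) A"
      using chain_maps_restrict[OF s(1) A] comp[of "Ident (Ch R) A" A g]
      by (intro bexI[of _ "\<lambda>n. restrict (s n) (elts A n)"]) (auto simp: Ch_def)
  qed
  have SES: "SES (Ch R) = ch_ses R" by (simp add: Ch_def)
  have "Ext1 (Ch R) A X = {Ext1_zero (Ch R) A X} \<longleftrightarrow>
    (\<forall>f E g. SES (Ch R) X f E g A \<longrightarrow> (\<exists>s\<in>Arr (Ch R) A E. Comp (Ch R) A g s = Ident (Ch R) A))"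
  proof (rule Ext1_eq_zero_iff)
    fix f E g assume ses: "SES (Ch R) X f E g A"
    then have D: "E \<in> ch_objects R" "ch_ses R X f E g A" unfolding SES by (auto dest: ch_sesD)
    have "(\<lambda>n. restrict (\<lambda>x. x) (elts E n)) \<in> chain_maps R E E"
      using chain_maps_restrict[OF chom_ident D(1)] .
    then show "\<exists>h\<in>Arr (Ch R) E E. Comp (Ch R) X h f = f \<and> Comp (Ch R) E g h = g"
      using ext[OF D(2)] chomD(3)[OF ch_sesD(4)[OF D(2)]]
      by (intro bexI[of _ "\<lambda>n. restrict (\<lambda>x. x) (elts E n)"]) (auto simp: comp, simp add: Ch_def)
  next
    fix f E g s f' E' g' s'
    assume "SES (Ch R) X f E g A" "SES (Ch R) X f' E' g' A"
    then have ses: "ch_ses R X f E g A" and ses': "ch_ses R X f' E' g' A" unfolding SES .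
    assume "s \<in> Arr (Ch R) A E" and s0: "Comp (Ch R) A g s = Ident (Ch R) A"
      and "s' \<in> Arr (Ch R) A E'" and s0': "Comp (Ch R) A g' s' = Ident (Ch R) A"
    then have s: "chom R A E s" and s': "chom R A E' s'" by (auto simp: Ch_def intro: chain_mapsD)
    have gs: "\<And>n a. a \<in> elts A n \<Longrightarrow> g n (s n a) = a"
      using comp[of "Ident (Ch R) A" A g s] s0 by (simp add: Ch_def)
    have gs': "\<And>n a. a \<in> elts A n \<Longrightarrow> g' n (s' n a) = a"
      using comp[of "Ident (Ch R) A" A g' s'] s0' by (simp add: Ch_def)
    note D = ch_sesD[OF ses] and D' = ch_sesD[OF ses']
    obtain r where r: "chom R E X r" "\<And>n x. x \<in> elts X n \<Longrightarrow> r n (f n x) = x"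
      by (rule chom_splitting[OF ses s gs]) (assumption | rule that)+
    \<comment> \<open>Both extensions are direct sums of \<open>X\<close> and \<open>A\<close>. The
      map transports the component in \<open>X\<close> along \<open>f'\<close> and the component in
      \<open>A\<close> along \<open>s'\<close>.\<close>
    let ?h = "\<lambda>n e. f' n (r n e) \<oplus>\<^bsub>chmod E' n\<^esub> s' n (g n e)"
    have h: "chom R E E' ?h"
      by (rule chom_add[OF D'(2) chom_comp[OF r(1) D'(4)] chom_comp[OF D(5) s']])
    have hf: "?h n (f n x) = f' n x" if x: "x \<in> elts X n" for n x
    proof -
      interpret E': left_module R "chmod E' n" using D'(2) by (rule ch_objectsD)
      have "g n (f n x) = \<zero>\<^bsub>chmod A n\<^esub>" using D(7)[of n] x by auto
      then have "s' n (g n (f n x)) = \<zero>\<^bsub>chmod E' n\<^esub>"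
        using mhom_zero[OF chomD(1)[OF s'] ch_objectsD(1)[OF D(3)] E'.left_module_axioms] by simp
      then show ?thesis using r(2)[OF x] chomD(3)[OF D'(4) x] by simp
    qed
    have gh: "g' n (?h n e) = g n e" if e: "e \<in> elts E n" for n e
    proof -
      interpret A: left_module R "chmod A n" using D(3) by (rule ch_objectsD)
      have re: "r n e \<in> elts X n" and ge: "g n e \<in> elts A n"
        using chomD(3)[OF r(1) e] chomD(3)[OF D(5) e] .
      have "g' n (f' n (r n e)) = \<zero>\<^bsub>chmod A n\<^esub>" using D'(7)[of n] re by auto
      then show ?thesis
        using mhomD(2)[OF chomD(1)[OF D'(5)] chomD(3)[OF D'(4) re] chomD(3)[OF s' ge]] gs'[OF ge] ge by simp
    qed
    have "(\<lambda>n. restrict (?h n) (elts E n)) \<in> chain_maps R E E'"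
      using chain_maps_restrict[OF h D(2)] .
    then show "\<exists>h\<in>Arr (Ch R) E E'. Comp (Ch R) X h f = f' \<and> Comp (Ch R) E g' h = g"
      using ext(1)[OF ses'] ext(2)[OF ses] hf gh chomD(3)[OF D(4)]
      by (intro bexI[of _ "\<lambda>n. restrict (?h n) (elts E n)"]) (simp_all add: comp, simp add: Ch_def)
  next
    show "\<exists>f E g. SES (Ch R) X f E g A" unfolding SES using ch_ses_exists[OF X A] .
  qed
  then show ?thesis unfolding sec SES .
qed

text \<open>By \<open>Ext1_Ch\<close>, this says that \<open>Ext\<^sup>1(A, X) = 0\<close>.\<close>

definition splits where
  "splits A X \<longleftrightarrow> (\<forall>f E g. ch_ses R X f E g A \<longrightarrow>
      (\<exists>s. chom R A E s \<and> (\<forall>n. \<forall>a\<in>elts A n. g n (s n a) = a)))"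

lemma Ext1_Ch_splits:
  "X \<in> ch_objects R \<Longrightarrow> A \<in> ch_objects R \<Longrightarrow> Ext1 (Ch R) A X = {Ext1_zero (Ch R) A X} \<longleftrightarrow> splits A X"
  unfolding splits_def by (rule Ext1_Ch)

lemma right_perp_Ch:
  assumes "\<S> \<subseteq> ch_objects R"
  shows "right_perp (Ch R) \<S> = {X \<in> ch_objects R. \<forall>A\<in>\<S>. splits A X}"
proof -
  have "Obj (Ch R) = ch_objects R" by (simp add: Ch_def)
  moreover have "A \<in> ch_objects R" if "A \<in> \<S>" for A using assms that by blast
  ultimately show ?thesis
    unfolding right_perp_def by (intro Collect_cong conj_cong ball_cong Ext1_Ch_splits) auto
qed

lemma left_perp_Ch:
  assumes "\<T> \<subseteq> ch_objects R"
  shows "left_perp (Ch R) \<T> = {A \<in> ch_objects R. \<forall>X\<in>\<T>. splits A X}"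
proof -
  have "Obj (Ch R) = ch_objects R" by (simp add: Ch_def)
  moreover have "A \<in> ch_objects R" if "A \<in> \<T>" for A using assms that by blast
  ultimately show ?thesis
    unfolding left_perp_def by (intro Collect_cong conj_cong ball_cong Ext1_Ch_splits) auto
qed


section \<open>Yoneda extensions of modules\<close>

lemma mod_ses_exists:
  assumes X: "X \<in> mod_objects R" and A: "A \<in> mod_objects R" shows "\<exists>f E g. mod_ses R X f E g A"
proof -
  interpret X: left_module R X using X by (rule mod_objectsD)
  interpret A: left_module R A using A by (rule mod_objectsD)
  note lX = X.left_module_axioms and lA = A.left_module_axioms
  have K: "smod R A {\<zero>\<^bsub>A\<^esub>}" unfolding smod_def by (simp add: A.smult_zero)
  obtain Z \<psi> where po: "pushout X A {\<zero>\<^bsub>A\<^esub>} (\<lambda>x. \<zero>\<^bsub>X\<^esub>) Z \<psi>"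
    using pushout_exists[OF X A K mhom_const_zero[OF lX]] .
  have Z: "Z \<in> mod_objects R" and sub: "msub R X Z" and psi: "mhom R A Z \<psi>"
    and form: "\<And>z. z \<in> carrier Z \<Longrightarrow> \<exists>w\<in>carrier X. \<exists>p\<in>carrier A. z = w \<oplus>\<^bsub>Z\<^esub> \<psi> p"
    using po unfolding pushout_def by auto
  interpret Z: left_module R Z using Z by (rule mod_objectsD)
  obtain g where g: "mhom R Z A g" "\<And>w. w \<in> carrier X \<Longrightarrow> g w = \<zero>\<^bsub>A\<^esub>"
    "\<And>p. p \<in> carrier A \<Longrightarrow> g (\<psi> p) = p"
    by (rule pushout_universal[OF po lA mhom_const_zero[OF lA] mhom_ident]) auto
  have XZ: "x \<in> carrier Z" if "x \<in> carrier X" for x using sub that unfolding msub_def by blast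
  have "g ` carrier Z = carrier A"
    using mhomD(1)[OF g(1)] mhomD(1)[OF psi] g(3) by (force simp: image_iff)
  moreover have "carrier X = {z \<in> carrier Z. g z = \<zero>\<^bsub>A\<^esub>}"
  proof (intro equalityI subsetI)
    fix z assume "z \<in> {z \<in> carrier Z. g z = \<zero>\<^bsub>A\<^esub>}"
    then have z: "z \<in> carrier Z" "g z = \<zero>\<^bsub>A\<^esub>" by auto
    then obtain w p where wp: "w \<in> carrier X" "p \<in> carrier A" "z = w \<oplus>\<^bsub>Z\<^esub> \<psi> p" using form by blast
    then have "g z = p"
      using mhomD(2)[OF g(1) XZ mhomD(1)[OF psi]] g by simp
    then have "z = w" using wp z mhom_zero[OF psi lA Z.left_module_axioms] XZ by simp
    then show "z \<in> carrier X" using wp by simp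
  qed (use XZ g(2) in auto)
  moreover have "mhom R X Z (\<lambda>x. x)" using sub unfolding msub_def mhom_def by auto
  ultimately have "mod_ses R X (restrict (\<lambda>x. x) (carrier X)) Z (restrict g (carrier Z)) A"
    by (intro mod_sesI X Z A g(1)) simp_all
  then show ?thesis by blast
qed

lemma mhom_splitting:
  assumes ses: "mod_ses R X f E g A" and s: "mhom R A E s"
    and gs: "\<And>a. a \<in> carrier A \<Longrightarrow> g (s a) = a"
  obtains r where "mhom R E X r" "\<And>x. x \<in> carrier X \<Longrightarrow> r (f x) = x"
proof -
  note D = mod_sesD[OF ses]
  interpret E: left_module R E by (rule D)
  interpret A: left_module R A by (rule D)
  have t: "mhom R E E (\<lambda>e. e \<ominus>\<^bsub>E\<^esub> s (g e))"
    by (rule mhom_diff[OF D(2) mhom_ident mhom_comp[OF D(5) s]])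
  have im: "(\<lambda>e. e \<ominus>\<^bsub>E\<^esub> s (g e)) ` carrier E \<subseteq> f ` carrier X"
  proof (intro image_subsetI)
    fix e assume e: "e \<in> carrier E"
    have ge: "g e \<in> carrier A" using mhomD(1)[OF D(5) e] .
    have sg: "s (g e) \<in> carrier E" using mhomD(1)[OF s ge] .
    have "g (e \<ominus>\<^bsub>E\<^esub> s (g e)) = \<zero>\<^bsub>A\<^esub>"
      using mhom_minus[OF D(5) D(2,3) e sg] gs[OF ge] ge by (simp add: A.M.r_neg A.M.minus_eq)
    then show "e \<ominus>\<^bsub>E\<^esub> s (g e) \<in> f ` carrier X" unfolding D(7) using e sg by simp
  qed
  obtain r where r: "mhom R E X r" "\<And>e. e \<in> carrier E \<Longrightarrow> f (r e) = e \<ominus>\<^bsub>E\<^esub> s (g e)"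
    using mhom_lift_mono[OF D(4) t D(2) D(1) D(6) im] by blast
  have "r (f x) = x" if x: "x \<in> carrier X" for x
  proof -
    have fx: "f x \<in> carrier E" "g (f x) = \<zero>\<^bsub>A\<^esub>" using D(7) x by auto
    then have "f (r (f x)) = f x"
      using r(2) mhom_zero[OF s D(3) D(2)] by (simp add: E.M.minus_eq E.a_inv_zero)
    then show ?thesis using inj_onD[OF D(6)] mhomD(1)[OF r(1) fx(1)] x by blast
  qed
  with r(1) show thesis by (rule that)
qed

definition mod_splits where
  "mod_splits A X \<longleftrightarrow> (\<forall>f E g. mod_ses R X f E g A \<longrightarrow>
      (\<exists>s. mhom R A E s \<and> (\<forall>a\<in>carrier A. g (s a) = a)))"

lemma Ext1_R_Mod:
  assumes X: "X \<in> mod_objects R" and A: "A \<in> mod_objects R"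
  shows "Ext1 (R_Mod R) A X = {Ext1_zero (R_Mod R) A X} \<longleftrightarrow> mod_splits A X"
proof -
  have lA: "left_module R A" using A by (rule mod_objectsD)
  have comp: "Comp (R_Mod R) C g f = h \<longleftrightarrow> (\<forall>x\<in>carrier C. g (f x) = h x)"
    if "h \<in> extensional (carrier C)" for C g f h
    using compose_eq_iff[OF that] unfolding R_Mod_def by simp
  have ext: "f \<in> extensional (carrier X)" "g \<in> extensional (carrier E)" if "mod_ses R X f E g A" for f E g
    using that unfolding mod_ses_def by (auto dest: left_mod_hom_extensional)
  have sec: "(\<exists>s\<in>Arr (R_Mod R) A E. Comp (R_Mod R) A g s = Ident (R_Mod R) A) \<longleftrightarrow>
      (\<exists>s. mhom R A E s \<and> (\<forall>a\<in>carrier A. g (s a) = a))" for E g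
  proof
    assume "\<exists>s\<in>Arr (R_Mod R) A E. Comp (R_Mod R) A g s = Ident (R_Mod R) A"
    then obtain s where "s \<in> left_mod_hom R A E" "Comp (R_Mod R) A g s = Ident (R_Mod R) A"
      by (auto simp: R_Mod_def)
    then show "\<exists>s. mhom R A E s \<and> (\<forall>a\<in>carrier A. g (s a) = a)"
      using comp[of "Ident (R_Mod R) A" A g s] by (auto simp: R_Mod_def intro!: exI[of _ s] left_mod_homD)
  next
    assume "\<exists>s. mhom R A E s \<and> (\<forall>a\<in>carrier A. g (s a) = a)"
    then obtain s where s: "mhom R A E s" "\<forall>a\<in>carrier A. g (s a) = a" by blast
    then show "\<exists>s\<in>Arr (R_Mod R) A E. Comp (R_Mod R) A g s = Ident (R_Mod R) A"
      using left_mod_hom_restrict[OF s(1) lA] comp[of "Ident (R_Mod R) A" A g]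
      by (intro bexI[of _ "restrict s (carrier A)"]) (auto simp: R_Mod_def)
  qed
  have SES: "SES (R_Mod R) = mod_ses R" by (simp add: R_Mod_def)
  have "Ext1 (R_Mod R) A X = {Ext1_zero (R_Mod R) A X} \<longleftrightarrow>
    (\<forall>f E g. SES (R_Mod R) X f E g A \<longrightarrow> (\<exists>s\<in>Arr (R_Mod R) A E. Comp (R_Mod R) A g s = Ident (R_Mod R) A))"
  proof (rule Ext1_eq_zero_iff)
    fix f E g assume "SES (R_Mod R) X f E g A"
    then have ses: "mod_ses R X f E g A" unfolding SES .
    note D = mod_sesD[OF ses]
    have "restrict (\<lambda>x. x) (carrier E) \<in> left_mod_hom R E E"
      using left_mod_hom_restrict[OF mhom_ident D(2)] .
    then show "\<exists>h\<in>Arr (R_Mod R) E E. Comp (R_Mod R) X h f = f \<and> Comp (R_Mod R) E g h = g"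
      using ext[OF ses] mhomD(1)[OF D(4)]
      by (intro bexI[of _ "restrict (\<lambda>x. x) (carrier E)"]) (auto simp: comp, simp add: R_Mod_def)
  next
    fix f E g s f' E' g' s'
    assume "SES (R_Mod R) X f E g A" "SES (R_Mod R) X f' E' g' A"
    then have ses: "mod_ses R X f E g A" and ses': "mod_ses R X f' E' g' A" unfolding SES .
    assume "s \<in> Arr (R_Mod R) A E" and s0: "Comp (R_Mod R) A g s = Ident (R_Mod R) A"
      and "s' \<in> Arr (R_Mod R) A E'" and s0': "Comp (R_Mod R) A g' s' = Ident (R_Mod R) A"
    then have s: "mhom R A E s" and s': "mhom R A E' s'" by (auto simp: R_Mod_def intro: left_mod_homD)
    have gs: "\<And>a. a \<in> carrier A \<Longrightarrow> g (s a) = a"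
      using comp[of "Ident (R_Mod R) A" A g s] s0 by (simp add: R_Mod_def)
    have gs': "\<And>a. a \<in> carrier A \<Longrightarrow> g' (s' a) = a"
      using comp[of "Ident (R_Mod R) A" A g' s'] s0' by (simp add: R_Mod_def)
    note D = mod_sesD[OF ses] and D' = mod_sesD[OF ses']
    interpret E': left_module R E' by (rule D')
    interpret A: left_module R A by (rule D')
    obtain r where r: "mhom R E X r" "\<And>x. x \<in> carrier X \<Longrightarrow> r (f x) = x"
      by (rule mhom_splitting[OF ses s gs]) (assumption | rule that)+
    let ?h = "\<lambda>e. f' (r e) \<oplus>\<^bsub>E'\<^esub> s' (g e)"
    have h: "mhom R E E' ?h"
      by (rule mhom_add[OF D'(2) mhom_comp[OF r(1) D'(4)] mhom_comp[OF D(5) s']])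
    have hf: "?h (f x) = f' x" if x: "x \<in> carrier X" for x
    proof -
      have "g (f x) = \<zero>\<^bsub>A\<^esub>" using D(7) x by auto
      then show ?thesis using r(2)[OF x] mhomD(1)[OF D'(4) x] mhom_zero[OF s' D'(3) D'(2)] by simp
    qed
    have gh: "g' (?h e) = g e" if e: "e \<in> carrier E" for e
    proof -
      have re: "r e \<in> carrier X" and ge: "g e \<in> carrier A"
        using mhomD(1)[OF r(1) e] mhomD(1)[OF D(5) e] .
      have "g' (f' (r e)) = \<zero>\<^bsub>A\<^esub>" using D'(7) re by auto
      then show ?thesis
        using mhomD(2)[OF D'(5) mhomD(1)[OF D'(4) re] mhomD(1)[OF s' ge]] gs'[OF ge] ge by simp
    qed
    have "restrict ?h (carrier E) \<in> left_mod_hom R E E'"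
      using left_mod_hom_restrict[OF h D(2)] .
    then show "\<exists>h\<in>Arr (R_Mod R) E E'. Comp (R_Mod R) X h f = f' \<and> Comp (R_Mod R) E g' h = g"
      using ext(1)[OF ses'] ext(2)[OF ses] hf gh mhomD(1)[OF D(4)]
      by (intro bexI[of _ "restrict ?h (carrier E)"]) (simp_all add: comp, simp add: R_Mod_def)
  next
    show "\<exists>f E g. SES (R_Mod R) X f E g A" unfolding SES using mod_ses_exists[OF X A] .
  qed
  then show ?thesis unfolding sec SES mod_splits_def .
qed

lemma right_perp_R_Mod:
  assumes "\<S> \<subseteq> mod_objects R"
  shows "right_perp (R_Mod R) \<S> = {X \<in> mod_objects R. \<forall>A\<in>\<S>. mod_splits A X}"
proof -
  have "Obj (R_Mod R) = mod_objects R" by (simp add: R_Mod_def)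
  moreover have "A \<in> mod_objects R" if "A \<in> \<S>" for A using assms that by blast
  ultimately show ?thesis
    unfolding right_perp_def by (intro Collect_cong conj_cong ball_cong Ext1_R_Mod) auto
qed

section \<open>Projective complexes and presentations\<close>

definition projective where
  "projective P \<longleftrightarrow> (\<forall>E F g v. E \<in> ch_objects R \<longrightarrow> F \<in> ch_objects R \<longrightarrow> chom R E F g \<longrightarrow>
     (\<forall>n. g n ` elts E n = elts F n) \<longrightarrow> chom R P F v \<longrightarrow>
     (\<exists>h. chom R P E h \<and> (\<forall>n. \<forall>x\<in>elts P n. g n (h n x) = v n x)))"

text \<open>In degree \<open>n\<close>, the complex consists of the free modules on \<open>X\<^sub>n\<close> and on \<open>X\<^bsub>n+1\<^esub>\<close>: it
  is the direct sum of the disks on free modules mapping onto the \<open>X\<^sub>n\<close>.\<close>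

lemma projective_presentation:
  assumes X: "X \<in> ch_objects R"
  obtains P p where "P \<in> ch_objects R" "chom R P X p"
    "\<And>n. p n ` elts P n = elts X n" "projective P"
proof -
  have "\<exists>F \<iota>. free_on (elts X n) F \<iota>" for n
    by (rule free_module_exists[OF mod_objectsD(2)[OF ch_objectsD(2)[OF X]]])
  then obtain F \<iota> where fr: "\<And>n. free_on (elts X n) (F n) (\<iota> n)" by metis
  have F: "F n \<in> mod_objects R" and iota: "g \<in> elts X n \<Longrightarrow> \<iota> n g \<in> carrier (F n)" for n g
    using fr[of n] unfolding free_on_def by blast+
  have free: "\<exists>h. mhom R (F n) N h \<and> (\<forall>g\<in>elts X n. h (\<iota> n g) = u g)"
    if "left_module R N" "\<And>g. g \<in> elts X n \<Longrightarrow> u g \<in> carrier N" for n u and N :: "('u, 'u) module"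
    by (rule fr[of n, unfolded free_on_def, THEN conjunct2, THEN conjunct2, THEN conjunct1, rule_format])
      (use that in auto)
  have gen: "h x = h' x"
    if "left_module R N" "mhom R (F n) N h" "mhom R (F n) N h'"
      "\<And>g. g \<in> elts X n \<Longrightarrow> h (\<iota> n g) = h' (\<iota> n g)" "x \<in> carrier (F n)"
    for n h h' x and N :: "('u, 'u) module"
    by (rule fr[of n, unfolded free_on_def, THEN conjunct2, THEN conjunct2, THEN conjunct2, rule_format,
          OF that(1-3) _ that(5)])
      (use that(4) in auto)
  note FM = mod_objectsD(1)[OF F]
  \<comment> \<open>Amalgamating along zero gives a direct sum. The summand \<open>F n\<close> is
    contained literally, and \<open>F (n + 1)\<close> is embedded by \<psi>.\<close>
  have "\<exists>Z \<psi>. pushout (F n) (F (n + 1)) {\<zero>\<^bsub>F (n + 1)\<^esub>} (\<lambda>x. \<zero>\<^bsub>F n\<^esub>) Z \<psi>" for n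
  proof -
    interpret left_module R "F (n + 1)" by (rule FM)
    have "smod R (F (n + 1)) {\<zero>\<^bsub>F (n + 1)\<^esub>}" unfolding smod_def by (simp add: smult_zero)
    from pushout_exists[OF F F this mhom_const_zero[OF FM]] show ?thesis by metis
  qed
  then obtain Z \<psi> where po: "\<And>n. pushout (F n) (F (n + 1)) {\<zero>\<^bsub>F (n + 1)\<^esub>} (\<lambda>x. \<zero>\<^bsub>F n\<^esub>) (Z n) (\<psi> n)"
    by metis
  have ZO: "Z n \<in> mod_objects R" and sub: "msub R (F n) (Z n)" and psi: "mhom R (F (n + 1)) (Z n) (\<psi> n)"
    for n using po[of n] unfolding pushout_def by auto
  note ZM = mod_objectsD(1)[OF ZO]
  have psi': "mhom R (F n) (Z (n - 1)) (\<psi> (n - 1))" for n using psi[of "n - 1"] by simp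
  have form: "\<exists>w\<in>carrier (F n). \<exists>p\<in>carrier (F (n + 1)). z = w \<oplus>\<^bsub>Z n\<^esub> \<psi> n p"
    if "z \<in> carrier (Z n)" for z n using po[of n] that unfolding pushout_def by blast
  have FZ: "x \<in> carrier (Z n)" if "x \<in> carrier (F n)" for n x
    using sub[of n] that unfolding msub_def by blast
  have psiZ: "\<psi> n x \<in> carrier (Z n)" if "x \<in> carrier (F (n + 1))" for n x
    using mhomD(1)[OF psi that] .
  have univ: "\<exists>c. mhom R (Z n) E c \<and> (\<forall>w\<in>carrier (F n). c w = a w) \<and> (\<forall>p\<in>carrier (F (n + 1)). c (\<psi> n p) = b p)"
    if E: "left_module R E" and a: "mhom R (F n) E a" and b: "mhom R (F (n + 1)) E b" for n E a b
  proof -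
    have "b k = a \<zero>\<^bsub>F n\<^esub>" if "k \<in> {\<zero>\<^bsub>F (n + 1)\<^esub>}" for k
      using that mhom_zero[OF a FM E] mhom_zero[OF b FM E] by simp
    from pushout_universal[OF po E a b this] show ?thesis by metis
  qed
  \<comment> \<open>The literal summand \<open>F n\<close> goes identically to the copy of
    \<open>F n\<close> in degree n - 1 that \<psi> embeds, and the other summand is killed: these
    are the differentials of the disks.\<close>
  have "\<exists>d. mhom R (Z n) (Z (n - 1)) d \<and> (\<forall>w\<in>carrier (F n). d w = \<psi> (n - 1) w) \<and>
      (\<forall>p\<in>carrier (F (n + 1)). d (\<psi> n p) = \<zero>\<^bsub>Z (n - 1)\<^esub>)" for n
    by (rule univ[OF ZM psi' mhom_const_zero[OF ZM]])
  then obtain d where d: "\<And>n. mhom R (Z n) (Z (n - 1)) (d n)"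
    "\<And>n w. w \<in> carrier (F n) \<Longrightarrow> d n w = \<psi> (n - 1) w"
    "\<And>n p. p \<in> carrier (F (n + 1)) \<Longrightarrow> d n (\<psi> n p) = \<zero>\<^bsub>Z (n - 1)\<^esub>" by metis
  define P where "P = \<lparr>chmod = Z, diff = (\<lambda>n. restrict (d n) (carrier (Z n)))\<rparr>"
  have formP: "\<exists>w\<in>carrier (F n). \<exists>p\<in>carrier (F (n + 1)). z = w \<oplus>\<^bsub>Z n\<^esub> \<psi> n p"
    if "z \<in> elts P n" for z n using form[of z n] that by (simp add: P_def)
  have dz: "d n (w \<oplus>\<^bsub>Z n\<^esub> \<psi> n p) = \<psi> (n - 1) w"
    if "w \<in> carrier (F n)" "p \<in> carrier (F (n + 1))" for n w p
  proof -
    interpret left_module R "Z (n - 1)" by (rule ZM)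
    show ?thesis
      using mhomD(2)[OF d(1) FZ psiZ] d(2,3) that psiZ[of w "n - 1"] by simp
  qed
  have PO: "P \<in> ch_objects R"
  proof (rule ch_objectsI)
    show "chmod P n \<in> mod_objects R" for n using ZO by (simp add: P_def)
    show "mhom R (chmod P n) (chmod P (n - 1)) (diff P n)" for n
      using mhom_cong[OF d(1) ZM] by (simp add: P_def)
    show "diff P n \<in> extensional (elts P n)" for n by (simp add: P_def)
    fix n z assume z: "z \<in> elts P n"
    then obtain w p where wp: "w \<in> carrier (F n)" "p \<in> carrier (F (n + 1))" "z = w \<oplus>\<^bsub>Z n\<^esub> \<psi> n p"
      using formP by blast
    have "d n z \<in> carrier (Z (n - 1))" using mhomD(1)[OF d(1)] z by (simp add: P_def)
    moreover have "d (n - 1) (d n z) = \<zero>\<^bsub>Z (n - 2)\<^esub>"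
      using dz[OF wp(1,2)] d(3)[of w "n - 1"] wp by simp
    ultimately show "diff P (n - 1) (diff P n z) = \<zero>\<^bsub>chmod P (n - 2)\<^esub>"
      using z by (simp add: P_def)
  qed
  \<comment> \<open>Linear maps on the \<open>F n\<close> can be prescribed freely, and commutation
    with the differential forces the values on the copy of \<open>F (n + 1)\<close>.\<close>
  have maps: "\<exists>c. chom R P E c \<and> (\<forall>n. \<forall>w\<in>carrier (F n). c n w = a n w)"
    if E: "E \<in> ch_objects R" and a: "\<And>n. mhom R (F n) (chmod E n) (a n)" for E a
  proof -
    have b: "mhom R (F (n + 1)) (chmod E n) (\<lambda>x. diff E (n + 1) (a (n + 1) x))" for n
      using mhom_comp[OF a ch_objectsD(3)[OF E], of "n + 1"] by simp
    have "\<exists>c. mhom R (Z n) (chmod E n) c \<and> (\<forall>w\<in>carrier (F n). c w = a n w) \<and>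
        (\<forall>p\<in>carrier (F (n + 1)). c (\<psi> n p) = diff E (n + 1) (a (n + 1) p))" for n
      by (rule univ[OF ch_objectsD(1)[OF E] a b])
    then obtain c where c: "\<And>n. mhom R (Z n) (chmod E n) (c n)"
      "\<And>n w. w \<in> carrier (F n) \<Longrightarrow> c n w = a n w"
      "\<And>n p. p \<in> carrier (F (n + 1)) \<Longrightarrow> c n (\<psi> n p) = diff E (n + 1) (a (n + 1) p)" by metis
    have "chom R P E c"
    proof (rule chomI)
      fix n z assume z: "z \<in> elts P n"
      then obtain w p where wp: "w \<in> carrier (F n)" "p \<in> carrier (F (n + 1))" "z = w \<oplus>\<^bsub>Z n\<^esub> \<psi> n p"
        using formP by blast
      interpret E: left_module R "chmod E (n - 1)" using E by (rule ch_objectsD)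
      have aw: "a n w \<in> elts E n" and ap: "a (n + 1) p \<in> elts E (n + 1)"
        using mhomD(1)[OF a] wp by auto
      have dap: "diff E (n + 1) (a (n + 1) p) \<in> elts E n"
        "diff E n (diff E (n + 1) (a (n + 1) p)) = \<zero>\<^bsub>chmod E (n - 1)\<^esub>"
        using diff_closed[OF E ap] ch_objectsD(4)[OF E ap] by simp_all
      have "c (n - 1) (diff P n z) = diff E n (a n w)"
        using z wp dz[OF wp(1,2)] c(3)[of w "n - 1"] by (simp add: P_def)
      also have "\<dots> = diff E n (c n z)"
        using wp(3) mhomD(2)[OF c(1) FZ[OF wp(1)] psiZ[OF wp(2)]] c(2)[OF wp(1)] c(3)[OF wp(2)]
          mhomD(2)[OF ch_objectsD(3)[OF E] aw dap(1)] dap(2) diff_closed[OF E aw] by simp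
      finally show "c (n - 1) (diff P n z) = diff E n (c n z)" .
    qed (simp add: P_def c)
    then show ?thesis using c(2) by blast
  qed
  \<comment> \<open>The basis elements determine a chain map out of \<open>P\<close>, since \<psi> n
    p is the boundary of \<open>p\<close> taken in degree n + 1.\<close>
  have agree: "c n z = c' n z"
    if E: "E \<in> ch_objects R" and c: "chom R P E c" "chom R P E c'"
      and eq: "\<And>n x. x \<in> elts X n \<Longrightarrow> c n (\<iota> n x) = c' n (\<iota> n x)" and z: "z \<in> elts P n"
    for E c c' n z
  proof -
    have FE: "mhom R (F n) (chmod E n) (c n)" "mhom R (F n) (chmod E n) (c' n)" for n
      using chomD(1)[OF c(1), of n] chomD(1)[OF c(2), of n] sub[of n]
      unfolding mhom_def msub_def P_def by (auto simp: subset_iff)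
    have eqF: "c n x = c' n x" if "x \<in> carrier (F n)" for n x
      using gen[OF ch_objectsD(1)[OF E] FE eq that] .
    obtain w p where wp: "w \<in> carrier (F n)" "p \<in> carrier (F (n + 1))" "z = w \<oplus>\<^bsub>Z n\<^esub> \<psi> n p"
      using formP z by blast
    have "\<psi> n p = diff P (n + 1) p" using d(2)[OF wp(2)] FZ[OF wp(2)] by (simp add: P_def)
    then have "c n (\<psi> n p) = c' n (\<psi> n p)"
      using chomD(2)[OF c(1), of p "n + 1"] chomD(2)[OF c(2), of p "n + 1"] FZ[OF wp(2)] eqF[OF wp(2)]
      by (simp add: P_def)
    then show ?thesis
      using wp mhomD(2)[OF chomD(1)[OF c(1)], of w n "\<psi> n p"] mhomD(2)[OF chomD(1)[OF c(2)], of w n "\<psi> n p"]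
        eqF[OF wp(1)] FZ[OF wp(1)] psiZ[OF wp(2)] by (simp add: P_def)
  qed
  have lifting: "\<exists>c. chom R P E c \<and> (\<forall>n. \<forall>x\<in>elts X n. c n (\<iota> n x) = u n x)"
    if E: "E \<in> ch_objects R" and u: "\<And>n x. x \<in> elts X n \<Longrightarrow> u n x \<in> elts E n" for E u
  proof -
    have "\<exists>a. mhom R (F n) (chmod E n) a \<and> (\<forall>x\<in>elts X n. a (\<iota> n x) = u n x)" for n
      by (rule free[OF ch_objectsD(1)[OF E] u])
    then obtain a where a: "\<And>n. mhom R (F n) (chmod E n) (a n)"
      "\<And>n x. x \<in> elts X n \<Longrightarrow> a n (\<iota> n x) = u n x" by metis
    then show ?thesis using maps[OF E a(1)] iota by metis
  qed
  have "projective P"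
    unfolding projective_def
  proof (intro allI impI)
    fix E F' g v
    assume E: "E \<in> ch_objects R" and F': "F' \<in> ch_objects R" and g: "chom R E F' g"
      and surj: "\<forall>n. g n ` elts E n = elts F' n" and v: "chom R P F' v"
    define u where "u n x = (SOME e. e \<in> elts E n \<and> g n e = v n (\<iota> n x))" for n x
    have u: "u n x \<in> elts E n \<and> g n (u n x) = v n (\<iota> n x)" if "x \<in> elts X n" for n x
    proof -
      have "v n (\<iota> n x) \<in> g n ` elts E n"
        using chomD(3)[OF v, of "\<iota> n x" n] FZ[OF iota[OF that]] surj by (simp add: P_def)
      then have "\<exists>e. e \<in> elts E n \<and> g n e = v n (\<iota> n x)" by (metis imageE)
      from someI_ex[OF this] show ?thesis unfolding u_def .
    qed
    then obtain c where c: "chom R P E c" "\<And>n x. x \<in> elts X n \<Longrightarrow> c n (\<iota> n x) = u n x"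
      using lifting[OF E, of u] by blast
    have "g n (c n z) = v n z" if "z \<in> elts P n" for n z
      by (rule agree[OF F' chom_comp[OF c(1) g] v _ that]) (simp add: c(2) u)
    then show "\<exists>h. chom R P E h \<and> (\<forall>n. \<forall>x\<in>elts P n. g n (h n x) = v n x)"
      using c(1) by blast
  qed
  moreover obtain p where p: "chom R P X p" "\<And>n x. x \<in> elts X n \<Longrightarrow> p n (\<iota> n x) = x"
    using lifting[OF X, of "\<lambda>n x. x"] by blast
  moreover have "p n ` elts P n = elts X n" for n
  proof
    show "p n ` elts P n \<subseteq> elts X n" using chomD(3)[OF p(1)] by blast
    show "elts X n \<subseteq> p n ` elts P n"
    proof
      fix x assume x: "x \<in> elts X n"
      then have "\<iota> n x \<in> elts P n" using FZ iota by (simp add: P_def)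
      then show "x \<in> p n ` elts P n" using p(2)[OF x] by (metis image_eqI)
    qed
  qed
  ultimately show thesis using PO by (intro that[of P p])
qed


text \<open>Surjectivity of the restriction from Hom(P, X) to Hom(K, X), where K is the kernel of
  \<open>p\<close>. If \<open>P\<close> is projective and \<open>p\<close> is onto, the cokernel of
  this restriction is Ext^1(S, X). Vanishing of Ext is thereby tested on one fixed presentation,
  which is the form that the small object argument can achieve.\<close>

definition extends where
  "extends P S p X \<longleftrightarrow> (\<forall>\<phi>. chom R (subcx P (cx_kernel P S p)) X \<phi> \<longrightarrow>
     (\<exists>\<psi>. chom R P X \<psi> \<and> (\<forall>n. \<forall>k\<in>cx_kernel P S p n. \<psi> n k = \<phi> n k)))"

text \<open>Pushing \<open>P\<close> out along \<phi> gives an extension of \<open>S\<close> by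
  \<open>X\<close>. Its splitting yields a retraction onto \<open>X\<close>, and the composite of
  this retraction with \<psi> extends \<phi>. The lemma is applied to projective presentations and
  to maps out of disks and spheres.\<close>

lemma splits_imp_extends:
  assumes sp: "splits S X" and X: "X \<in> ch_objects R" and S: "S \<in> ch_objects R" and P: "P \<in> ch_objects R"
    and p: "chom R P S p" and surj: "\<And>n. p n ` elts P n = elts S n"
  shows "extends P S p X"
  unfolding extends_def
proof (intro allI impI)
  fix \<phi> assume phi: "chom R (subcx P (cx_kernel P S p)) X \<phi>"
  obtain E \<psi> where po: "cpushout X P (cx_kernel P S p) \<phi> E \<psi>"
    using cpushout_exists[OF X P cx_kernel_gsub[OF p P S] phi] .
  note poD = cpushoutD[OF po]
  obtain g where g: "chom R E S g" "\<And>n x. x \<in> elts P n \<Longrightarrow> g n (\<psi> n x) = p n x"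
    "\<And>n. g n ` elts E n = elts S n"
    "\<And>n. elts X n = {z \<in> elts E n. g n z = \<zero>\<^bsub>chmod S n\<^esub>}"
    by (rule cpushout_cokernel[OF po S p surj]) (assumption | rule that)+
  have ses: "ch_ses R X (\<lambda>n. restrict (\<lambda>x. x) (elts X n)) E
      (\<lambda>n. restrict (g n) (elts E n)) S"
    by (rule ch_sesI[OF X poD(3) S chom_csub[OF poD(5)] g(1)]) (simp_all add: g(3) flip: g(4))
  obtain s where s: "chom R S E s"
    "\<forall>n. \<forall>a\<in>elts S n. restrict (g n) (elts E n) (s n a) = a"
    using sp ses unfolding splits_def by blast
  obtain r where r: "chom R E X r"
    "\<And>n x. x \<in> elts X n \<Longrightarrow> r n (restrict (\<lambda>x. x) (elts X n) x) = x"
    by (rule chom_splitting[OF ses s(1) bspec[OF spec[OF s(2)]]]) (assumption | rule that)+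
  have "r n (\<psi> n k) = \<phi> n k" if k: "k \<in> cx_kernel P S p n" for n k
    using r(2)[of "\<phi> n k" n] poD(8)[OF k] chomD(3)[OF phi, of k n] k by simp
  then show "\<exists>\<psi>. chom R P X \<psi> \<and> (\<forall>n. \<forall>k\<in>cx_kernel P S p n. \<psi> n k = \<phi> n k)"
    using chom_comp[OF poD(6) r(1)] by blast
qed

text \<open>Projectivity lifts \<open>p\<close> through \<open>g\<close> to a map \<open>h\<close>,
  whose restriction to the kernel takes values in \<open>X\<close>. Subtracting an extension of that
  restriction makes the lift vanish on the kernel, so it descends to a section.\<close>

lemma extends_imp_splits:
  assumes ext: "extends P S p X" and X: "X \<in> ch_objects R" and S: "S \<in> ch_objects R" and P: "P \<in> ch_objects R"
    and p: "chom R P S p" and surj: "\<And>n. p n ` elts P n = elts S n"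
    and proj: "projective P"
  shows "splits S X"
  unfolding splits_def
proof (intro allI impI)
  fix f E g assume ses: "ch_ses R X f E g S"
  note D = ch_sesD[OF ses]
  obtain h where h: "chom R P E h" "\<And>n x. x \<in> elts P n \<Longrightarrow> g n (h n x) = p n x"
    using proj[unfolded projective_def, rule_format, OF D(2,3,5) D(8) p] by blast
  let ?K = "subcx P (cx_kernel P S p)"
  have K: "gsub R P (cx_kernel P S p)" by (rule cx_kernel_gsub[OF p P S])
  have hK: "chom R ?K E h" using chom_from_csub[OF h(1) csub_subcx[OF K]] .
  have im: "h n x \<in> f n ` elts X n" if "x \<in> elts ?K n" for n x
    using that h(2)[of x n] chomD(3)[OF h(1), of x n] unfolding D(7) by (simp add: cx_kernel_def)
  obtain \<phi> where phi: "chom R ?K X \<phi>" "\<And>n x. x \<in> elts ?K n \<Longrightarrow> f n (\<phi> n x) = h n x"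
    by (rule chom_lift_mono[OF D(4) hK subcx_objects[OF P K] X D(6) im]) (assumption | rule that)+
  obtain \<psi> where psi: "chom R P X \<psi>" "\<And>n k. k \<in> cx_kernel P S p n \<Longrightarrow> \<psi> n k = \<phi> n k"
    using ext phi(1) unfolding extends_def by blast
  let ?t = "\<lambda>n x. h n x \<ominus>\<^bsub>chmod E n\<^esub> f n (\<psi> n x)"
  have t: "chom R P E ?t" by (rule chom_diff[OF D(2) h(1) chom_comp[OF psi(1) D(4)]])
  have t0: "?t n x = \<zero>\<^bsub>chmod E n\<^esub>" if x: "x \<in> elts P n" "p n x = \<zero>\<^bsub>chmod S n\<^esub>" for n x
  proof -
    have "x \<in> cx_kernel P S p n" using x by (simp add: cx_kernel_def)
    then have "f n (\<psi> n x) = h n x" using psi(2) phi(2) by simp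
    then show ?thesis
      using left_module_diff_eq_zero[OF ch_objectsD(1)[OF D(2)]] chomD(3)[OF h(1) x(1)] by simp
  qed
  obtain s where s: "chom R S E s" "\<And>n x. x \<in> elts P n \<Longrightarrow> s n (p n x) = ?t n x"
    by (rule chom_factor_epi[OF p t P S D(2) surj t0]) (assumption | rule that)+
  have "g n (s n a) = a" if "a \<in> elts S n" for n a
  proof -
    obtain x where x: "x \<in> elts P n" "a = p n x" using \<open>a \<in> _\<close> surj by blast
    have fx: "f n (\<psi> n x) \<in> elts E n" "g n (f n (\<psi> n x)) = \<zero>\<^bsub>chmod S n\<^esub>"
      using chomD(3)[OF psi(1) x(1)] D(7)[of n] by auto
    interpret S: left_module R "chmod S n" using S by (rule ch_objectsD)
    show ?thesis
      using s(2)[OF x(1)] mhom_minus[OF chomD(1)[OF D(5)] ch_objectsD(1)[OF D(2)] ch_objectsD(1)[OF D(3)]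
          chomD(3)[OF h(1) x(1)] fx(1)] h(2)[OF x(1)] fx(2) x that by (simp add: S.M.minus_eq S.a_inv_zero)
  qed
  then show "\<exists>s. chom R S E s \<and> (\<forall>n. \<forall>a\<in>elts S n. g n (s n a) = a)"
    using s(1) by blast
qed

text \<open>The left lifting property of the inclusion of \<open>W\<close> in \<open>Z\<close>
  against epimorphisms with kernel in \<open>T\<close>; \<open>u\<close> is the part of the lift
  that is already given. This form passes through pushouts and through unions of towers, while the
  cokernel enters only in \<open>left_lifting_cokernel\<close>.\<close>

definition left_lifting where
  "left_lifting T W Z \<longleftrightarrow> csub R W Z \<and> (\<forall>Y\<in>T. \<forall>f E g F u v. ch_ses R Y f E g F \<longrightarrow> chom R W E u \<longrightarrow> chom R Z F v \<longrightarrow>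
     (\<forall>n. \<forall>x\<in>elts W n. g n (u n x) = v n x) \<longrightarrow>
     (\<exists>h. chom R Z E h \<and> (\<forall>n. \<forall>x\<in>elts W n. h n x = u n x) \<and>
       (\<forall>n. \<forall>x\<in>elts Z n. g n (h n x) = v n x)))"

text \<open>The absolute case, with no part of the lift prescribed. Lifting an identity map then
  produces a section, which is how membership in the left orthogonal class is obtained.\<close>

definition lifts_against where
  "lifts_against T Z \<longleftrightarrow> (\<forall>Y\<in>T. \<forall>f E g F v. ch_ses R Y f E g F \<longrightarrow> chom R Z F v \<longrightarrow>
     (\<exists>h. chom R Z E h \<and> (\<forall>n. \<forall>x\<in>elts Z n. g n (h n x) = v n x)))"

lemma left_liftingD:
  assumes "left_lifting T W Z"
  shows "csub R W Z"
    "Y \<in> T \<Longrightarrow> ch_ses R Y f E g F \<Longrightarrow> chom R W E u \<Longrightarrow> chom R Z F v \<Longrightarrow>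
     (\<And>n x. x \<in> elts W n \<Longrightarrow> g n (u n x) = v n x) \<Longrightarrow>
     \<exists>h. chom R Z E h \<and> (\<forall>n. \<forall>x\<in>elts W n. h n x = u n x) \<and>
       (\<forall>n. \<forall>x\<in>elts Z n. g n (h n x) = v n x)"
proof -
  show "csub R W Z" using assms unfolding left_lifting_def by blast
  assume "Y \<in> T" "ch_ses R Y f E g F" "chom R W E u" "chom R Z F v"
    "\<And>n x. x \<in> elts W n \<Longrightarrow> g n (u n x) = v n x"
  then show "\<exists>h. chom R Z E h \<and> (\<forall>n. \<forall>x\<in>elts W n. h n x = u n x) \<and>
       (\<forall>n. \<forall>x\<in>elts Z n. g n (h n x) = v n x)"
    by (intro assms[unfolded left_lifting_def, THEN conjunct2, rule_format])
qed

lemma left_liftingI: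
  assumes "csub R W Z"
    "\<And>Y f E g F u v. Y \<in> T \<Longrightarrow> ch_ses R Y f E g F \<Longrightarrow> chom R W E u \<Longrightarrow> chom R Z F v \<Longrightarrow>
     (\<And>n x. x \<in> elts W n \<Longrightarrow> g n (u n x) = v n x) \<Longrightarrow>
     \<exists>h. chom R Z E h \<and> (\<forall>n. \<forall>x\<in>elts W n. h n x = u n x) \<and>
       (\<forall>n. \<forall>x\<in>elts Z n. g n (h n x) = v n x)"
  shows "left_lifting T W Z"
  unfolding left_lifting_def using assms(1) by (intro conjI ballI allI impI) (auto intro: assms(2))

lemma projective_lifts_against: assumes "projective P" shows "lifts_against T P"
  unfolding lifts_against_def
proof (intro ballI allI impI)
  fix Y f E g F v assume "ch_ses R Y f E g F" and v: "chom R P F v"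
  note D = ch_sesD[OF this(1)]
  show "\<exists>h. chom R P E h \<and> (\<forall>n. \<forall>x\<in>elts P n. g n (h n x) = v n x)"
    by (rule assms[unfolded projective_def, rule_format, OF D(2,3,5) D(8) v])
qed

lemma lifts_against_extend: assumes P: "lifts_against T P" and PZ: "left_lifting T P Z" shows "lifts_against T Z"
  unfolding lifts_against_def
proof (intro ballI allI impI)
  fix Y f E g F v assume Y: "Y \<in> T" and ses: "ch_ses R Y f E g F" and v: "chom R Z F v"
  have "chom R P F v" using chom_from_csub[OF v left_liftingD(1)[OF PZ]] .
  then obtain u where u: "chom R P E u" "\<And>n x. x \<in> elts P n \<Longrightarrow> g n (u n x) = v n x"
    using P[unfolded lifts_against_def, rule_format, OF Y ses] by blast
  show "\<exists>h. chom R Z E h \<and> (\<forall>n. \<forall>x\<in>elts Z n. g n (h n x) = v n x)"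
    using left_liftingD(2)[OF PZ Y ses u(1) v u(2)] by blast
qed

lemma lifts_against_left_perp:
  assumes "lifts_against T A" "A \<in> ch_objects R" "T \<subseteq> ch_objects R" shows "A \<in> left_perp (Ch R) T"
proof -
  have "splits A Y" if "Y \<in> T" for Y
    unfolding splits_def
  proof (intro allI impI)
    fix f E g assume ses: "ch_ses R Y f E g A"
    from assms(1)[unfolded lifts_against_def, rule_format, OF that ses chom_ident]
    show "\<exists>s. chom R A E s \<and> (\<forall>n. \<forall>a\<in>elts A n. g n (s n a) = a)" .
  qed
  then show ?thesis unfolding left_perp_Ch[OF assms(3)] using assms(2) by blast
qed

text \<open>Projectivity gives some lift \<open>v'\<close>, which may disagree with \<open>u\<close>
  on the kernel. The discrepancy takes values in \<open>Y\<close>, extends to \<open>P\<close> by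
  assumption, and is added to \<open>v'\<close>.\<close>

lemma presentation_left_lifting:
  assumes ext: "\<And>Y. Y \<in> T \<Longrightarrow> extends P S p Y" and S: "S \<in> ch_objects R" and P: "P \<in> ch_objects R"
    and p: "chom R P S p" and proj: "projective P"
  shows "left_lifting T (subcx P (cx_kernel P S p)) P"
proof (rule left_liftingI)
  let ?K = "subcx P (cx_kernel P S p)"
  have K: "gsub R P (cx_kernel P S p)" by (rule cx_kernel_gsub[OF p P S])
  have KO: "?K \<in> ch_objects R" by (rule subcx_objects[OF P K])
  show KP: "csub R ?K P" by (rule csub_subcx[OF K])
  fix Y f E g F u v
  assume Y: "Y \<in> T" and ses: "ch_ses R Y f E g F" and u: "chom R ?K E u" and v: "chom R P F v"
    and uv: "\<And>n x. x \<in> elts ?K n \<Longrightarrow> g n (u n x) = v n x"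
  note D = ch_sesD[OF ses]
  obtain v' where v': "chom R P E v'" "\<And>n x. x \<in> elts P n \<Longrightarrow> g n (v' n x) = v n x"
    using proj[unfolded projective_def, rule_format, OF D(2,3,5) D(8) v] by blast
  let ?t = "\<lambda>n x. u n x \<ominus>\<^bsub>chmod E n\<^esub> v' n x"
  have t: "chom R ?K E ?t" by (rule chom_diff[OF D(2) u chom_from_csub[OF v'(1) KP]])
  have im: "?t n x \<in> f n ` elts Y n" if x: "x \<in> elts ?K n" for n x
  proof -
    have xP: "x \<in> elts P n" using csubD(3)[OF KP x] .
    have "g n (?t n x) = v n x \<ominus>\<^bsub>chmod F n\<^esub> v n x"
      using mhom_minus[OF chomD(1)[OF D(5)] ch_objectsD(1)[OF D(2)] ch_objectsD(1)[OF D(3)]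
          chomD(3)[OF u x] chomD(3)[OF v'(1) xP]] uv[OF x] v'(2)[OF xP] by simp
    then show ?thesis unfolding D(7) using chomD(3)[OF t x] chomD(3)[OF v xP]
      left_module_diff_eq_zero[OF ch_objectsD(1)[OF D(3)]] by simp
  qed
  obtain \<phi> where phi: "chom R ?K Y \<phi>" "\<And>n x. x \<in> elts ?K n \<Longrightarrow> f n (\<phi> n x) = ?t n x"
    by (rule chom_lift_mono[OF D(4) t KO D(1) D(6) im]) (assumption | rule that)+
  obtain \<psi> where psi: "chom R P Y \<psi>" "\<And>n k. k \<in> cx_kernel P S p n \<Longrightarrow> \<psi> n k = \<phi> n k"
    using ext[OF Y] phi(1) unfolding extends_def by blast
  let ?h = "\<lambda>n x. f n (\<psi> n x) \<oplus>\<^bsub>chmod E n\<^esub> v' n x"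
  have h: "chom R P E ?h" by (rule chom_add[OF D(2) chom_comp[OF psi(1) D(4)] v'(1)])
  have "?h n x = u n x" if x: "x \<in> elts ?K n" for n x
    using psi(2)[of x n] phi(2)[OF x] x
      left_module_diff_add[OF ch_objectsD(1)[OF D(2)] chomD(3)[OF u x] chomD(3)[OF v'(1) csubD(3)[OF KP x]]]
    by simp
  moreover have "g n (?h n x) = v n x" if x: "x \<in> elts P n" for n x
  proof -
    interpret F: left_module R "chmod F n" using D(3) by (rule ch_objectsD)
    have fx: "f n (\<psi> n x) \<in> elts E n" "g n (f n (\<psi> n x)) = \<zero>\<^bsub>chmod F n\<^esub>"
      using chomD(3)[OF psi(1) x] D(7)[of n] by auto
    show ?thesis
      using mhomD(2)[OF chomD(1)[OF D(5)] fx(1) chomD(3)[OF v'(1) x]] fx(2) v'(2)[OF x] chomD(3)[OF v x] by simp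
  qed
  ultimately show "\<exists>h. chom R P E h \<and> (\<forall>n. \<forall>x\<in>elts ?K n. h n x = u n x) \<and>
       (\<forall>n. \<forall>x\<in>elts P n. g n (h n x) = v n x)" using h by blast
qed

text \<open>The problem is pulled back to \<open>P\<close> and solved there relative to the values
  on \<open>K\<close> forced by \<open>u\<close>. The universal property glues that solution to
  \<open>u\<close>.\<close>

lemma pushout_left_lifting:
  assumes left_lifting: "left_lifting T (subcx P K) P" and po: "cpushout W P K \<phi> Z \<psi>" and phi: "chom R (subcx P K) W \<phi>"
  shows "left_lifting T W Z"
proof (rule left_liftingI)
  note poD = cpushoutD[OF po]
  show "csub R W Z" by (rule poD)
  fix Y f E g F u v
  assume Y: "Y \<in> T" and ses: "ch_ses R Y f E g F" and u: "chom R W E u" and v: "chom R Z F v"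
    and uv: "\<And>n x. x \<in> elts W n \<Longrightarrow> g n (u n x) = v n x"
  note D = ch_sesD[OF ses]
  have "g n (u n (\<phi> n x)) = v n (\<psi> n x)" if "x \<in> elts (subcx P K) n" for n x
    using uv[OF chomD(3)[OF phi that]] poD(8)[of x n] that by simp
  from left_liftingD(2)[OF left_lifting Y ses chom_comp[OF phi u] chom_comp[OF poD(6) v] this]
  obtain b where b: "chom R P E b" "\<And>n x. x \<in> K n \<Longrightarrow> b n x = u n (\<phi> n x)"
    "\<And>n x. x \<in> elts P n \<Longrightarrow> g n (b n x) = v n (\<psi> n x)" by auto
  obtain h where h: "chom R Z E h" "\<And>n w. w \<in> elts W n \<Longrightarrow> h n w = u n w"
    "\<And>n x. x \<in> elts P n \<Longrightarrow> h n (\<psi> n x) = b n x"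
    by (rule cpushout_universal[OF po D(2) u b(1,2)]) (assumption | rule that)+
  have "g n (h n z) = v n z" if "z \<in> elts Z n" for n z
  proof -
    obtain w x where wx: "w \<in> elts W n" "x \<in> elts P n" "z = w \<oplus>\<^bsub>chmod Z n\<^esub> \<psi> n x"
      using cpushout_form[OF po \<open>z \<in> _\<close>] .
    have Z: "w \<in> elts Z n" "\<psi> n x \<in> elts Z n"
      using csubD(3)[OF poD(5) wx(1)] chomD(3)[OF poD(6) wx(2)] .
    show ?thesis
      using wx(3) mhomD(2)[OF chomD(1)[OF h(1)] Z] mhomD(2)[OF chomD(1)[OF v] Z] h(2)[OF wx(1)] h(3)[OF wx(2)]
        mhomD(2)[OF chomD(1)[OF D(5)] chomD(3)[OF h(1) Z(1)] chomD(3)[OF h(1) Z(2)]] uv[OF wx(1)] b(3)[OF wx(2)]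
      by simp
  qed
  then show "\<exists>h. chom R Z E h \<and> (\<forall>n. \<forall>x\<in>elts W n. h n x = u n x) \<and>
       (\<forall>n. \<forall>x\<in>elts Z n. g n (h n x) = v n x)" using h(1,2) by blast
qed

lemma cquotient_exists:
  assumes Z: "Z \<in> ch_objects R" and N: "gsub R Z N"
  obtains A q where "A \<in> ch_objects R" "chom R Z A q"
    "\<And>n. q n ` elts Z n = elts A n"
    "\<And>n. {x \<in> elts Z n. q n x = \<zero>\<^bsub>chmod A n\<^esub>} = N n"
proof -
  have "\<exists>Q q. Q \<in> mod_objects R \<and> mhom R (chmod Z n) Q q \<and> q ` elts Z n = carrier Q \<and>
      (\<forall>x\<in>elts Z n. q x = \<zero>\<^bsub>Q\<^esub> \<longleftrightarrow> x \<in> N n)" for n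
    by (rule quotient_exists[OF ch_objectsD(1)[OF Z, of n] gsubD(1)[OF N, of n]
          mod_objectsD(2)[OF ch_objectsD(2)[OF Z, of n]], of "{}" undefined])
      (simp, simp, simp, intro exI conjI ballI, assumption, assumption, assumption, simp)
  then obtain Q q where Q: "\<And>n. Q n \<in> mod_objects R" and q: "\<And>n. mhom R (chmod Z n) (Q n) (q n)"
    and surj: "\<And>n. q n ` elts Z n = carrier (Q n)"
    and ker: "\<And>n x. x \<in> elts Z n \<Longrightarrow> q n x = \<zero>\<^bsub>Q n\<^esub> \<longleftrightarrow> x \<in> N n" by metis
  note QM = mod_objectsD(1)[OF Q]
  have "\<exists>d. mhom R (Q n) (Q (n - 1)) d \<and> (\<forall>x\<in>elts Z n. d (q n x) = q (n - 1) (diff Z n x))" for n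
  proof -
    have "q (n - 1) (diff Z n x) = \<zero>\<^bsub>Q (n - 1)\<^esub>" if "x \<in> elts Z n" "q n x = \<zero>\<^bsub>Q n\<^esub>" for x
      using that ker diff_closed[OF Z] gsubD(2)[OF N] by blast
    from mhom_factor_epi[OF q mhom_comp[OF ch_objectsD(3)[OF Z] q] ch_objectsD(1)[OF Z] QM QM surj this]
    show ?thesis by metis
  qed
  then obtain d where d: "\<And>n. mhom R (Q n) (Q (n - 1)) (d n)"
    "\<And>n x. x \<in> elts Z n \<Longrightarrow> d n (q n x) = q (n - 1) (diff Z n x)" by metis
  define A where "A = \<lparr>chmod = Q, diff = (\<lambda>n. restrict (d n) (carrier (Q n)))\<rparr>"
  have qC: "q n x \<in> carrier (Q n)" if "x \<in> elts Z n" for n x using mhomD(1)[OF q that] .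
  have "A \<in> ch_objects R"
  proof (rule ch_objectsI)
    show "chmod A n \<in> mod_objects R" for n using Q by (simp add: A_def)
    show "mhom R (chmod A n) (chmod A (n - 1)) (diff A n)" for n
      using mhom_cong[OF d(1) QM] by (simp add: A_def)
    show "diff A n \<in> extensional (elts A n)" for n by (simp add: A_def)
    fix n y assume "y \<in> elts A n"
    then obtain x where x: "x \<in> elts Z n" "y = q n x" using surj[of n] by (auto simp: A_def)
    have dx: "diff Z n x \<in> elts Z (n - 1)" using diff_closed[OF Z x(1)] .
    show "diff A (n - 1) (diff A n y) = \<zero>\<^bsub>chmod A (n - 2)\<^esub>"
      using d(2)[OF x(1)] d(2)[OF dx] qC[OF x(1)] qC[OF dx] ch_objectsD(4)[OF Z x(1)] x(2)
        mhom_zero[OF q ch_objectsD(1)[OF Z] QM] by (simp add: A_def)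
  qed
  moreover have "chom R Z A q"
    by (rule chomI) (use q qC d(2) in \<open>simp_all add: A_def\<close>)
  moreover have "{x \<in> elts Z n. q n x = \<zero>\<^bsub>chmod A n\<^esub>} = N n" for n
    using ker gsubD(3)[OF N] by (auto simp: A_def)
  ultimately show thesis using surj by (intro that[of A q]) (simp_all add: A_def)
qed

text \<open>A lifting problem for the cokernel is composed with the quotient map and solved on
  \<open>Z\<close> with the zero map prescribed on \<open>W\<close>. The solution kills
  \<open>W\<close> and therefore descends.\<close>

lemma left_lifting_cokernel:
  assumes left_lifting: "left_lifting T W Z" and W: "W \<in> ch_objects R" and Z: "Z \<in> ch_objects R" and T: "T \<subseteq> ch_objects R"
  shows "\<exists>A\<in>left_perp (Ch R) T. \<exists>f g. ch_ses R W f Z g A"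
proof -
  note WZ = left_liftingD(1)[OF left_lifting]
  obtain A q where A: "A \<in> ch_objects R" and q: "chom R Z A q"
    "\<And>n. q n ` elts Z n = elts A n"
    "\<And>n. {x \<in> elts Z n. q n x = \<zero>\<^bsub>chmod A n\<^esub>} = elts W n"
    by (rule cquotient_exists[OF Z gsub_csub[OF WZ W]]) (assumption | rule that)+
  have "lifts_against T A"
    unfolding lifts_against_def
  proof (intro ballI allI impI)
    fix Y f E g F v assume Y: "Y \<in> T" and ses: "ch_ses R Y f E g F" and v: "chom R A F v"
    note D = ch_sesD[OF ses]
    have v0: "v n \<zero>\<^bsub>chmod A n\<^esub> = \<zero>\<^bsub>chmod F n\<^esub>" for n
      by (rule mhom_zero[OF chomD(1)[OF v] ch_objectsD(1)[OF A] ch_objectsD(1)[OF D(3)]])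
    have g0: "g n \<zero>\<^bsub>chmod E n\<^esub> = \<zero>\<^bsub>chmod F n\<^esub>" for n
      by (rule mhom_zero[OF chomD(1)[OF D(5)] ch_objectsD(1)[OF D(2)] ch_objectsD(1)[OF D(3)]])
    have "g n \<zero>\<^bsub>chmod E n\<^esub> = v n (q n x)" if "x \<in> elts W n" for n x
    proof -
      have "q n x = \<zero>\<^bsub>chmod A n\<^esub>" using that q(3)[of n] by blast
      then show ?thesis using v0 g0 by simp
    qed
    from left_liftingD(2)[OF left_lifting Y ses chom_const_zero[OF D(2)] chom_comp[OF q(1) v] this]
    obtain h where h: "chom R Z E h" "\<And>n x. x \<in> elts W n \<Longrightarrow> h n x = \<zero>\<^bsub>chmod E n\<^esub>"
      "\<And>n x. x \<in> elts Z n \<Longrightarrow> g n (h n x) = v n (q n x)" by blast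
    have h0: "h n x = \<zero>\<^bsub>chmod E n\<^esub>" if "x \<in> elts Z n" "q n x = \<zero>\<^bsub>chmod A n\<^esub>" for n x
      using that h(2) q(3)[of n] by blast
    obtain s where s: "chom R A E s" "\<And>n x. x \<in> elts Z n \<Longrightarrow> s n (q n x) = h n x"
      by (rule chom_factor_epi[OF q(1) h(1) Z A D(2) q(2) h0]) (assumption | rule that)+
    have "g n (s n a) = v n a" if "a \<in> elts A n" for n a
      using that s(2) h(3) q(2)[of n] by force
    then show "\<exists>h. chom R A E h \<and> (\<forall>n. \<forall>x\<in>elts A n. g n (h n x) = v n x)"
      using s(1) by blast
  qed
  then have "A \<in> left_perp (Ch R) T" using lifts_against_left_perp A T by blast
  moreover have "ch_ses R W (\<lambda>n. restrict (\<lambda>x. x) (elts W n)) Z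
      (\<lambda>n. restrict (q n) (elts Z n)) A"
    by (rule ch_sesI[OF W Z A chom_csub[OF WZ] q(1)]) (simp_all add: q(2,3))
  ultimately show ?thesis by blast
qed

end

section \<open>Unions of chains of complexes\<close>

definition cchain :: "'u ring \<Rightarrow> 'u ch_complex set \<Rightarrow> bool" where
  "cchain R \<C> \<longleftrightarrow> \<C> \<noteq> {} \<and> \<C> \<subseteq> ch_objects R \<and> (\<forall>C\<in>\<C>. \<forall>D\<in>\<C>. csub R C D \<or> csub R D C)"

text \<open>Operations on a union are evaluated in some member containing all the arguments. In a
  chain the choice does not matter, because of two members one contains the other with the same
  operations.\<close>

definition pick :: "'u ch_complex set \<Rightarrow> int \<Rightarrow> 'u set \<Rightarrow> 'u ch_complex" where
  "pick \<C> n S = (SOME C. C \<in> \<C> \<and> S \<subseteq> elts C n)"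

definition Union_cx :: "'u ch_complex set \<Rightarrow> 'u ch_complex" where
  "Union_cx \<C> = \<lparr>
     chmod = (\<lambda>n. \<lparr>carrier = (\<Union>C\<in>\<C>. elts C n), monoid.mult = undefined, one = undefined,
       zero = \<zero>\<^bsub>chmod (pick \<C> n {}) n\<^esub>,
       add = (\<lambda>x y. x \<oplus>\<^bsub>chmod (pick \<C> n {x, y}) n\<^esub> y),
       smult = (\<lambda>a x. a \<odot>\<^bsub>chmod (pick \<C> n {x}) n\<^esub> x)\<rparr>),
     diff = (\<lambda>n. \<lambda>x \<in> (\<Union>C\<in>\<C>. elts C n). diff (pick \<C> n {x}) n x)\<rparr>"

lemma carrier_Union_cx: "elts (Union_cx \<C>) n = (\<Union>C\<in>\<C>. elts C n)"
  by (simp add: Union_cx_def)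

lemma csub_Union_cx:
  assumes \<C>: "cchain R \<C>" and C: "C \<in> \<C>" shows "csub R C (Union_cx \<C>)"
proof -
  have pick: "pick \<C> n S \<in> \<C>" "S \<subseteq> elts (pick \<C> n S) n"
    "csub R C (pick \<C> n S) \<or> csub R (pick \<C> n S) C" if "S \<subseteq> elts C n" for n S
  proof -
    have "pick \<C> n S \<in> \<C> \<and> S \<subseteq> elts (pick \<C> n S) n"
      unfolding pick_def by (rule someI[of _ C]) (use that C in blast)
    then show "pick \<C> n S \<in> \<C>" "S \<subseteq> elts (pick \<C> n S) n"
      "csub R C (pick \<C> n S) \<or> csub R (pick \<C> n S) C"
      using \<C> C unfolding cchain_def by blast+
  qed
  show ?thesis
    unfolding csub_def msub_def carrier_Union_cx
  proof (intro allI conjI ballI)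
    fix n
    show "elts C n \<subseteq> (\<Union>C\<in>\<C>. elts C n)" using C by blast
    have "\<zero>\<^bsub>chmod C n\<^esub> = \<zero>\<^bsub>chmod (pick \<C> n {}) n\<^esub>"
      using pick(3)[of "{}" n] csubD(4) by (metis empty_subsetI)
    then show "\<zero>\<^bsub>chmod C n\<^esub> = \<zero>\<^bsub>chmod (Union_cx \<C>) n\<^esub>" by (simp add: Union_cx_def)
    show "x \<oplus>\<^bsub>chmod C n\<^esub> y = x \<oplus>\<^bsub>chmod (Union_cx \<C>) n\<^esub> y"
      if "x \<in> elts C n" "y \<in> elts C n" for x y
      using pick(2,3)[of "{x, y}" n] that by (auto simp: Union_cx_def csubD(5))
    show "a \<odot>\<^bsub>chmod C n\<^esub> x = a \<odot>\<^bsub>chmod (Union_cx \<C>) n\<^esub> x"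
      if "a \<in> carrier R" "x \<in> elts C n" for a x
      using pick(2,3)[of "{x}" n] that by (auto simp: Union_cx_def csubD(6))
    show "diff C n x = diff (Union_cx \<C>) n x" if "x \<in> elts C n" for x
      using pick(2,3)[of "{x}" n] that C by (auto simp: Union_cx_def csubD(2))
  qed
qed

lemma cchain_common:
  assumes \<C>: "cchain R \<C>"
    and x: "x \<in> elts (Union_cx \<C>) n" "y \<in> elts (Union_cx \<C>) n"
  obtains C where "C \<in> \<C>" "x \<in> elts C n" "y \<in> elts C n"
proof -
  obtain C D where CD: "C \<in> \<C>" "x \<in> elts C n" "D \<in> \<C>" "y \<in> elts D n"
    using x unfolding carrier_Union_cx by blast
  then have "csub R C D \<or> csub R D C" using \<C> unfolding cchain_def by blast
  then show thesis using CD csubD(3) that by metis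
qed

context module_universe
begin

text \<open>Each module axiom involves at most three elements, and these lie in a common member of
  the chain.\<close>

lemma Union_cx_objects:
  assumes \<C>: "cchain R \<C>" and small: "small TYPE('u) \<C>" shows "Union_cx \<C> \<in> ch_objects R"
proof -
  let ?U = "Union_cx \<C>"
  have sub: "csub R C ?U" if "C \<in> \<C>" for C using csub_Union_cx[OF \<C> that] .
  have obj: "C \<in> ch_objects R" if "C \<in> \<C>" for C using \<C> that unfolding cchain_def by blast
  obtain C0 where C0: "C0 \<in> \<C>" using \<C> unfolding cchain_def by blast
  have in1: "\<exists>C\<in>\<C>. x \<in> elts C n" if "x \<in> elts ?U n" for x n
    using that unfolding carrier_Union_cx by blast
  have U: "x \<in> elts ?U n" if "C \<in> \<C>" "x \<in> elts C n" for C x n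
    using that unfolding carrier_Union_cx by blast
  have mod: "left_module R (chmod ?U n)" for n
  proof -
    have common: "\<exists>C\<in>\<C>. x \<in> elts C n \<and> y \<in> elts C n"
      if "x \<in> elts ?U n" "y \<in> elts ?U n" for x y
      using cchain_common[OF \<C> that] by blast
    have common3: "\<exists>C\<in>\<C>. x \<in> elts C n \<and> y \<in> elts C n \<and> z \<in> elts C n"
      if xyz: "x \<in> elts ?U n" "y \<in> elts ?U n" "z \<in> elts ?U n" for x y z
    proof -
      obtain C where C: "C \<in> \<C>" "x \<in> elts C n" "y \<in> elts C n" using common xyz by blast
      obtain D where D: "D \<in> \<C>" "z \<in> elts D n" using in1 xyz by blast
      have "csub R C D \<or> csub R D C" using \<C> C D unfolding cchain_def by blast
      then show ?thesis using C D csubD(3) by metis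
    qed
    show ?thesis
    proof (rule left_moduleI)
      show "ring R" by (rule ring_axioms)
      interpret C0: left_module R "chmod C0 n" using obj[OF C0] by (rule ch_objectsD)
      show "\<zero>\<^bsub>chmod ?U n\<^esub> \<in> elts ?U n"
        using U[OF C0 C0.M.zero_closed] csubD(4)[OF sub[OF C0]] by simp
    next
      fix x y assume "x \<in> elts ?U n" "y \<in> elts ?U n"
      then obtain C where C: "C \<in> \<C>" "x \<in> elts C n" "y \<in> elts C n" using common by blast
      interpret C: left_module R "chmod C n" using obj[OF C(1)] by (rule ch_objectsD)
      note s = csubD(5)[OF sub[OF C(1)], symmetric]
      show "x \<oplus>\<^bsub>chmod ?U n\<^esub> y \<in> elts ?U n" using C by (simp add: s U[OF C(1)])
      show "x \<oplus>\<^bsub>chmod ?U n\<^esub> y = y \<oplus>\<^bsub>chmod ?U n\<^esub> x" using C by (simp add: s C.M.a_comm)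
      fix a assume a: "a \<in> carrier R"
      show "a \<odot>\<^bsub>chmod ?U n\<^esub> (x \<oplus>\<^bsub>chmod ?U n\<^esub> y) = a \<odot>\<^bsub>chmod ?U n\<^esub> x \<oplus>\<^bsub>chmod ?U n\<^esub> a \<odot>\<^bsub>chmod ?U n\<^esub> y"
        using C a by (simp add: s csubD(6)[OF sub[OF C(1)], symmetric] C.smult_r_distr C.smult_closed)
    next
      fix x y z assume "x \<in> elts ?U n" "y \<in> elts ?U n" "z \<in> elts ?U n"
      then obtain C where C: "C \<in> \<C>" "x \<in> elts C n" "y \<in> elts C n" "z \<in> elts C n"
        using common3 by blast
      interpret C: left_module R "chmod C n" using obj[OF C(1)] by (rule ch_objectsD)
      note s = csubD(5)[OF sub[OF C(1)], symmetric]
      show "(x \<oplus>\<^bsub>chmod ?U n\<^esub> y) \<oplus>\<^bsub>chmod ?U n\<^esub> z = x \<oplus>\<^bsub>chmod ?U n\<^esub> (y \<oplus>\<^bsub>chmod ?U n\<^esub> z)"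
        using C by (simp add: s C.M.a_assoc)
    next
      fix x assume "x \<in> elts ?U n"
      then obtain C where C: "C \<in> \<C>" "x \<in> elts C n" using in1 by blast
      interpret C: left_module R "chmod C n" using obj[OF C(1)] by (rule ch_objectsD)
      note s = csubD(4,5,6)[OF sub[OF C(1)], symmetric]
      show "\<zero>\<^bsub>chmod ?U n\<^esub> \<oplus>\<^bsub>chmod ?U n\<^esub> x = x" using C by (simp add: s)
      show "\<exists>y\<in>elts ?U n. y \<oplus>\<^bsub>chmod ?U n\<^esub> x = \<zero>\<^bsub>chmod ?U n\<^esub>"
        using C U[OF C(1)] by (intro bexI[of _ "\<ominus>\<^bsub>chmod C n\<^esub> x"]) (simp_all add: s C.M.l_neg)
      show "\<one> \<odot>\<^bsub>chmod ?U n\<^esub> x = x" using C by (simp add: s C.smult_one)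
      fix a assume a: "a \<in> carrier R"
      show "a \<odot>\<^bsub>chmod ?U n\<^esub> x \<in> elts ?U n" using C a by (simp add: s C.smult_closed U[OF C(1)])
      fix b assume b: "b \<in> carrier R"
      show "(a \<oplus> b) \<odot>\<^bsub>chmod ?U n\<^esub> x = a \<odot>\<^bsub>chmod ?U n\<^esub> x \<oplus>\<^bsub>chmod ?U n\<^esub> b \<odot>\<^bsub>chmod ?U n\<^esub> x"
        using C a b by (simp add: s C.smult_l_distr C.smult_closed)
      show "(a \<otimes> b) \<odot>\<^bsub>chmod ?U n\<^esub> x = a \<odot>\<^bsub>chmod ?U n\<^esub> (b \<odot>\<^bsub>chmod ?U n\<^esub> x)"
        using C a b by (simp add: s C.smult_assoc C.smult_closed)
    qed
  qed
  have d: "diff ?U n x \<in> elts C (n - 1)" "diff ?U n x = diff C n x"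
    if "C \<in> \<C>" "x \<in> elts C n" for C n x
    using csubD(2)[OF sub[OF that(1)] that(2)] diff_closed[OF obj[OF that(1)] that(2)] by simp_all
  show ?thesis
  proof (rule ch_objectsI)
    fix n
    have "small TYPE('u) (\<Union>C\<in>\<C>. elts C n)"
      using small mod_objectsD(2) ch_objectsD(2) obj by (intro small_UN) blast+
    then show "chmod ?U n \<in> mod_objects R"
      using mod unfolding mod_objects_def by (simp add: carrier_Union_cx)
    show "diff ?U n \<in> extensional (elts ?U n)" by (simp add: Union_cx_def)
    show "mhom R (chmod ?U n) (chmod ?U (n - 1)) (diff ?U n)"
      unfolding mhom_def
    proof (intro conjI ballI)
      fix x assume "x \<in> elts ?U n"
      then obtain C where C: "C \<in> \<C>" "x \<in> elts C n" using in1 by blast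
      then show "diff ?U n x \<in> elts ?U (n - 1)" using d U by blast
    next
      fix x y assume "x \<in> elts ?U n" "y \<in> elts ?U n"
      then obtain C where C: "C \<in> \<C>" "x \<in> elts C n" "y \<in> elts C n"
        by (rule cchain_common[OF \<C>])
      interpret C: left_module R "chmod C n" using obj[OF C(1)] by (rule ch_objectsD)
      show "diff ?U n (x \<oplus>\<^bsub>chmod ?U n\<^esub> y) = diff ?U n x \<oplus>\<^bsub>chmod ?U (n - 1)\<^esub> diff ?U n y"
        using C mhomD(2)[OF ch_objectsD(3)[OF obj[OF C(1)]] C(2,3)]
          csubD(5)[OF sub[OF C(1)] d(1)[OF C(1,2)] d(1)[OF C(1,3)]]
        by (simp add: csubD(5)[OF sub[OF C(1)], symmetric] d(2)[OF C(1)])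
    next
      fix a x assume a: "a \<in> carrier R" and "x \<in> elts ?U n"
      then obtain C where C: "C \<in> \<C>" "x \<in> elts C n" using in1 by blast
      interpret C: left_module R "chmod C n" using obj[OF C(1)] by (rule ch_objectsD)
      show "diff ?U n (a \<odot>\<^bsub>chmod ?U n\<^esub> x) = a \<odot>\<^bsub>chmod ?U (n - 1)\<^esub> diff ?U n x"
        using C a mhomD(3)[OF ch_objectsD(3)[OF obj[OF C(1)]] a C(2)]
          csubD(6)[OF sub[OF C(1)] a d(1)[OF C(1,2)]]
        by (simp add: csubD(6)[OF sub[OF C(1)], symmetric] d(2)[OF C(1)] C.smult_closed)
    qed
    fix x assume "x \<in> elts ?U n"
    then obtain C where C: "C \<in> \<C>" "x \<in> elts C n" using in1 by blast
    show "diff ?U (n - 1) (diff ?U n x) = \<zero>\<^bsub>chmod ?U (n - 2)\<^esub>"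
      using d(2)[OF C] d(2)[OF C(1) diff_closed[OF obj[OF C(1)] C(2)]]
        ch_objectsD(4)[OF obj[OF C(1)] C(2)] csubD(4)[OF sub[OF C(1)]] by simp
  qed
qed

text \<open>\<open>Z a\<close> is the stage at \<open>a\<close>, and \<open>D a\<close> is the union
  of \<open>X\<close> and all stages strictly below \<open>a\<close>. Letting each stage start from
  \<open>D a\<close> treats the least element, successors and limits alike.\<close>

definition tower where
  "tower T r X D Z \<longleftrightarrow> Well_order r \<and> small TYPE('u) (Field r) \<and> X \<in> ch_objects R \<and>
     (\<forall>a\<in>Field r. D a = Union_cx (insert X (Z ` {b. (b, a) \<in> r - Id})) \<and> D a \<in> ch_objects R \<and>
       Z a \<in> ch_objects R \<and> csub R X (D a) \<and> left_lifting T (D a) (Z a) \<and>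
       (\<forall>b. (b, a) \<in> r - Id \<longrightarrow> csub R (Z b) (D a)))"

lemma towerD:
  assumes "tower T r X D Z" "a \<in> Field r"
  shows "D a = Union_cx (insert X (Z ` {b. (b, a) \<in> r - Id}))" "D a \<in> ch_objects R" "Z a \<in> ch_objects R"
    "csub R X (D a)" "left_lifting T (D a) (Z a)" "(b, a) \<in> r - Id \<Longrightarrow> csub R (Z b) (D a)"
    "csub R (D a) (Z a)" "csub R X (Z a)"
  using assms left_liftingD(1) csub_trans unfolding tower_def by metis+

lemma tower_chain:
  assumes tw: "tower T r X D Z" shows "cchain R (insert X (Z ` Field r))"
proof -
  have tot: "(a, b) \<in> r - Id \<or> (b, a) \<in> r - Id \<or> a = b" if "a \<in> Field r" "b \<in> Field r" for a b
    using tw that unfolding tower_def well_order_on_def linear_order_on_def total_on_def by blast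
  have "csub R (Z a) (Z b)" if "a \<in> Field r" "b \<in> Field r" "(a, b) \<in> r - Id" for a b
    using csub_trans[OF towerD(6)[OF tw that(2,3)] towerD(7)[OF tw that(2)]] .
  then have "csub R (Z a) (Z b) \<or> csub R (Z b) (Z a)" if "a \<in> Field r" "b \<in> Field r" for a b
    using tot[OF that] that csub_refl by blast
  moreover have "X \<in> ch_objects R" using tw unfolding tower_def by blast
  ultimately show ?thesis
    unfolding cchain_def using towerD(3,8)[OF tw] csub_refl by blast
qed

text \<open>Transfinite recursion along \<open>r\<close>. The predicate \<open>Q\<close> records
  what the step at \<open>a\<close> achieves; in the applications this is the solution of extension
  problems.\<close>

lemma tower_exists:
  fixes Q :: "'i \<Rightarrow> 'u ch_complex \<Rightarrow> 'u ch_complex \<Rightarrow> bool"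
  assumes r: "Well_order r" and small: "small TYPE('u) (Field r)" and X: "X \<in> ch_objects R"
    and step: "\<And>a W. a \<in> Field r \<Longrightarrow> W \<in> ch_objects R \<Longrightarrow> csub R X W \<Longrightarrow>
      \<exists>W'. W' \<in> ch_objects R \<and> left_lifting T W W' \<and> Q a W W'"
  shows "\<exists>D Z. tower T r X D Z \<and> (\<forall>a\<in>Field r. Q a (D a) (Z a))"
proof -
  let ?less = "r - Id"
  have wf: "wf ?less" using r by (simp add: well_order_on_def)
  have Fld: "b \<in> Field r" if "(b, a) \<in> ?less" for a b using that by (auto simp: Field_def)
  have tot: "(a, b) \<in> ?less \<or> (b, a) \<in> ?less \<or> a = b" if "a \<in> Field r" "b \<in> Field r" for a b
    using r that unfolding well_order_on_def linear_order_on_def total_on_def by blast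
  have trans: "(a, c) \<in> ?less" if "(a, b) \<in> ?less" "(b, c) \<in> ?less" for a b c
    using r that unfolding well_order_on_def linear_order_on_def partial_order_on_def preorder_on_def
    by (auto dest: transD antisymD)
  define S where "S a W = (SOME W'. W' \<in> ch_objects R \<and> left_lifting T W W' \<and> Q a W W')" for a W
  \<comment> \<open>The recursion applies the choice \<open>S\<close> blindly. That the union below
    \<open>a\<close> is a complex, so that \<open>step\<close> justifies the choice, depends on the
    earlier stages forming a chain and is proved afterwards by induction in
    \<open>main\<close>.\<close>
  define Z where "Z = wfrec ?less (\<lambda>f a. S a (Union_cx (insert X (f ` {b. (b, a) \<in> ?less}))))"
  define D where "D a = Union_cx (insert X (Z ` {b. (b, a) \<in> ?less}))" for a
  have Z: "Z a = S a (D a)" for a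
  proof -
    have "cut Z ?less a ` {b. (b, a) \<in> ?less} = Z ` {b. (b, a) \<in> ?less}"
      by (intro image_cong refl) (simp add: cut_apply)
    then show ?thesis unfolding D_def using def_wfrec[OF Z_def[THEN eq_reflection] wf, of a] by simp
  qed
  have main: "a \<in> Field r \<longrightarrow> D a \<in> ch_objects R \<and> Z a \<in> ch_objects R \<and> csub R X (D a) \<and> left_lifting T (D a) (Z a) \<and>
      Q a (D a) (Z a) \<and> (\<forall>b. (b, a) \<in> ?less \<longrightarrow> csub R (Z b) (D a))" for a
  proof (induction a rule: wf_induct_rule[OF wf])
    case (1 a)
    show ?case
    proof
      assume a: "a \<in> Field r"
      have IH: "D b \<in> ch_objects R" "Z b \<in> ch_objects R" "csub R X (Z b)" "csub R (D b) (Z b)"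
        "\<And>c. (c, b) \<in> ?less \<Longrightarrow> csub R (Z c) (Z b)" if "(b, a) \<in> ?less" for b
        using 1[OF that] Fld[OF that] left_liftingD(1) csub_trans by blast+
      have comp: "csub R (Z b) (Z c) \<or> csub R (Z c) (Z b)" if "(b, a) \<in> ?less" "(c, a) \<in> ?less" for b c
        using tot[OF Fld[OF that(1)] Fld[OF that(2)]] IH(5) that csub_refl by blast
      have chain: "cchain R (insert X (Z ` {b. (b, a) \<in> ?less}))"
        unfolding cchain_def using X IH(2,3) comp csub_refl by blast
      have "small TYPE('u) {b. (b, a) \<in> ?less}" by (rule small_subset[OF small]) (use Fld in blast)
      then have "small TYPE('u) (insert X (Z ` {b. (b, a) \<in> ?less}))"
        using small_Un[OF small_finite[of "{X}"] small_image] by auto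
      then have Da: "D a \<in> ch_objects R" unfolding D_def by (rule Union_cx_objects[OF chain])
      have sub: "csub R C (D a)" if "C \<in> insert X (Z ` {b. (b, a) \<in> ?less})" for C
        unfolding D_def by (rule csub_Union_cx[OF chain that])
      have "Z a \<in> ch_objects R \<and> left_lifting T (D a) (Z a) \<and> Q a (D a) (Z a)"
        unfolding Z[of a] S_def by (rule someI_ex, rule step[OF a Da sub]) simp
      then show "D a \<in> ch_objects R \<and> Z a \<in> ch_objects R \<and> csub R X (D a) \<and> left_lifting T (D a) (Z a) \<and>
          Q a (D a) (Z a) \<and> (\<forall>b. (b, a) \<in> ?less \<longrightarrow> csub R (Z b) (D a))"
        using Da sub by blast
    qed
  qed
  have "tower T r X D Z" unfolding tower_def using r small X main D_def by blast
  then show ?thesis using main by blast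
qed


text \<open>Eklof's lemma. A lift along the whole tower is obtained from Zorn's lemma, applied to the graphs
  of lifts \<open>h\<close> defined on unions \<open>N\<close> of stages of the tower.\<close>

lemma tower_left_lifting:
  assumes tw: "tower T r X D Z" shows "left_lifting T X (Union_cx (insert X (Z ` Field r)))"
proof (rule left_liftingI)
  define U where "U = Union_cx (insert X (Z ` Field r))"
  have chain: "cchain R (insert X (Z ` Field r))" by (rule tower_chain[OF tw])
  have r: "Well_order r" and X: "X \<in> ch_objects R" and "small TYPE('u) (Field r)"
    using tw unfolding tower_def by auto
  then have UO: "U \<in> ch_objects R"
    unfolding U_def by (intro Union_cx_objects[OF chain]) (use small_Un[OF small_finite[of "{X}"] small_image] in auto)
  have XU: "csub R X U" unfolding U_def by (rule csub_Union_cx[OF chain]) simp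
  have ZU: "csub R (Z a) U" if "a \<in> Field r" for a
    unfolding U_def by (rule csub_Union_cx[OF chain]) (use that in simp)
  have DU: "csub R (D a) U" if "a \<in> Field r" for a
    using csub_trans[OF towerD(7)[OF tw that] ZU[OF that]] .
  have UC: "elts U n = elts X n \<union> (\<Union>a\<in>Field r. elts (Z a) n)" for n
    unfolding U_def carrier_Union_cx by blast
  show "csub R X (Union_cx (insert X (Z ` Field r)))" using XU unfolding U_def .
  fix Y f E g F u v
  assume Y: "Y \<in> T" and ses: "ch_ses R Y f E g F" and u: "chom R X E u"
    and v: "chom R (Union_cx (insert X (Z ` Field r))) F v"
    and uv: "\<And>n x. x \<in> elts X n \<Longrightarrow> g n (u n x) = v n x"
  note v = v[folded U_def]
  \<comment> \<open>The last clause makes \<open>N\<close> a union of \<open>X\<close> and entire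
    stages; this is what identifies it with some \<open>D a\<close> below.\<close>
  define good where "good N h \<longleftrightarrow> gsub R U N \<and> chom R (subcx U N) E h \<and>
      (\<forall>n. elts X n \<subseteq> N n) \<and> (\<forall>n. \<forall>x\<in>elts X n. h n x = u n x) \<and>
      (\<forall>n. \<forall>x\<in>N n. g n (h n x) = v n x) \<and>
      (\<forall>n. \<forall>x\<in>N n. x \<in> elts X n \<or>
        (\<exists>b\<in>Field r. x \<in> elts (Z b) n \<and> (\<forall>m. elts (Z b) m \<subseteq> N m)))" for N h
  have goodD: "gsub R U N" "chom R (subcx U N) E h" "x \<in> elts X n \<Longrightarrow> x \<in> N n"
    "x \<in> elts X n \<Longrightarrow> h n x = u n x" "x \<in> N n \<Longrightarrow> g n (h n x) = v n x"
    "x \<in> N n \<Longrightarrow> x \<in> elts X n \<or>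
        (\<exists>b\<in>Field r. x \<in> elts (Z b) n \<and> (\<forall>m. elts (Z b) m \<subseteq> N m))"
    if "good N h" for N h n x
    using that unfolding good_def by blast+
  \<comment> \<open>Encoding a partial lift by its graph turns extension of lifts into inclusion of
    sets, the order of Zorn's lemma.\<close>
  define graph where "graph N h = {(n, x, h n x) | n x. x \<in> N n}" for N :: "int \<Rightarrow> 'u set" and h :: "int \<Rightarrow> 'u \<Rightarrow> 'u"
  have graph: "(n, x, y) \<in> graph N h \<longleftrightarrow> x \<in> N n \<and> y = h n x" for n x y N h
    unfolding graph_def by blast
  have graph_mono: "N n \<subseteq> N' n" if sub: "graph N h \<subseteq> graph N' h'" for N N' h h' n
  proof
    fix x assume "x \<in> N n"
    then have "(n, x, h n x) \<in> graph N' h'" using subsetD[OF sub, of "(n, x, h n x)"] graph by simp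
    then show "x \<in> N' n" using graph by simp
  qed
  define \<A> where "\<A> = {graph N h | N h. good N h}"
  have "\<exists>M\<in>\<A>. \<forall>G\<in>\<A>. M \<subseteq> G \<longrightarrow> G = M"
  proof (rule subset_Zorn_nonempty)
    have "gsub R U (\<lambda>n. elts X n)" by (rule gsub_csub[OF XU X])
    moreover have "chom R (subcx U (\<lambda>n. elts X n)) E u"
    proof -
      have "csub R (subcx U (\<lambda>n. elts X n)) X"
        unfolding csub_def msub_def by (simp add: csubD(2,4,5,6)[OF XU])
      then show ?thesis by (rule chom_from_csub[OF u])
    qed
    ultimately have "good (\<lambda>n. elts X n) u" unfolding good_def using uv by simp
    then show "\<A> \<noteq> {}" unfolding \<A>_def by blast
  next
    fix \<C> assume ne: "\<C> \<noteq> {}" and ch: "subset.chain \<A> \<C>"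
    have mem: "\<exists>N h. G = graph N h \<and> good N h" if "G \<in> \<C>" for G
      using ch that unfolding subset.chain_def \<A>_def by blast
    have lin: "G \<subseteq> G' \<or> G' \<subseteq> G" if "G \<in> \<C>" "G' \<in> \<C>" for G G'
      using ch that unfolding subset_chain_def by blast
    define N where "N n = {x. \<exists>y. (n, x, y) \<in> \<Union>\<C>}" for n
    define h where "h n x = (SOME y. (n, x, y) \<in> \<Union>\<C>)" for n x
    have single: "y = y'" if yy: "(n, x, y) \<in> \<Union>\<C>" "(n, x, y') \<in> \<Union>\<C>" for n x y y'
    proof -
      obtain G G' where G: "G \<in> \<C>" "G' \<in> \<C>" "(n, x, y) \<in> G" "(n, x, y') \<in> G'" using yy by blast
      then obtain G'' where "G'' \<in> \<C>" "(n, x, y) \<in> G''" "(n, x, y') \<in> G''" using lin[OF G(1,2)] by blast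
      then show ?thesis using mem[of G''] graph by auto
    qed
    have hval: "h n x = y" if "(n, x, y) \<in> \<Union>\<C>" for n x y
      unfolding h_def using single that by (intro some_equality) auto
    have sub: "x \<in> N n" "h n x = h' n x" if "graph N' h' \<in> \<C>" "x \<in> N' n" for N' h' n x
    proof -
      have "(n, x, h' n x) \<in> \<Union>\<C>" using that graph by blast
      then show "x \<in> N n" "h n x = h' n x" using hval unfolding N_def by blast+
    qed
    have ex: "\<exists>N' h'. graph N' h' \<in> \<C> \<and> good N' h' \<and> x \<in> N' n" if x: "x \<in> N n" for n x
    proof -
      obtain y G where "G \<in> \<C>" "(n, x, y) \<in> G" using x unfolding N_def by blast
      then show ?thesis using mem[of G] graph by metis
    qed
    have ex2: "\<exists>N' h'. graph N' h' \<in> \<C> \<and> good N' h' \<and> x \<in> N' n \<and> y \<in> N' n"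
      if xy: "x \<in> N n" "y \<in> N n" for n x y
    proof -
      obtain N1 h1 N2 h2 where G: "graph N1 h1 \<in> \<C>" "good N1 h1" "x \<in> N1 n" "graph N2 h2 \<in> \<C>" "good N2 h2" "y \<in> N2 n"
        using ex[OF xy(1)] ex[OF xy(2)] by blast
      have "N1 n \<subseteq> N2 n \<or> N2 n \<subseteq> N1 n"
        using lin[OF G(1,4)] graph_mono by metis
      then show ?thesis using G by blast
    qed
    obtain N0 h0 where G0: "graph N0 h0 \<in> \<C>" "good N0 h0" using ne mem by blast
    have "gsub R U N"
      unfolding gsub_def smod_def
    proof (intro allI conjI ballI subsetI)
      fix n
      show "x \<in> elts U n" if "x \<in> N n" for x
      proof -
        obtain N' h' where "good N' h'" "x \<in> N' n" using ex[OF \<open>x \<in> N n\<close>] by blast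
        then show ?thesis using gsubD(3)[OF goodD(1)] by metis
      qed
      have "\<zero>\<^bsub>chmod U n\<^esub> \<in> N0 n"
        using gsubD(1)[OF goodD(1)[OF G0(2)], of n] unfolding smod_def by blast
      then show "\<zero>\<^bsub>chmod U n\<^esub> \<in> N n" by (rule sub(1)[OF G0(1)])
      show "x \<oplus>\<^bsub>chmod U n\<^esub> y \<in> N n" if "x \<in> N n" "y \<in> N n" for x y
      proof -
        obtain N' h' where G: "graph N' h' \<in> \<C>" "good N' h'" "x \<in> N' n" "y \<in> N' n" using ex2[OF \<open>x \<in> N n\<close> \<open>y \<in> N n\<close>] by blast
        have "x \<oplus>\<^bsub>chmod U n\<^esub> y \<in> N' n"
          using G(3,4) gsubD(1)[OF goodD(1)[OF G(2)], of n] unfolding smod_def by blast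
        then show ?thesis by (rule sub(1)[OF G(1)])
      qed
      show "a \<odot>\<^bsub>chmod U n\<^esub> x \<in> N n" if "a \<in> carrier R" "x \<in> N n" for a x
      proof -
        obtain N' h' where G: "graph N' h' \<in> \<C>" "good N' h'" "x \<in> N' n" using ex[OF \<open>x \<in> N n\<close>] by blast
        have "a \<odot>\<^bsub>chmod U n\<^esub> x \<in> N' n"
          using G(3) that gsubD(1)[OF goodD(1)[OF G(2)], of n] unfolding smod_def by blast
        then show ?thesis by (rule sub(1)[OF G(1)])
      qed
      show "diff U n x \<in> N (n - 1)" if "x \<in> N n" for x
      proof -
        obtain N' h' where G: "graph N' h' \<in> \<C>" "good N' h'" "x \<in> N' n" using ex[OF \<open>x \<in> N n\<close>] by blast
        show ?thesis by (rule sub(1)[OF G(1) gsubD(2)[OF goodD(1)[OF G(2)] G(3)]])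
      qed
    qed
    moreover have "chom R (subcx U N) E h"
    proof (rule chomI)
      fix n
      show "mhom R (chmod (subcx U N) n) (chmod E n) (h n)"
        unfolding mhom_def subcx_simps
      proof (intro conjI ballI)
        fix x assume "x \<in> N n"
        then obtain N' h' where G: "graph N' h' \<in> \<C>" "good N' h'" "x \<in> N' n" using ex by blast
        then show "h n x \<in> elts E n"
          using sub(2)[OF G(1,3)] chomD(3)[OF goodD(2)[OF G(2)], of x n] by simp
      next
        fix x y assume xy: "x \<in> N n" "y \<in> N n"
        obtain N' h' where G: "graph N' h' \<in> \<C>" "good N' h'" "x \<in> N' n" "y \<in> N' n" using ex2[OF xy] by blast
        have "x \<oplus>\<^bsub>chmod U n\<^esub> y \<in> N' n"
          using G(3,4) gsubD(1)[OF goodD(1)[OF G(2)], of n] unfolding smod_def by blast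
        then show "h n (x \<oplus>\<^bsub>chmod U n\<^esub> y) = h n x \<oplus>\<^bsub>chmod E n\<^esub> h n y"
          using sub(2)[OF G(1)] mhomD(2)[OF chomD(1)[OF goodD(2)[OF G(2)]], of x n y] G by simp
      next
        fix a x assume a: "a \<in> carrier R" and "x \<in> N n"
        then obtain N' h' where G: "graph N' h' \<in> \<C>" "good N' h'" "x \<in> N' n" using ex by blast
        have "a \<odot>\<^bsub>chmod U n\<^esub> x \<in> N' n"
          using G(3) a gsubD(1)[OF goodD(1)[OF G(2)], of n] unfolding smod_def by blast
        then show "h n (a \<odot>\<^bsub>chmod U n\<^esub> x) = a \<odot>\<^bsub>chmod E n\<^esub> h n x"
          using sub(2)[OF G(1)] mhomD(3)[OF chomD(1)[OF goodD(2)[OF G(2)]], of a x n] G a by simp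
      qed
      fix x assume "x \<in> elts (subcx U N) n"
      then have x: "x \<in> N n" by simp
      then obtain N' h' where G: "graph N' h' \<in> \<C>" "good N' h'" "x \<in> N' n" using ex by blast
      then have "h (n - 1) (diff U n x) = diff E n (h n x)"
        using sub(2)[OF G(1)] chomD(2)[OF goodD(2)[OF G(2)], of x n] gsubD(2)[OF goodD(1)[OF G(2)] G(3)] by simp
      then show "h (n - 1) (diff (subcx U N) n x) = diff E n (h n x)" using x by simp
    qed
    moreover have "x \<in> N n" "h n x = u n x" if "x \<in> elts X n" for n x
      using sub[OF G0(1) goodD(3)[OF G0(2) that]] goodD(4)[OF G0(2) that] by simp_all
    moreover have "g n (h n x) = v n x" "x \<in> elts X n \<or>
        (\<exists>b\<in>Field r. x \<in> elts (Z b) n \<and> (\<forall>m. elts (Z b) m \<subseteq> N m))"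
      if x: "x \<in> N n" for n x
    proof -
      obtain N' h' where G: "graph N' h' \<in> \<C>" "good N' h'" "x \<in> N' n" using ex[OF x] by blast
      show "g n (h n x) = v n x" using sub(2)[OF G(1,3)] goodD(5)[OF G(2,3)] by simp
      show "x \<in> elts X n \<or>
        (\<exists>b\<in>Field r. x \<in> elts (Z b) n \<and> (\<forall>m. elts (Z b) m \<subseteq> N m))"
        using goodD(6)[OF G(2,3)] sub(1)[OF G(1)] by (meson subset_iff)
    qed
    ultimately have "good N h" unfolding good_def by blast
    moreover have "\<Union>\<C> = graph N h"
    proof (rule Set.set_eqI)
      fix t :: "int \<times> 'u \<times> 'u"
      obtain n x y where t: "t = (n, x, y)" by (cases t) auto
      show "t \<in> \<Union>\<C> \<longleftrightarrow> t \<in> graph N h"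
        unfolding t graph using hval unfolding N_def by blast
    qed
    ultimately show "\<Union>\<C> \<in> \<A>" unfolding \<A>_def by blast
  qed
  then obtain M where M: "M \<in> \<A>" "\<forall>G\<in>\<A>. M \<subseteq> G \<longrightarrow> G = M" by blast
  then obtain N h where good: "good N h" and MN: "M = graph N h" unfolding \<A>_def by blast
  have max: "graph N' h' = graph N h" if "good N' h'" "graph N h \<subseteq> graph N' h'" for N' h'
  proof -
    have "graph N' h' \<in> \<A>" unfolding \<A>_def using that(1) by blast
    then show ?thesis using M(2) that(2) unfolding MN by blast
  qed
  \<comment> \<open>If a stage were missing from \<open>N\<close>, the lift could be extended over
    the least missing one.\<close>
  have all: "elts (Z b) m \<subseteq> N m" if b: "b \<in> Field r" for b m
  proof (rule ccontr)
    assume "\<not> elts (Z b) m \<subseteq> N m"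
    then have "b \<in> {b \<in> Field r. \<exists>m. \<not> elts (Z b) m \<subseteq> N m}" (is "b \<in> ?B") using b by blast
    moreover have wf: "wf (r - Id)" using r by (simp add: well_order_on_def)
    ultimately have "\<exists>a\<in>?B. \<forall>c. (c, a) \<in> r - Id \<longrightarrow> c \<notin> ?B"
      using wf[unfolded wf_eq_minimal, THEN spec, of ?B] by blast
    then obtain a where "a \<in> ?B" and min: "\<And>c. (c, a) \<in> r - Id \<Longrightarrow> c \<notin> ?B" by blast
    then obtain k where a: "a \<in> Field r" and k: "\<not> elts (Z a) k \<subseteq> N k" by blast
    have below: "elts (Z c) n \<subseteq> N n" if "(c, a) \<in> r - Id" for c n
      using min[OF that] that by (auto simp: Field_def)
    have tot: "(a, b) \<in> r - Id \<or> (b, a) \<in> r - Id \<or> a = b" if "b \<in> Field r" for b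
      using r a that unfolding well_order_on_def linear_order_on_def total_on_def by blast
    have DC: "elts (D a) n = elts X n \<union> (\<Union>c\<in>{c. (c, a) \<in> r - Id}. elts (Z c) n)" for n
      unfolding towerD(1)[OF tw a] carrier_Union_cx by blast
    \<comment> \<open>A stage contained in \<open>N\<close> cannot lie at or above \<open>a\<close>,
      since it would contain \<open>Z a\<close>. So \<open>N\<close> consists of \<open>X\<close>
      and the stages below \<open>a\<close>.\<close>
    have ND: "N n = elts (D a) n" for n
    proof
      show "elts (D a) n \<subseteq> N n" unfolding DC using below goodD(3)[OF good] by blast
      show "N n \<subseteq> elts (D a) n"
      proof
        fix x assume x: "x \<in> N n"
        show "x \<in> elts (D a) n"
        proof (cases "x \<in> elts X n")
          case True
          then show ?thesis unfolding DC by blast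
        next
          case False
          then obtain c where c: "c \<in> Field r" "x \<in> elts (Z c) n" "\<And>m. elts (Z c) m \<subseteq> N m"
            using goodD(6)[OF good x] by blast
          have "(a, c) \<notin> r - Id"
          proof
            assume ac: "(a, c) \<in> r - Id"
            have "csub R (Z a) (Z c)"
              using csub_trans[OF towerD(6)[OF tw c(1) ac] towerD(7)[OF tw c(1)]] .
            then have "elts (Z a) k \<subseteq> elts (Z c) k"
              using csubD(1)[of R "Z a" "Z c" k] unfolding msub_def by blast
            then show False using k c(3)[of k] by blast
          qed
          moreover have "a \<noteq> c" using c(3) k by blast
          ultimately have "(c, a) \<in> r - Id" using tot[OF c(1)] by blast
          then show ?thesis unfolding DC using c(2) by blast
        qed
      qed
    qed
    have "csub R (D a) (subcx U N)"
      unfolding csub_def msub_def using ND csubD(2,4,5,6)[OF DU[OF a]] by simp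
    then have hD: "chom R (D a) E h" by (rule chom_from_csub[OF goodD(2)[OF good]])
    have "g n (h n x) = v n x" if "x \<in> elts (D a) n" for n x
      using goodD(5)[OF good] that ND by blast
    from left_liftingD(2)[OF towerD(5)[OF tw a] Y ses hD chom_from_csub[OF v ZU[OF a]] this]
    obtain h' where h': "chom R (Z a) E h'" "\<And>n x. x \<in> elts (D a) n \<Longrightarrow> h' n x = h n x"
      "\<And>n x. x \<in> elts (Z a) n \<Longrightarrow> g n (h' n x) = v n x" by blast
    let ?N = "\<lambda>n. elts (Z a) n"
    have NZ: "N n \<subseteq> ?N n" for n unfolding ND using csubD(3)[OF towerD(7)[OF tw a]] by blast
    have "csub R (subcx U ?N) (Z a)"
      unfolding csub_def msub_def by (simp add: csubD(2,4,5,6)[OF ZU[OF a]])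
    then have "chom R (subcx U ?N) E h'" by (rule chom_from_csub[OF h'(1)])
    moreover have "gsub R U ?N" by (rule gsub_csub[OF ZU[OF a] towerD(3)[OF tw a]])
    moreover have "x \<in> ?N n" "h' n x = u n x" if "x \<in> elts X n" for n x
      using NZ[of n] h'(2)[of x n] goodD(3,4)[OF good that] ND[of n] by auto
    ultimately have "good ?N h'" unfolding good_def using h'(3) a by blast
    moreover have "graph N h \<subseteq> graph ?N h'"
      unfolding graph_def using NZ h'(2) ND by fastforce
    ultimately have "graph ?N h' = graph N h" by (rule max)
    from graph_mono[OF equalityD1[OF this], of k] have "?N k \<subseteq> N k" .
    then show False using k by blast
  qed
  have "elts U n \<subseteq> N n" for n unfolding UC using all goodD(3)[OF good] by blast
  then have NU: "N n = elts U n" for n using gsubD(3)[OF goodD(1)[OF good]] by blast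
  have "csub R U (subcx U N)" unfolding csub_def msub_def by (simp add: NU)
  then have "chom R U E h" by (rule chom_from_csub[OF goodD(2)[OF good]])
  then show "\<exists>h. chom R (Union_cx (insert X (Z ` Field r))) E h \<and> (\<forall>n. \<forall>x\<in>elts X n. h n x = u n x) \<and>
       (\<forall>n. \<forall>x\<in>elts (Union_cx (insert X (Z ` Field r))) n. g n (h n x) = v n x)"
    unfolding U_def[symmetric] using goodD(4,5)[OF good] NU by blast
qed

end

section \<open>The small object argument\<close>

context module_universe
begin

lemma chom_corestrict:
  assumes f: "chom R B U f" and C: "csub R C U" "C \<in> ch_objects R"
    and im: "\<And>n x. x \<in> elts B n \<Longrightarrow> f n x \<in> elts C n"
  shows "chom R B C f"
proof (rule chomI)
  fix n
  show "mhom R (chmod B n) (chmod C n) (f n)"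
    using chomD(1)[OF f, of n] im unfolding mhom_def by (simp add: csubD(5,6)[OF C(1)])
  show "f (n - 1) (diff B n x) = diff C n (f n x)" if "x \<in> elts B n" for x
    using chomD(2)[OF f that] csubD(2)[OF C(1) im[OF that]] by simp
qed

lemma Union_tower:
  assumes "tower T r X D Z"
  shows "Union_cx (insert X (Z ` Field r)) \<in> ch_objects R"
    "a \<in> Field r \<Longrightarrow> csub R (Z a) (Union_cx (insert X (Z ` Field r)))"
    "a \<in> Field r \<Longrightarrow> csub R (D a) (Union_cx (insert X (Z ` Field r)))"
proof -
  have chain: "cchain R (insert X (Z ` Field r))" by (rule tower_chain[OF assms])
  have "small TYPE('u) (Field r)" using assms unfolding tower_def by blast
  then have "small TYPE('u) ({X} \<union> Z ` Field r)" by (intro small_Un small_image) (simp_all add: small_finite)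
  then show "Union_cx (insert X (Z ` Field r)) \<in> ch_objects R"
    by (intro Union_cx_objects[OF chain]) simp
  assume a: "a \<in> Field r"
  show Z: "csub R (Z a) (Union_cx (insert X (Z ` Field r)))"
    by (rule csub_Union_cx[OF chain]) (use a in simp)
  show "csub R (D a) (Union_cx (insert X (Z ` Field r)))"
    by (rule csub_trans[OF towerD(7)[OF assms a] Z])
qed

text \<open>One round of the small object argument. The problems (s, \<phi>) are solved one at a
  time along a well-order of the set \<open>I\<close> of all of them. A map \<phi> into
  \<open>W\<close> remains a map into every later stage, so it can be pushed out when its turn
  comes.\<close>

lemma solve_extension_problems:
  assumes small: "small TYPE('u) \<S>"
    and P: "\<And>s. s \<in> \<S> \<Longrightarrow> P s \<in> ch_objects R" and K: "\<And>s. s \<in> \<S> \<Longrightarrow> gsub R (P s) (K s)"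
    and lpK: "\<And>s. s \<in> \<S> \<Longrightarrow> left_lifting T (subcx (P s) (K s)) (P s)" and W: "W \<in> ch_objects R"
  shows "\<exists>W'. W' \<in> ch_objects R \<and> left_lifting T W W' \<and>
    (\<forall>s\<in>\<S>. \<forall>\<phi>. chom R (subcx (P s) (K s)) W \<phi> \<longrightarrow>
      (\<exists>\<psi>. chom R (P s) W' \<psi> \<and> (\<forall>n. \<forall>k\<in>K s n. \<psi> n k = \<phi> n k)))"
proof -
  \<comment> \<open>Only extensional maps are listed, so that \<open>I\<close> is small.\<close>
  define I where "I = {(s, \<phi>). s \<in> \<S> \<and> (\<forall>n. \<phi> n \<in> K s n \<rightarrow>\<^sub>E elts W n) \<and>
    chom R (subcx (P s) (K s)) W \<phi>}"
  let ?Q = "\<lambda>(s, \<phi>) V V'. \<exists>\<psi>. chom R (P s) V' \<psi> \<and> (\<forall>n. \<forall>k\<in>K s n. \<psi> n k = \<phi> n k)"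
  have carr: "small TYPE('u) (elts C n)" if "C \<in> ch_objects R" for C n
    by (rule mod_objectsD(2)[OF ch_objectsD(2)[OF that]])
  have "small TYPE('u) (\<Union>s\<in>\<S>. Pair s ` {h. \<forall>n. h n \<in> K s n \<rightarrow>\<^sub>E elts W n})"
  proof (intro small_UN[OF small] small_image small_graded_maps carr[OF W])
    fix s n assume "s \<in> \<S>"
    then show "small TYPE('u) (K s n)"
      using small_subset[OF carr[OF P]] gsubD(3)[OF K] by (metis subsetI)
  qed
  then have "small TYPE('u) I" by (rule small_subset) (auto simp: I_def)
  then have I: "small TYPE('u) (Field |I| )" by (simp add: Field_card_of)
  have "\<exists>D Z. tower T |I| W D Z \<and> (\<forall>a\<in>Field |I|. ?Q a (D a) (Z a))"
  proof (rule tower_exists[OF card_of_Well_order I W])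
    fix a V assume "a \<in> Field |I|" and V: "V \<in> ch_objects R" and WV: "csub R W V"
    then obtain s \<phi> where a: "a = (s, \<phi>)" "s \<in> \<S>" "chom R (subcx (P s) (K s)) W \<phi>"
      by (auto simp: Field_card_of I_def)
    have phi: "chom R (subcx (P s) (K s)) V \<phi>" by (rule chom_into_csub[OF a(3) WV])
    obtain Z \<psi> where po: "cpushout V (P s) (K s) \<phi> Z \<psi>"
      using cpushout_exists[OF V P[OF a(2)] K[OF a(2)] phi] .
    have "left_lifting T V Z" by (rule pushout_left_lifting[OF lpK[OF a(2)] po phi])
    moreover have "\<forall>n. \<forall>k\<in>K s n. \<psi> n k = \<phi> n k" using cpushoutD(8)[OF po] by blast
    ultimately show "\<exists>V'. V' \<in> ch_objects R \<and> left_lifting T V V' \<and> ?Q a V V'"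
      using cpushoutD(3,6)[OF po] a(1) by auto
  qed
  then obtain D Z where tw: "tower T |I| W D Z" and Q: "\<And>a. a \<in> Field |I| \<Longrightarrow> ?Q a (D a) (Z a)" by blast
  let ?U = "Union_cx (insert W (Z ` Field |I| ))"
  have "\<exists>\<psi>. chom R (P s) ?U \<psi> \<and> (\<forall>n. \<forall>k\<in>K s n. \<psi> n k = \<phi> n k)"
    if s: "s \<in> \<S>" and phi: "chom R (subcx (P s) (K s)) W \<phi>" for s \<phi>
  proof -
    \<comment> \<open>An arbitrary map is represented in the index set by its extensional
      restriction.\<close>
    define \<phi>' where "\<phi>' n = restrict (\<phi> n) (K s n)" for n
    have "chom R (subcx (P s) (K s)) W \<phi>'"
      by (rule chom_cong[OF phi subcx_objects[OF P[OF s] K[OF s]]]) (simp add: \<phi>'_def)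
    moreover have "\<phi>' n \<in> K s n \<rightarrow>\<^sub>E elts W n" for n
      using chomD(3)[OF phi, of _ n] by (auto simp: \<phi>'_def)
    ultimately have a: "(s, \<phi>') \<in> Field |I|" using s by (simp add: Field_card_of I_def)
    obtain \<psi> where psi: "chom R (P s) (Z (s, \<phi>')) \<psi>" "\<forall>n. \<forall>k\<in>K s n. \<psi> n k = \<phi>' n k" using Q[OF a] by auto
    have "chom R (P s) ?U \<psi>" by (rule chom_into_csub[OF psi(1) Union_tower(2)[OF tw a]])
    then show ?thesis using psi(2) by (auto simp: \<phi>'_def)
  qed
  then show ?thesis using tower_left_lifting[OF tw] Union_tower(1)[OF tw] by blast
qed

text \<open>A map from a kernel to the union already factors through a stage, because the kernel is
  too small to be cofinal in the tower. A later step extends that map, so the union satisfies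
  \<open>extends\<close> for every presentation and hence lies in \<open>T\<close>.\<close>

lemma small_object_argument:
  assumes small: "small TYPE('u) \<S>" and \<S>: "\<S> \<subseteq> ch_objects R" and X: "X \<in> ch_objects R"
    and T: "T = {Y \<in> ch_objects R. \<forall>s\<in>\<S>. splits s Y}"
  shows "\<exists>U\<in>T. left_lifting T X U"
proof -
  have "\<exists>P p. P \<in> ch_objects R \<and> chom R P s p \<and> (\<forall>n. p n ` elts P n = elts s n) \<and>
    projective P" if "s \<in> \<S>" for s
    using projective_presentation[of s] \<S> that by (metis subsetD)
  then obtain P p where P: "\<And>s. s \<in> \<S> \<Longrightarrow> P s \<in> ch_objects R" and p: "\<And>s. s \<in> \<S> \<Longrightarrow> chom R (P s) s (p s)"
    and surj: "\<And>s n. s \<in> \<S> \<Longrightarrow> p s n ` elts (P s) n = elts s n"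
    and proj: "\<And>s. s \<in> \<S> \<Longrightarrow> projective (P s)" by metis
  define K where "K s = cx_kernel (P s) s (p s)" for s
  have SO: "s \<in> ch_objects R" if "s \<in> \<S>" for s using \<S> that by blast
  have K: "gsub R (P s) (K s)" if "s \<in> \<S>" for s
    unfolding K_def by (rule cx_kernel_gsub[OF p[OF that] P[OF that] SO[OF that]])
  have lpK: "left_lifting T (subcx (P s) (K s)) (P s)" if s: "s \<in> \<S>" for s
    unfolding K_def
  proof (rule presentation_left_lifting[OF _ SO[OF s] P[OF s] p[OF s] proj[OF s]])
    fix Y assume "Y \<in> T"
    then have "splits s Y" "Y \<in> ch_objects R" unfolding T using s by blast+
    then show "extends (P s) s (p s) Y"
      by (rule splits_imp_extends[OF _ _ SO[OF s] P[OF s] p[OF s] surj[OF s]])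
  qed
  let ?Q = "\<lambda>W W'. \<forall>s\<in>\<S>. \<forall>\<phi>. chom R (subcx (P s) (K s)) W \<phi> \<longrightarrow>
      (\<exists>\<psi>. chom R (P s) W' \<psi> \<and> (\<forall>n. \<forall>k\<in>K s n. \<psi> n k = \<phi> n k))"
  define KK where "KK s = (\<Union>n\<in>UNIV. Pair n ` K s n)" for s
  \<comment> \<open>\<open>B\<close> bounds every kernel with all its degrees taken together. The
    summand of natural numbers makes it infinite, so that its successor cardinal is regular.\<close>
  define B where "B = (\<Union>s\<in>\<S>. KK s) <+> (UNIV :: nat set)"
  have smK: "small TYPE('u) (K s n)" if "s \<in> \<S>" for s n
  proof (rule small_subset[OF mod_objectsD(2)[OF ch_objectsD(2)[OF P[OF that]]]])
    show "K s n \<subseteq> elts (P s) n" using gsubD(3)[OF K[OF that]] by blast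
  qed
  have "small TYPE('u) (\<Union>s\<in>\<S>. KK s)"
    unfolding KK_def by (intro small_UN[OF small] small_UN[OF small_int] small_image smK)
  then have smB: "small TYPE('u) B"
    unfolding B_def Plus_def by (intro small_Un small_image small_nat)
  have infB: "infinite B" unfolding B_def by (simp add: finite_Plus_iff)
  let ?r = "cardSuc |B|"
  have r: "Card_order ?r" by (rule cardSuc_Card_order[OF card_of_Card_order])
  have wo: "Well_order ?r" by (rule cardSuc_Well_order[OF card_of_Card_order])
  \<comment> \<open>The successor cardinal is at most the cardinality of the power set, which is
    small; so the tower is indexed by a small set.\<close>
  have "?r \<le>o |Pow B|"
    by (rule cardSuc_least[OF card_of_Card_order card_of_Card_order card_of_Pow])
  then have "|Field ?r| \<le>o |Pow B|"
    using card_of_Field_ordIso[OF r] ordIso_ordLeq_trans by blast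
  then have smr: "small TYPE('u) (Field ?r)"
    using small_Pow[OF smB] unfolding small_def by (rule ordLeq_ordLess_trans)
  have "\<exists>D Z. tower T ?r X D Z \<and> (\<forall>a\<in>Field ?r. ?Q (D a) (Z a))"
    by (rule tower_exists[OF wo smr X]) (rule solve_extension_problems[OF small P K lpK])
  then obtain D Z where tw: "tower T ?r X D Z" and Q: "\<And>a. a \<in> Field ?r \<Longrightarrow> ?Q (D a) (Z a)" by blast
  let ?U = "Union_cx (insert X (Z ` Field ?r))"
  note U = Union_tower[OF tw]
  have "splits s ?U" if s: "s \<in> \<S>" for s
  proof (rule extends_imp_splits[OF _ U(1) SO[OF s] P[OF s] p[OF s] surj[OF s] proj[OF s]])
    show "extends (P s) s (p s) ?U"
      unfolding extends_def K_def[symmetric]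
    proof (intro allI impI)
      fix \<phi> assume phi: "chom R (subcx (P s) (K s)) ?U \<phi>"
      \<comment> \<open>Degrees are recorded along with the elements, so that one stage is found for
        all degrees of the kernel at once.\<close>
      define As where "As i = {(n, x). x \<in> elts (Z i) n}" for i
      define Im where "Im = (\<lambda>(n, k). (n, \<phi> n k)) ` KK s"
      have "|Im| \<le>o |KK s|" unfolding Im_def by (rule card_of_image)
      also have "|KK s| \<le>o |\<Union>s\<in>\<S>. KK s|" using s by (intro card_of_mono1) blast
      also have "|\<Union>s\<in>\<S>. KK s| \<le>o |B|" unfolding B_def by (rule card_of_Plus1)
      finally have cardIm: "|Im| \<le>o |B|" .
      have chain: "relChain ?r As"
        unfolding relChain_def
      proof (intro allI impI)
        fix i j assume ij: "(i, j) \<in> ?r"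
        show "As i \<subseteq> As j"
        proof (cases "i = j")
          case False
          then have "(i, j) \<in> ?r - Id" "j \<in> Field ?r" using ij by (auto simp: Field_def)
          then have "csub R (Z i) (Z j)"
            using csub_trans towerD(6,7)[OF tw] by blast
          then show ?thesis unfolding As_def by (auto dest: csubD(3))
        qed simp
      qed
      have "Field ?r \<noteq> {}" by (rule Field_cardSuc_not_empty[OF card_of_Card_order])
      then obtain a0 where a0: "a0 \<in> Field ?r" by blast
      have "Im \<subseteq> (\<Union>i\<in>Field ?r. As i)"
      proof
        fix t assume "t \<in> Im"
        then obtain n k where t: "t = (n, \<phi> n k)" "k \<in> K s n" unfolding Im_def KK_def by auto
        then have "\<phi> n k \<in> elts ?U n" using chomD(3)[OF phi, of k n] by simp
        then have "\<exists>i\<in>Field ?r. \<phi> n k \<in> elts (Z i) n"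
          unfolding carrier_Union_cx using csubD(3)[OF towerD(8)[OF tw a0]] a0 by blast
        then show "t \<in> (\<Union>i\<in>Field ?r. As i)" unfolding As_def t(1) by blast
      qed
      then obtain i where i: "i \<in> Field ?r" "Im \<subseteq> As i"
        using cardSuc_UNION[OF card_of_Card_order _ chain _ cardIm] infB by (auto simp: Field_card_of)
      have "infinite (Field ?r)" using infB cardSuc_finite[OF card_of_Card_order, of B] by (simp add: Field_card_of)
      \<comment> \<open>The step at \<open>j\<close> starts from \<open>D j\<close>, which contains
        the stages strictly below \<open>j\<close>; hence an index beyond \<open>i\<close> is
        needed, and an infinite cardinal has no last element.\<close>
      then obtain j where j: "j \<in> Field ?r" "i \<noteq> j" "(i, j) \<in> ?r"
        using infinite_Card_order_limit[OF r _ i(1)] by blast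
      then have Zi: "csub R (Z i) (D j)" using towerD(6)[OF tw j(1)] by blast
      have "chom R (subcx (P s) (K s)) (D j) \<phi>"
      proof (rule chom_corestrict[OF phi U(3)[OF j(1)] towerD(2)[OF tw j(1)]])
        fix n k assume "k \<in> elts (subcx (P s) (K s)) n"
        then have "(n, \<phi> n k) \<in> Im" unfolding Im_def KK_def by force
        then have "\<phi> n k \<in> elts (Z i) n" using i(2) unfolding As_def by blast
        then show "\<phi> n k \<in> elts (D j) n" by (rule csubD(3)[OF Zi])
      qed
      then obtain \<psi> where "chom R (P s) (Z j) \<psi>" "\<forall>n. \<forall>k\<in>K s n. \<psi> n k = \<phi> n k"
        using Q[OF j(1)] s by blast
      then show "\<exists>\<psi>. chom R (P s) ?U \<psi> \<and> (\<forall>n. \<forall>k\<in>K s n. \<psi> n k = \<phi> n k)"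
        using chom_into_csub[OF _ U(2)[OF j(1)]] by blast
    qed
  qed
  then have "?U \<in> T" unfolding T using U(1) by blast
  then show ?thesis using tower_left_lifting[OF tw] by blast
qed

text \<open>The second sequence is obtained from the first one by Salce's lemma: a presentation of \<open>X\<close> by a
  projective \<open>P\<close> is pushed out along an embedding of its kernel into an object of \<open>T\<close>.\<close>

lemma complete_pair_Ch:
  assumes small: "small TYPE('u) \<S>" and \<S>: "\<S> \<subseteq> ch_objects R"
  shows "complete_pair (Ch R) (left_perp (Ch R) (right_perp (Ch R) \<S>)) (right_perp (Ch R) \<S>)"
proof -
  define T where "T = right_perp (Ch R) \<S>"
  have T: "T = {Y \<in> ch_objects R. \<forall>s\<in>\<S>. splits s Y}" unfolding T_def by (rule right_perp_Ch[OF \<S>])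
  then have TO: "T \<subseteq> ch_objects R" by blast
  have "(\<exists>B\<in>T. \<exists>A\<in>left_perp (Ch R) T. \<exists>f g. ch_ses R B f A g X) \<and>
      (\<exists>B\<in>T. \<exists>A\<in>left_perp (Ch R) T. \<exists>f g. ch_ses R X f B g A)" if X: "X \<in> ch_objects R" for X
  proof
    obtain U where U: "U \<in> T" "left_lifting T X U" using small_object_argument[OF small \<S> X T] by blast
    then show "\<exists>B\<in>T. \<exists>A\<in>left_perp (Ch R) T. \<exists>f g. ch_ses R X f B g A"
      using left_lifting_cokernel[OF U(2) X _ TO] TO by blast
    obtain P p where P: "P \<in> ch_objects R" and p: "chom R P X p"
      and surj: "\<And>n. p n ` elts P n = elts X n" and proj: "projective P"
      using projective_presentation[OF X] by blast
    let ?K = "subcx P (cx_kernel P X p)"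
    have K: "gsub R P (cx_kernel P X p)" by (rule cx_kernel_gsub[OF p P X])
    have KO: "?K \<in> ch_objects R" by (rule subcx_objects[OF P K])
    obtain V where V: "V \<in> T" "left_lifting T ?K V" using small_object_argument[OF small \<S> KO T] by blast
    have VO: "V \<in> ch_objects R" using V(1) TO by blast
    have KV: "csub R ?K V" by (rule left_liftingD(1)[OF V(2)])
    let ?N = "\<lambda>n. elts ?K n"
    have N: "gsub R V ?N" by (rule gsub_csub[OF KV KO])
    \<comment> \<open>The restriction of \<open>V\<close> to the carriers of the kernel need not be
      the same record as the kernel, but each is a subcomplex of the other.\<close>
    have NK: "csub R (subcx V ?N) ?K" and KN: "csub R ?K (subcx V ?N)"
      unfolding csub_def msub_def using csubD(2,4,5,6)[OF KV] by simp_all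
    have phi: "chom R (subcx V ?N) P (\<lambda>n x. x)"
      by (rule chom_csub[OF csub_trans[OF NK csub_subcx[OF K]]])
    \<comment> \<open>The kernel sits in both \<open>P\<close> and \<open>V\<close>. Here
      \<open>P\<close> is the part that \<open>Q\<close> contains literally, and \<open>V\<close> is
      attached along the kernel.\<close>
    obtain Q \<psi> where po: "cpushout P V ?N (\<lambda>n x. x) Q \<psi>"
      using cpushout_exists[OF P VO N phi] .
    note poD = cpushoutD[OF po]
    have "left_lifting T (subcx V ?N) V"
    proof (rule left_liftingI)
      show "csub R (subcx V ?N) V" by (rule csub_subcx[OF N])
      fix Y f E g F u v
      assume Y: "Y \<in> T" "ch_ses R Y f E g F" "chom R (subcx V ?N) E u" and v: "chom R V F v"
        and uv: "\<And>n x. x \<in> elts (subcx V ?N) n \<Longrightarrow> g n (u n x) = v n x"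
      have "g n (u n x) = v n x" if "x \<in> elts ?K n" for n x
        using uv[of x n] that by simp
      from left_liftingD(2)[OF V(2) Y(1,2) chom_from_csub[OF Y(3) KN] v this]
      show "\<exists>h. chom R V E h \<and> (\<forall>n. \<forall>x\<in>elts (subcx V ?N) n. h n x = u n x) \<and>
         (\<forall>n. \<forall>x\<in>elts V n. g n (h n x) = v n x)" by simp
    qed
    then have "left_lifting T P Q" by (rule pushout_left_lifting[OF _ po phi])
    \<comment> \<open>\<open>P\<close> is projective and its inclusion in \<open>Q\<close> has the
      lifting property, so \<open>Q\<close> itself lifts against \<open>T\<close>.\<close>
    then have QT: "Q \<in> left_perp (Ch R) T"
      using lifts_against_left_perp[OF lifts_against_extend[OF projective_lifts_against[OF proj]] poD(3) TO] by blast
    have "\<zero>\<^bsub>chmod X n\<^esub> = p n x" if "x \<in> ?N n" for n x using that by (simp add: cx_kernel_def)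
    from cpushout_universal[OF po X p chom_const_zero[OF X] this]
    obtain g where g: "chom R Q X g" "\<And>n w. w \<in> elts P n \<Longrightarrow> g n w = p n w"
      "\<And>n x. x \<in> elts V n \<Longrightarrow> g n (\<psi> n x) = \<zero>\<^bsub>chmod X n\<^esub>" by metis
    have "ch_ses R V (\<lambda>n. restrict (\<psi> n) (elts V n)) Q (\<lambda>n. restrict (g n) (elts Q n)) X"
    proof (rule ch_sesI[OF VO poD(3) X poD(6) g(1)])
      fix n
      interpret V: left_module R "chmod V n" using VO by (rule ch_objectsD)
      interpret Q: left_module R "chmod Q n" using poD(3) by (rule ch_objectsD)
      interpret X: left_module R "chmod X n" using X by (rule ch_objectsD)
      interpret P: left_module R "chmod P n" using P by (rule ch_objectsD)
      \<comment> \<open>If \<psi> x is zero it lies in \<open>P\<close>, so \<open>x\<close> belongs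
        to the kernel of \<open>p\<close>, on which \<psi> is the inclusion.\<close>
      have psi_ker: "x = \<zero>\<^bsub>chmod V n\<^esub>" if x: "x \<in> elts V n" "\<psi> n x = \<zero>\<^bsub>chmod Q n\<^esub>" for x
      proof -
        have "\<psi> n x \<in> elts P n" using x(2) csubD(4)[OF poD(5), of n] P.M.zero_closed by simp
        then have xN: "x \<in> ?N n" by (rule poD(9)[OF x(1)])
        then have "x = \<zero>\<^bsub>chmod Q n\<^esub>" using poD(8)[OF xN] x(2) by simp
        then show ?thesis using csubD(4)[OF poD(5), of n] csubD(4)[OF KV, of n] by simp
      qed
      show "inj_on (\<psi> n) (elts V n)"
      proof (rule inj_onI)
        fix x y assume xy: "x \<in> elts V n" "y \<in> elts V n" "\<psi> n x = \<psi> n y"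
        then have "\<psi> n (x \<ominus>\<^bsub>chmod V n\<^esub> y) = \<zero>\<^bsub>chmod Q n\<^esub>"
          using mhom_minus[OF chomD(1)[OF poD(6)] V.left_module_axioms Q.left_module_axioms xy(1,2)]
            left_module_diff_eq_zero[OF Q.left_module_axioms] chomD(3)[OF poD(6)] by simp
        then have "x \<ominus>\<^bsub>chmod V n\<^esub> y = \<zero>\<^bsub>chmod V n\<^esub>" using psi_ker xy(1,2) by simp
        then show "x = y" using left_module_diff_eq_zero[OF V.left_module_axioms xy(1,2)] by blast
      qed
      show "\<psi> n ` elts V n = {x \<in> elts Q n. g n x = \<zero>\<^bsub>chmod X n\<^esub>}"
      proof (intro equalityI subsetI)
        fix z assume "z \<in> {x \<in> elts Q n. g n x = \<zero>\<^bsub>chmod X n\<^esub>}"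
        then have z: "z \<in> elts Q n" "g n z = \<zero>\<^bsub>chmod X n\<^esub>" by auto
        obtain w x where wx: "w \<in> elts P n" "x \<in> elts V n" "z = w \<oplus>\<^bsub>chmod Q n\<^esub> \<psi> n x"
          using cpushout_form[OF po z(1)] .
        have wQ: "w \<in> elts Q n" and xQ: "\<psi> n x \<in> elts Q n"
          using csubD(3)[OF poD(5) wx(1)] chomD(3)[OF poD(6) wx(2)] .
        have "p n w = \<zero>\<^bsub>chmod X n\<^esub>"
          using mhomD(2)[OF chomD(1)[OF g(1)] wQ xQ] g(2)[OF wx(1)] g(3)[OF wx(2)] z(2) wx(3)
            chomD(3)[OF p wx(1)] by simp
        then have wN: "w \<in> ?N n" using wx(1) by (simp add: cx_kernel_def)
        then have wV: "w \<in> elts V n" by (rule csubD(3)[OF KV])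
        have "z = \<psi> n (w \<oplus>\<^bsub>chmod V n\<^esub> x)"
          using mhomD(2)[OF chomD(1)[OF poD(6)] wV wx(2)] poD(8)[OF wN] wx(3) by simp
        then show "z \<in> \<psi> n ` elts V n" using wV wx(2) by blast
      qed (use chomD(3)[OF poD(6)] g(3) in auto)
      show "g n ` elts Q n = elts X n"
      proof
        show "g n ` elts Q n \<subseteq> elts X n" using chomD(3)[OF g(1)] by blast
        show "elts X n \<subseteq> g n ` elts Q n"
          unfolding surj[symmetric] using g(2) csubD(3)[OF poD(5)] by (metis image_eqI image_subsetI)
      qed
    qed
    then show "\<exists>B\<in>T. \<exists>A\<in>left_perp (Ch R) T. \<exists>f g. ch_ses R B f A g X" using V(1) QT by blast
  qed
  moreover have "Obj (Ch R) = ch_objects R" "SES (Ch R) = ch_ses R" by (simp_all add: Ch_def)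
  ultimately show ?thesis unfolding complete_pair_def T_def by simp
qed

end

section \<open>Spheres and disks\<close>

lemma zero_submodule_simps [simp]:
  "carrier (zero_submodule M) = {\<zero>\<^bsub>M\<^esub>}" "\<zero>\<^bsub>zero_submodule M\<^esub> = \<zero>\<^bsub>M\<^esub>"
  by (simp_all add: zero_submodule_def)

lemma sphere_simps:
  "chmod (sphere n M) k = (if k = n then M else zero_submodule M)"
  "\<zero>\<^bsub>chmod (sphere n M) k\<^esub> = \<zero>\<^bsub>M\<^esub>"
  "x \<in> elts (sphere n M) k \<Longrightarrow> diff (sphere n M) k x = \<zero>\<^bsub>M\<^esub>"
  by (simp_all add: sphere_def Let_def)

lemma disk_simps:
  "chmod (disk n M) k = (if k = n \<or> k = n - 1 then M else zero_submodule M)"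
  "\<zero>\<^bsub>chmod (disk n M) k\<^esub> = \<zero>\<^bsub>M\<^esub>"
  "x \<in> elts (disk n M) k \<Longrightarrow> diff (disk n M) k x = (if k = n then x else \<zero>\<^bsub>M\<^esub>)"
  by (simp_all add: disk_def Let_def)

text \<open>This covers maps out of spheres, disks and their subcomplexes.\<close>

lemma chom_two_degrees:
  assumes X: "X \<in> ch_objects R" and u: "mhom R (chmod C n) (chmod X n) u"
    and w: "mhom R (chmod C (n - 1)) (chmod X (n - 1)) w"
    and ud: "\<And>x. x \<in> elts C (n + 1) \<Longrightarrow> u (diff C (n + 1) x) = \<zero>\<^bsub>chmod X n\<^esub>"
    and wd: "\<And>x. x \<in> elts C n \<Longrightarrow> w (diff C n x) = diff X n (u x)"
    and dw: "\<And>x. x \<in> elts C (n - 1) \<Longrightarrow> diff X (n - 1) (w x) = \<zero>\<^bsub>chmod X (n - 2)\<^esub>"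
  shows "chom R C X (\<lambda>k x. if k = n then u x else if k = n - 1 then w x else \<zero>\<^bsub>chmod X k\<^esub>)"
proof (rule chomI)
  have d0: "diff X k \<zero>\<^bsub>chmod X k\<^esub> = \<zero>\<^bsub>chmod X (k - 1)\<^esub>" for k
    by (rule mhom_zero[OF ch_objectsD(3)[OF X] ch_objectsD(1)[OF X] ch_objectsD(1)[OF X]])
  fix k
  show "mhom R (chmod C k) (chmod X k) (\<lambda>x. if k = n then u x else if k = n - 1 then w x else \<zero>\<^bsub>chmod X k\<^esub>)"
    by (cases "k = n"; cases "k = n - 1")
      (use u w in \<open>simp_all add: mhom_const_zero[OF ch_objectsD(1)[OF X]]\<close>)
  fix x assume x: "x \<in> elts C k"
  consider "k = n + 1" | "k = n" | "k = n - 1" | "k \<noteq> n + 1" "k \<noteq> n" "k \<noteq> n - 1" by blast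
  then show "(if k - 1 = n then u (diff C k x) else if k - 1 = n - 1 then w (diff C k x) else \<zero>\<^bsub>chmod X (k - 1)\<^esub>) =
      diff X k (if k = n then u x else if k = n - 1 then w x else \<zero>\<^bsub>chmod X k\<^esub>)"
  proof cases
    case 1
    then show ?thesis using ud x d0[of "n + 1"] by simp
  next
    case 2
    then show ?thesis using wd x by simp
  next
    case 3
    then show ?thesis using dw x by simp
  next
    case 4
    then show ?thesis using d0[of k] by auto
  qed
qed

context module_universe
begin

lemma zero_smod: "left_module R M \<Longrightarrow> smod R M {\<zero>\<^bsub>M\<^esub>}"
proof -
  assume "left_module R M"
  then interpret M: left_module R M .
  show ?thesis unfolding smod_def by (simp add: M.smult_zero)
qed

lemma zero_submodule_objects: "M \<in> mod_objects R \<Longrightarrow> zero_submodule M \<in> mod_objects R"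
  unfolding zero_submodule_def by (intro mod_objects_restrict zero_smod mod_objectsD(1))

lemma regular_module_objects: "regular_module R \<in> mod_objects R"
proof -
  have "left_module R (regular_module R)"
    by (rule left_moduleI) (auto simp: regular_module_def a_ac l_distr r_distr m_assoc ring_axioms
        intro!: bexI[of _ "\<ominus> _"] l_neg)
  then show ?thesis unfolding mod_objects_def using small_ring by (simp add: regular_module_def)
qed

lemma sphere_objects: assumes "M \<in> mod_objects R" shows "sphere n M \<in> ch_objects R"
proof (rule ch_objectsI)
  interpret M: left_module R M using assms by (rule mod_objectsD)
  have m: "chmod (sphere n M) k \<in> mod_objects R" for k
    using assms zero_submodule_objects by (simp add: sphere_simps)
  fix k
  show "chmod (sphere n M) k \<in> mod_objects R" by (rule m)
  show "diff (sphere n M) k \<in> extensional (elts (sphere n M) k)"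
    by (simp add: sphere_def Let_def)
  have "mhom R (chmod (sphere n M) k) (chmod (sphere n M) (k - 1)) (\<lambda>x. \<zero>\<^bsub>chmod (sphere n M) (k - 1)\<^esub>)"
    by (rule mhom_const_zero[OF mod_objectsD(1)[OF m]])
  then show "mhom R (chmod (sphere n M) k) (chmod (sphere n M) (k - 1)) (diff (sphere n M) k)"
    by (rule mhom_cong[OF _ mod_objectsD(1)[OF m]]) (simp add: sphere_simps(2,3))
  show "diff (sphere n M) (k - 1) (diff (sphere n M) k x) = \<zero>\<^bsub>chmod (sphere n M) (k - 2)\<^esub>"
    if "x \<in> elts (sphere n M) k" for x
    using that by (subst sphere_simps(3)) (auto simp: sphere_simps)
qed

lemma disk_objects: assumes "M \<in> mod_objects R" shows "disk n M \<in> ch_objects R"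
proof (rule ch_objectsI)
  interpret M: left_module R M using assms by (rule mod_objectsD)
  have m: "chmod (disk n M) k \<in> mod_objects R" for k
    using assms zero_submodule_objects by (simp add: disk_simps)
  fix k
  show "chmod (disk n M) k \<in> mod_objects R" by (rule m)
  show "diff (disk n M) k \<in> extensional (elts (disk n M) k)"
    by (simp add: disk_def Let_def)
  show "mhom R (chmod (disk n M) k) (chmod (disk n M) (k - 1)) (diff (disk n M) k)"
  proof (cases "k = n")
    case True
    have "mhom R M M (\<lambda>x. x)" by (rule mhom_ident)
    then have "mhom R (chmod (disk n M) k) (chmod (disk n M) (k - 1)) (\<lambda>x. x)"
      using True by (simp add: disk_simps(1))
    then show ?thesis
      by (rule mhom_cong[OF _ mod_objectsD(1)[OF m]]) (simp add: disk_simps(3) True)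
  next
    case False
    have "mhom R (chmod (disk n M) k) (chmod (disk n M) (k - 1)) (\<lambda>x. \<zero>\<^bsub>chmod (disk n M) (k - 1)\<^esub>)"
      by (rule mhom_const_zero[OF mod_objectsD(1)[OF m]])
    then show ?thesis
      by (rule mhom_cong[OF _ mod_objectsD(1)[OF m]]) (simp add: disk_simps(2,3) False)
  qed
  show "diff (disk n M) (k - 1) (diff (disk n M) k x) = \<zero>\<^bsub>chmod (disk n M) (k - 2)\<^esub>"
    if "x \<in> elts (disk n M) k" for x
    using that by (auto simp: disk_simps)
qed

lemma cycles_eq: "cycles C n = (chmod C n)\<lparr>carrier := {x \<in> elts C n. diff C n x = \<zero>\<^bsub>chmod C (n - 1)\<^esub>}\<rparr>"
  unfolding cycles_def a_kernel_eq ..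

lemma carrier_cycles: "carrier (cycles C n) = {x \<in> elts C n. diff C n x = \<zero>\<^bsub>chmod C (n - 1)\<^esub>}"
  by (simp add: cycles_eq)

lemma cycles_objects: assumes "C \<in> ch_objects R" shows "cycles C n \<in> mod_objects R"
  unfolding cycles_eq
  by (rule mod_objects_restrict[OF ch_objectsD(2)[OF assms]
        kernel_smod[OF ch_objectsD(3)[OF assms] ch_objectsD(1)[OF assms] ch_objectsD(1)[OF assms]]])

text \<open>Passes from homology, whose elements are cosets, to elements: a coset is the trivial one
  exactly when its representative is a boundary.\<close>

lemma exact_complex_iff:
  assumes C: "C \<in> ch_objects R"
  shows "exact_complex C \<longleftrightarrow> (\<forall>n. \<forall>x\<in>elts C n. diff C n x = \<zero>\<^bsub>chmod C (n - 1)\<^esub> \<longrightarrow>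
    (\<exists>y\<in>elts C (n + 1). diff C (n + 1) y = x))"
proof -
  have "carrier (homology C n) = {\<one>\<^bsub>homology C n\<^esub>} \<longleftrightarrow> carrier (cycles C n) \<subseteq> boundaries C n" for n
  proof -
    let ?B = "boundaries C n"
    interpret Z: left_module R "cycles C n" by (rule mod_objectsD(1)[OF cycles_objects[OF C]])
    interpret C1: left_module R "chmod C (n + 1)" by (rule ch_objectsD(1)[OF C])
    have d: "mhom R (chmod C (n + 1)) (cycles C n) (diff C (n + 1))"
      unfolding cycles_eq
      using mhom_into_restrict[OF ch_objectsD(3)[OF C, of "n + 1"]] ch_objectsD(4)[OF C, of _ "n + 1"]
        diff_closed[OF C, of _ "n + 1"] by simp
    have BZ: "?B \<subseteq> carrier (cycles C n)" unfolding boundaries_def using mhomD(1)[OF d] by blast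
    have B0: "\<zero>\<^bsub>cycles C n\<^esub> \<in> ?B"
      unfolding boundaries_def
      using mhom_zero[OF d C1.left_module_axioms Z.left_module_axioms] C1.M.zero_closed by (metis image_eqI)
    have Badd: "x \<oplus>\<^bsub>cycles C n\<^esub> y \<in> ?B" if xy: "x \<in> ?B" "y \<in> ?B" for x y
    proof -
      obtain a b where ab: "a \<in> elts C (n + 1)" "b \<in> elts C (n + 1)"
        "x = diff C (n + 1) a" "y = diff C (n + 1) b" using xy unfolding boundaries_def by blast
      have "x \<oplus>\<^bsub>cycles C n\<^esub> y = diff C (n + 1) (a \<oplus>\<^bsub>chmod C (n + 1)\<^esub> b)"
        using mhomD(2)[OF d ab(1,2)] ab(3,4) by simp
      then show ?thesis unfolding boundaries_def using C1.M.a_closed[OF ab(1,2)] by blast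
    qed
    have Bminus: "\<ominus>\<^bsub>cycles C n\<^esub> x \<in> ?B" if x: "x \<in> ?B" for x
    proof -
      obtain a where a: "a \<in> elts C (n + 1)" "x = diff C (n + 1) a"
        using x unfolding boundaries_def by blast
      have "\<ominus>\<^bsub>cycles C n\<^esub> x = diff C (n + 1) (\<ominus>\<^bsub>chmod C (n + 1)\<^esub> a)"
        using mhom_a_inv[OF d C1.left_module_axioms Z.left_module_axioms a(1)] a(2) by simp
      then show ?thesis unfolding boundaries_def using C1.M.a_inv_closed[OF a(1)] by blast
    qed
    have carr: "carrier (homology C n) = {(\<lambda>b. b \<oplus>\<^bsub>cycles C n\<^esub> x) ` ?B | x. x \<in> carrier (cycles C n)}"
      and one: "\<one>\<^bsub>homology C n\<^esub> = ?B"
      unfolding homology_def A_FactGroup_def' A_RCOSETS_def' a_r_coset_def r_coset_def by auto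
    have coset: "(\<lambda>b. b \<oplus>\<^bsub>cycles C n\<^esub> x) ` ?B = ?B \<longleftrightarrow> x \<in> ?B" if x: "x \<in> carrier (cycles C n)" for x
    proof
      assume "(\<lambda>b. b \<oplus>\<^bsub>cycles C n\<^esub> x) ` ?B = ?B"
      moreover have "x = \<zero>\<^bsub>cycles C n\<^esub> \<oplus>\<^bsub>cycles C n\<^esub> x" using x by simp
      ultimately show "x \<in> ?B" using B0 by blast
    next
      assume xB: "x \<in> ?B"
      show "(\<lambda>b. b \<oplus>\<^bsub>cycles C n\<^esub> x) ` ?B = ?B"
      proof
        show "(\<lambda>b. b \<oplus>\<^bsub>cycles C n\<^esub> x) ` ?B \<subseteq> ?B" using Badd xB by blast
        show "?B \<subseteq> (\<lambda>b. b \<oplus>\<^bsub>cycles C n\<^esub> x) ` ?B"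
        proof
          fix b assume b: "b \<in> ?B"
          then have "b = (b \<oplus>\<^bsub>cycles C n\<^esub> (\<ominus>\<^bsub>cycles C n\<^esub> x)) \<oplus>\<^bsub>cycles C n\<^esub> x"
            using x BZ by (simp add: Z.M.a_assoc Z.M.l_neg subset_iff)
          then show "b \<in> (\<lambda>b. b \<oplus>\<^bsub>cycles C n\<^esub> x) ` ?B" using Badd[OF b Bminus[OF xB]] by blast
        qed
      qed
    qed
    show ?thesis
    proof
      assume H: "carrier (homology C n) = {\<one>\<^bsub>homology C n\<^esub>}"
      show "carrier (cycles C n) \<subseteq> ?B"
      proof
        fix x assume x: "x \<in> carrier (cycles C n)"
        then have "(\<lambda>b. b \<oplus>\<^bsub>cycles C n\<^esub> x) ` ?B \<in> carrier (homology C n)" unfolding carr by blast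
        then show "x \<in> ?B" using coset[OF x] unfolding H one by blast
      qed
    next
      assume sub: "carrier (cycles C n) \<subseteq> ?B"
      have "(\<lambda>b. b \<oplus>\<^bsub>cycles C n\<^esub> x) ` ?B = ?B" if "x \<in> carrier (cycles C n)" for x
        using coset[OF that] sub that by blast
      then show "carrier (homology C n) = {\<one>\<^bsub>homology C n\<^esub>}"
        unfolding carr one using Z.M.zero_closed by (auto intro!: exI[of _ "\<zero>\<^bsub>cycles C n\<^esub>"])
    qed
  qed
  then show ?thesis
    unfolding exact_complex_def carrier_cycles boundaries_def by (auto simp: image_iff subset_iff) metis+
qed

lemma exactD:
  assumes "exact_complex C" "C \<in> ch_objects R" "x \<in> elts C n" "diff C n x = \<zero>\<^bsub>chmod C (n - 1)\<^esub>"
  obtains y where "y \<in> elts C (n + 1)" "diff C (n + 1) y = x"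
  using assms(1)[unfolded exact_complex_iff[OF assms(2)], rule_format, OF assms(3,4)] that by blast

section \<open>The generating set\<close>

text \<open>The boundary of any preimage of \<open>m\<close> comes from a cycle of \<open>Y\<close>
  in degree n - 1. By exactness that cycle is the boundary of some \<open>z\<close>, and subtracting
  the image of \<open>z\<close> from the preimage leaves a cycle over \<open>m\<close>.\<close>

lemma cycle_over_sphere:
  assumes ses: "ch_ses R Y f E g (sphere n M)" and M: "M \<in> mod_objects R" and ex: "exact_complex Y"
    and m: "m \<in> carrier M"
  obtains e where "e \<in> carrier (cycles E n)" "g n e = m"
proof -
  note D = ch_sesD[OF ses]
  interpret E: left_module R "chmod E n" using D(2) by (rule ch_objectsD)
  interpret E1: left_module R "chmod E (n - 1)" using D(2) by (rule ch_objectsD)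
  interpret M: left_module R M using M by (rule mod_objectsD)
  have "m \<in> g n ` elts E n" unfolding D(8) using m by (simp add: sphere_simps(1))
  then obtain e where e: "e \<in> elts E n" "g n e = m" by blast
  have de: "diff E n e \<in> elts E (n - 1)" by (rule diff_closed[OF D(2) e(1)])
  have "g (n - 1) (diff E n e) = \<zero>\<^bsub>chmod (sphere n M) (n - 1)\<^esub>"
    using chomD(2)[OF D(5) e(1)] chomD(3)[OF D(5) e(1)] by (simp add: sphere_simps(2,3))
  then have "diff E n e \<in> f (n - 1) ` elts Y (n - 1)" unfolding D(7) using de by simp
  then obtain y where y: "y \<in> elts Y (n - 1)" "f (n - 1) y = diff E n e" by (metis imageE)
  have dy: "diff Y (n - 1) y \<in> elts Y (n - 1 - 1)" by (rule diff_closed[OF D(1) y(1)])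
  interpret Y2: left_module R "chmod Y (n - 1 - 1)" using D(1) by (rule ch_objectsD)
  have "f (n - 1 - 1) (diff Y (n - 1) y) = \<zero>\<^bsub>chmod E (n - 1 - 1)\<^esub>"
    using chomD(2)[OF D(4) y(1)] y(2) ch_objectsD(4)[OF D(2) e(1)] by simp
  also have "\<dots> = f (n - 1 - 1) \<zero>\<^bsub>chmod Y (n - 1 - 1)\<^esub>"
    by (rule mhom_zero[OF chomD(1)[OF D(4)] ch_objectsD(1)[OF D(1)] ch_objectsD(1)[OF D(2)], symmetric])
  finally have "diff Y (n - 1) y = \<zero>\<^bsub>chmod Y (n - 1 - 1)\<^esub>"
    using inj_onD[OF D(6)] dy Y2.M.zero_closed by blast
  then obtain z where z: "z \<in> elts Y n" "diff Y n z = y"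
    using exactD[OF ex D(1) y(1)] by auto
  have fz: "f n z \<in> elts E n" "g n (f n z) = \<zero>\<^bsub>M\<^esub>"
    using D(7)[of n] z(1) by (auto simp: sphere_simps(2))
  have "diff E n (e \<ominus>\<^bsub>chmod E n\<^esub> f n z) = diff E n e \<ominus>\<^bsub>chmod E (n - 1)\<^esub> diff E n e"
    using mhom_minus[OF ch_objectsD(3)[OF D(2)] E.left_module_axioms E1.left_module_axioms e(1) fz(1)]
      chomD(2)[OF D(4) z(1)] z(2) y(2) by simp
  then have "diff E n (e \<ominus>\<^bsub>chmod E n\<^esub> f n z) = \<zero>\<^bsub>chmod E (n - 1)\<^esub>"
    using left_module_diff_eq_zero[OF E1.left_module_axioms de de] by simp
  moreover have "g n (e \<ominus>\<^bsub>chmod E n\<^esub> f n z) = m"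
    using mhom_minus[OF chomD(1)[OF D(5)] E.left_module_axioms ch_objectsD(1)[OF D(3)] e(1) fz(1)]
      fz(2) e(2) m by (simp add: sphere_simps(1) M.M.minus_eq M.a_inv_zero)
  ultimately show thesis using e(1) fz(1) by (intro that) (simp_all add: carrier_cycles)
qed

text \<open>A chain map from a sphere amounts to a linear map into the cycles in degree n, so only
  that degree has to be split.\<close>

lemma splits_sphereI:
  assumes M: "M \<in> mod_objects R"
    and sec: "\<And>f E g. ch_ses R Y f E g (sphere n M) \<Longrightarrow>
      \<exists>s. mhom R M (chmod E n) s \<and> (\<forall>m\<in>carrier M. diff E n (s m) = \<zero>\<^bsub>chmod E (n - 1)\<^esub> \<and> g n (s m) = m)"
  shows "splits (sphere n M) Y"
  unfolding splits_def
proof (intro allI impI)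
  fix f E g assume ses: "ch_ses R Y f E g (sphere n M)"
  note D = ch_sesD[OF ses]
  have lM: "left_module R M" using M by (rule mod_objectsD)
  obtain s where s: "mhom R M (chmod E n) s"
    "\<And>m. m \<in> carrier M \<Longrightarrow> diff E n (s m) = \<zero>\<^bsub>chmod E (n - 1)\<^esub> \<and> g n (s m) = m"
    using sec[OF ses] by blast
  have s0: "s \<zero>\<^bsub>M\<^esub> = \<zero>\<^bsub>chmod E n\<^esub>" by (rule mhom_zero[OF s(1) lM ch_objectsD(1)[OF D(2)]])
  let ?s = "\<lambda>k x. if k = n then s x else if k = n - 1 then \<zero>\<^bsub>chmod E (n - 1)\<^esub> else \<zero>\<^bsub>chmod E k\<^esub>"
  have "chom R (sphere n M) E ?s"
  proof (rule chom_two_degrees[OF D(2)])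
    show "mhom R (chmod (sphere n M) n) (chmod E n) s" using s(1) by (simp add: sphere_simps)
    show "mhom R (chmod (sphere n M) (n - 1)) (chmod E (n - 1)) (\<lambda>x. \<zero>\<^bsub>chmod E (n - 1)\<^esub>)"
      by (rule mhom_const_zero[OF ch_objectsD(1)[OF D(2)]])
    show "diff E (n - 1) \<zero>\<^bsub>chmod E (n - 1)\<^esub> = \<zero>\<^bsub>chmod E (n - 2)\<^esub>"
      using mhom_zero[OF ch_objectsD(3)[OF D(2)] ch_objectsD(1)[OF D(2)] ch_objectsD(1)[OF D(2)], of "n - 1"] by simp
  qed (use s s0 in \<open>simp_all add: sphere_simps\<close>)
  moreover have "g k (?s k a) = a" if "a \<in> elts (sphere n M) k" for k a
    using that s(2) mhom_zero[OF chomD(1)[OF D(5)] ch_objectsD(1)[OF D(2)] ch_objectsD(1)[OF D(3)], of k]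
    by (auto simp: sphere_simps split: if_splits)
  ultimately show "\<exists>s. chom R (sphere n M) E s \<and>
      (\<forall>k. \<forall>a\<in>elts (sphere n M) k. g k (s k a) = a)" by blast
qed

text \<open>A map out of the regular module is determined by the image of one, and here a cycle over
  one is available.\<close>

lemma splits_sphere_regular:
  assumes "exact_complex Y" shows "splits (sphere n (regular_module R)) Y"
proof (rule splits_sphereI[OF regular_module_objects])
  fix f E g assume ses: "ch_ses R Y f E g (sphere n (regular_module R))"
  note D = ch_sesD[OF ses]
  interpret E: left_module R "chmod E n" using D(2) by (rule ch_objectsD)
  interpret E1: left_module R "chmod E (n - 1)" using D(2) by (rule ch_objectsD)
  have "\<one> \<in> carrier (regular_module R)" by (simp add: regular_module_def)
  then obtain e where e: "e \<in> carrier (cycles E n)" "g n e = \<one>"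
    using cycle_over_sphere[OF ses regular_module_objects assms] by blast
  then have eE: "e \<in> elts E n" "diff E n e = \<zero>\<^bsub>chmod E (n - 1)\<^esub>" by (simp_all add: carrier_cycles)
  have "mhom R (regular_module R) (chmod E n) (\<lambda>r. r \<odot>\<^bsub>chmod E n\<^esub> e)"
    unfolding mhom_def using eE(1)
    by (simp add: regular_module_def E.smult_closed E.smult_l_distr E.smult_assoc)
  moreover have "diff E n (r \<odot>\<^bsub>chmod E n\<^esub> e) = \<zero>\<^bsub>chmod E (n - 1)\<^esub>" "g n (r \<odot>\<^bsub>chmod E n\<^esub> e) = r"
    if "r \<in> carrier (regular_module R)" for r
    using that eE e(2) mhomD(3)[OF ch_objectsD(3)[OF D(2)] _ eE(1), of r] mhomD(3)[OF chomD(1)[OF D(5)] _ eE(1), of r]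
    by (simp_all add: E1.smult_zero regular_module_def sphere_simps(1))
  ultimately show "\<exists>s. mhom R (regular_module R) (chmod E n) s \<and> (\<forall>m\<in>carrier (regular_module R).
      diff E n (s m) = \<zero>\<^bsub>chmod E (n - 1)\<^esub> \<and> g n (s m) = m)" by blast
qed

text \<open>Passing to cycles in degree n keeps the sequence exact, surjectivity being
  \<open>cycle_over_sphere\<close>. A section of the sequence of cycles is then a section from the
  sphere.\<close>

lemma splits_sphere:
  assumes ex: "exact_complex Y" and M: "M \<in> mod_objects R" and sp: "mod_splits M (cycles Y n)"
  shows "splits (sphere n M) Y"
proof (rule splits_sphereI[OF M])
  fix f E g assume ses: "ch_ses R Y f E g (sphere n M)"
  note D = ch_sesD[OF ses]
  interpret Y1: left_module R "chmod Y (n - 1)" using D(1) by (rule ch_objectsD)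
  have f0: "f k \<zero>\<^bsub>chmod Y k\<^esub> = \<zero>\<^bsub>chmod E k\<^esub>" for k
    by (rule mhom_zero[OF chomD(1)[OF D(4)] ch_objectsD(1)[OF D(1)] ch_objectsD(1)[OF D(2)]])
  have f_cyc: "f n y \<in> carrier (cycles E n) \<longleftrightarrow> y \<in> carrier (cycles Y n)" if y: "y \<in> elts Y n" for y
  proof -
    have "diff E n (f n y) = f (n - 1) (diff Y n y)" using chomD(2)[OF D(4) y] by simp
    then have "diff E n (f n y) = \<zero>\<^bsub>chmod E (n - 1)\<^esub> \<longleftrightarrow> diff Y n y = \<zero>\<^bsub>chmod Y (n - 1)\<^esub>"
      using f0[of "n - 1"] inj_on_eq_iff[OF D(6) diff_closed[OF D(1) y] Y1.M.zero_closed] by simp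
    then show ?thesis using y chomD(3)[OF D(4) y] by (simp add: carrier_cycles)
  qed
  have "mod_ses R (cycles Y n) (restrict (f n) (carrier (cycles Y n))) (cycles E n)
      (restrict (g n) (carrier (cycles E n))) M"
  proof (rule mod_sesI[OF cycles_objects[OF D(1)] cycles_objects[OF D(2)] M])
    show "mhom R (cycles Y n) (cycles E n) (f n)"
      using f_cyc unfolding cycles_eq[of E] unfolding cycles_eq[of Y]
      by (intro mhom_into_restrict mhom_from_restrict chomD(1)[OF D(4)]) (auto simp: carrier_cycles)
    show "mhom R (cycles E n) M (g n)"
      unfolding cycles_eq[of E] using chomD(1)[OF D(5), of n]
      by (intro mhom_from_restrict) (auto simp: sphere_simps)
    show "inj_on (f n) (carrier (cycles Y n))"
      by (rule inj_on_subset[OF D(6)]) (auto simp: carrier_cycles)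
    show "f n ` carrier (cycles Y n) = {x \<in> carrier (cycles E n). g n x = \<zero>\<^bsub>M\<^esub>}"
    proof (intro equalityI subsetI)
      fix x assume "x \<in> f n ` carrier (cycles Y n)"
      then obtain y where y: "y \<in> carrier (cycles Y n)" "x = f n y" by blast
      then have "y \<in> elts Y n" by (simp add: carrier_cycles)
      then show "x \<in> {x \<in> carrier (cycles E n). g n x = \<zero>\<^bsub>M\<^esub>}"
        using y f_cyc D(7)[of n] by (auto simp: sphere_simps)
    next
      fix x assume x: "x \<in> {x \<in> carrier (cycles E n). g n x = \<zero>\<^bsub>M\<^esub>}"
      then have "x \<in> f n ` elts Y n"
        unfolding D(7) by (simp add: sphere_simps carrier_cycles)
      then show "x \<in> f n ` carrier (cycles Y n)" using x f_cyc by auto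
    qed
    show "g n ` carrier (cycles E n) = carrier M"
    proof
      show "g n ` carrier (cycles E n) \<subseteq> carrier M"
        using chomD(3)[OF D(5), of _ n] by (auto simp: carrier_cycles sphere_simps)
      show "carrier M \<subseteq> g n ` carrier (cycles E n)"
        using cycle_over_sphere[OF ses M ex] by (metis image_eqI subsetI)
    qed
  qed
  then obtain s where s: "mhom R M (cycles E n) s"
    "\<And>m. m \<in> carrier M \<Longrightarrow> restrict (g n) (carrier (cycles E n)) (s m) = m"
    using sp unfolding mod_splits_def by blast
  have sE: "s m \<in> carrier (cycles E n)" if "m \<in> carrier M" for m using mhomD(1)[OF s(1) that] .
  have "mhom R M (chmod E n) s"
    using s(1) unfolding mhom_def cycles_eq by auto
  then show "\<exists>s. mhom R M (chmod E n) s \<and>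
      (\<forall>m\<in>carrier M. diff E n (s m) = \<zero>\<^bsub>chmod E (n - 1)\<^esub> \<and> g n (s m) = m)"
    using sE s(2) by (auto simp: carrier_cycles intro!: exI[of _ s])
qed

text \<open>A chain map from a disk is determined by its component in degree n, the other one being
  the composite with the differential. Hence a section in degree n suffices.\<close>

lemma splits_disk:
  assumes Y: "Y \<in> ch_objects R" and M: "M \<in> mod_objects R" and sp: "mod_splits M (chmod Y n)"
  shows "splits (disk n M) Y"
  unfolding splits_def
proof (intro allI impI)
  fix f E g assume ses: "ch_ses R Y f E g (disk n M)"
  note D = ch_sesD[OF ses]
  interpret M: left_module R M using M by (rule mod_objectsD)
  interpret E1: left_module R "chmod E (n - 1)" using D(2) by (rule ch_objectsD)
  have "mod_ses R (chmod Y n) (f n) (chmod E n) (g n) M"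
    using ses unfolding ch_ses_def by (metis disk_simps(1))
  then obtain s where s: "mhom R M (chmod E n) s" "\<And>m. m \<in> carrier M \<Longrightarrow> g n (s m) = m"
    using sp unfolding mod_splits_def by blast
  let ?w = "\<lambda>x. diff E n (s x)"
  let ?s = "\<lambda>k x. if k = n then s x else if k = n - 1 then ?w x else \<zero>\<^bsub>chmod E k\<^esub>"
  have s0: "s \<zero>\<^bsub>M\<^esub> = \<zero>\<^bsub>chmod E n\<^esub>" by (rule mhom_zero[OF s(1) M.left_module_axioms ch_objectsD(1)[OF D(2)]])
  have sE: "s x \<in> elts E n" if "x \<in> carrier M" for x using mhomD(1)[OF s(1) that] .
  have "chom R (disk n M) E ?s"
  proof (rule chom_two_degrees[OF D(2)])
    show "mhom R (chmod (disk n M) n) (chmod E n) s" using s(1) by (simp add: disk_simps)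
    show "mhom R (chmod (disk n M) (n - 1)) (chmod E (n - 1)) ?w"
      using mhom_comp[OF s(1) ch_objectsD(3)[OF D(2)]] by (simp add: disk_simps)
  qed (use s0 sE ch_objectsD(4)[OF D(2)] in \<open>simp_all add: disk_simps\<close>)
  moreover have "g k (?s k a) = a" if a: "a \<in> elts (disk n M) k" for k a
  proof -
    consider "k = n" | "k = n - 1" | "k \<noteq> n" "k \<noteq> n - 1" by blast
    then show ?thesis
    proof cases
      case 1
      then show ?thesis using a s(2) by (simp add: disk_simps)
    next
      case 2
      then have aM: "a \<in> carrier M" using a by (simp add: disk_simps)
      then have "g (n - 1) (?w a) = a"
        using chomD(2)[OF D(5) sE[OF aM]] s(2)[OF aM] by (simp add: disk_simps)
      then show ?thesis using 2 by simp
    next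
      case 3
      then show ?thesis
        using a mhom_zero[OF chomD(1)[OF D(5)] ch_objectsD(1)[OF D(2)] ch_objectsD(1)[OF D(3)], of k]
        by (simp add: disk_simps)
    qed
  qed
  ultimately show "\<exists>s. chom R (disk n M) E s \<and>
      (\<forall>k. \<forall>a\<in>elts (disk n M) k. g k (s k a) = a)" by blast
qed

text \<open>The kernel of the projection from D^(n+1)(R) to S^(n+1)(R) is S^n(R). A cycle
  \<open>x\<close> defines a map from this kernel to \<open>X\<close>, and an extension to the disk
  sends one, in degree n + 1, to an element with boundary \<open>x\<close>.\<close>

lemma exact_if_splits_spheres:
  assumes X: "X \<in> ch_objects R" and sp: "\<And>n. splits (sphere n (regular_module R)) X"
  shows "exact_complex X"
  unfolding exact_complex_iff[OF X]
proof (intro allI ballI impI)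
  fix n x assume x: "x \<in> elts X n" "diff X n x = \<zero>\<^bsub>chmod X (n - 1)\<^esub>"
  let ?M = "regular_module R" and ?P = "disk (n + 1) (regular_module R)" and ?S = "sphere (n + 1) (regular_module R)"
  note M = regular_module_objects
  note P = disk_objects[OF M, of "n + 1"] and S = sphere_objects[OF M, of "n + 1"]
  interpret M: left_module R ?M using M by (rule mod_objectsD)
  interpret X: left_module R "chmod X n" using X by (rule ch_objectsD)
  interpret X1: left_module R "chmod X (n - 1)" using X by (rule ch_objectsD)
  let ?p = "\<lambda>k x. if k = n + 1 then x else if k = n + 1 - 1 then \<zero>\<^bsub>chmod ?S (n + 1 - 1)\<^esub> else \<zero>\<^bsub>chmod ?S k\<^esub>"
  have p: "chom R ?P ?S ?p"
  proof (rule chom_two_degrees[OF S])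
    show "mhom R (chmod ?P (n + 1)) (chmod ?S (n + 1)) (\<lambda>x. x)"
      using mhom_ident by (simp add: sphere_simps disk_simps)
    show "mhom R (chmod ?P (n + 1 - 1)) (chmod ?S (n + 1 - 1)) (\<lambda>x. \<zero>\<^bsub>chmod ?S (n + 1 - 1)\<^esub>)"
      by (rule mhom_const_zero[OF ch_objectsD(1)[OF S]])
  qed (simp_all add: sphere_simps disk_simps)
  have surj: "?p k ` elts ?P k = elts ?S k" for k
    by (auto simp: sphere_simps disk_simps image_iff intro!: bexI[of _ "\<zero>\<^bsub>?M\<^esub>"])
  have K: "gsub R ?P (cx_kernel ?P ?S ?p)" by (rule cx_kernel_gsub[OF p P S])
  let ?C = "subcx ?P (cx_kernel ?P ?S ?p)"
  have ker_n: "cx_kernel ?P ?S ?p n = carrier ?M" "cx_kernel ?P ?S ?p (n + 1) = {\<zero>\<^bsub>?M\<^esub>}"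
    "cx_kernel ?P ?S ?p (n - 1) \<subseteq> {\<zero>\<^bsub>?M\<^esub>}"
    by (auto simp: cx_kernel_def sphere_simps disk_simps)
  let ?u = "\<lambda>r. r \<odot>\<^bsub>chmod X n\<^esub> x"
  let ?phi = "\<lambda>k r. if k = n then ?u r else if k = n - 1 then \<zero>\<^bsub>chmod X (n - 1)\<^esub> else \<zero>\<^bsub>chmod X k\<^esub>"
  have R: "carrier ?M = carrier R" "\<zero>\<^bsub>?M\<^esub> = \<zero>" by (simp_all add: regular_module_def)
  have "chom R ?C X ?phi"
  proof (rule chom_two_degrees[OF X])
    show "mhom R (chmod ?C n) (chmod X n) ?u"
      using x(1) unfolding mhom_def
      by (simp add: ker_n R disk_simps X.smult_closed X.smult_l_distr X.smult_assoc, simp add: regular_module_def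
          X.smult_l_distr X.smult_assoc)
    show "mhom R (chmod ?C (n - 1)) (chmod X (n - 1)) (\<lambda>r. \<zero>\<^bsub>chmod X (n - 1)\<^esub>)"
      by (rule mhom_const_zero[OF ch_objectsD(1)[OF X]])
    show "?u (diff ?C (n + 1) r) = \<zero>\<^bsub>chmod X n\<^esub>" if "r \<in> elts ?C (n + 1)" for r
    proof -
      have r: "r \<in> cx_kernel ?P ?S ?p (n + 1)" using that by simp
      then have "diff ?C (n + 1) r = r" using gsubD(3)[OF K r] by (simp add: disk_simps(3))
      then have "diff ?C (n + 1) r = \<zero>" using r ker_n(2) R(2) by simp
      then show ?thesis using X.zero_smult[OF x(1)] by simp
    qed
    show "\<zero>\<^bsub>chmod X (n - 1)\<^esub> = diff X n (?u r)" if "r \<in> elts ?C n" for r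
      using that mhomD(3)[OF ch_objectsD(3)[OF X] _ x(1), of r] x(2) by (simp add: ker_n R X1.smult_zero)
    show "diff X (n - 1) \<zero>\<^bsub>chmod X (n - 1)\<^esub> = \<zero>\<^bsub>chmod X (n - 2)\<^esub>"
      using mhom_zero[OF ch_objectsD(3)[OF X] ch_objectsD(1)[OF X] ch_objectsD(1)[OF X], of "n - 1"] by simp
  qed
  moreover have "extends ?P ?S ?p X" by (rule splits_imp_extends[OF sp X S P p surj])
  ultimately obtain \<psi> where psi: "chom R ?P X \<psi>" "\<And>k r. r \<in> cx_kernel ?P ?S ?p k \<Longrightarrow> \<psi> k r = ?phi k r"
    unfolding extends_def by blast
  have one: "\<one> \<in> elts ?P (n + 1)" by (simp add: disk_simps R)
  have "diff X (n + 1) (\<psi> (n + 1) \<one>) = \<psi> n \<one>"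
    using chomD(2)[OF psi(1) one] one by (simp add: disk_simps)
  also have "\<dots> = x" using psi(2)[of \<one> n] x(1) by (simp add: ker_n R X.smult_one)
  finally show "\<exists>y\<in>elts X (n + 1). diff X (n + 1) y = x"
    using chomD(3)[OF psi(1) one] by blast
qed

text \<open>The map e - f (r e) vanishes on the kernel of \<open>g\<close> and so descends along
  \<open>g\<close> to a section.\<close>

lemma mhom_section:
  assumes ses: "mod_ses R X f E g A" and r: "mhom R E X r" and rf: "\<And>x. x \<in> carrier X \<Longrightarrow> r (f x) = x"
  shows "\<exists>s. mhom R A E s \<and> (\<forall>a\<in>carrier A. g (s a) = a)"
proof -
  note D = mod_sesD[OF ses]
  interpret E: left_module R E by (rule D)
  interpret A: left_module R A by (rule D)
  have t: "mhom R E E (\<lambda>e. e \<ominus>\<^bsub>E\<^esub> f (r e))" by (rule mhom_diff[OF D(2) mhom_ident mhom_comp[OF r D(4)]])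
  have ker: "e \<ominus>\<^bsub>E\<^esub> f (r e) = \<zero>\<^bsub>E\<^esub>" if "e \<in> carrier E" "g e = \<zero>\<^bsub>A\<^esub>" for e
  proof -
    have "e \<in> f ` carrier X" unfolding D(7) using that by simp
    then have "f (r e) = e" using rf by auto
    then show ?thesis using left_module_diff_eq_zero[OF D(2) that(1) that(1)] by simp
  qed
  obtain s where s: "mhom R A E s" "\<And>e. e \<in> carrier E \<Longrightarrow> s (g e) = e \<ominus>\<^bsub>E\<^esub> f (r e)"
    by (rule mhom_factor_epi[OF D(5) t D(2) D(3) D(2) D(8) ker]) (assumption | rule that)+
  have "g (s a) = a" if a: "a \<in> carrier A" for a
  proof -
    obtain e where e: "e \<in> carrier E" "a = g e" using a D(8) by blast
    have fr: "f (r e) \<in> carrier E" "g (f (r e)) = \<zero>\<^bsub>A\<^esub>" using D(7) mhomD(1)[OF r e(1)] by auto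
    then show ?thesis
      using s(2)[OF e(1)] mhom_minus[OF D(5) D(2,3) e(1) fr(1)] e a by (simp add: A.M.minus_eq A.a_inv_zero)
  qed
  then show ?thesis using s(1) by blast
qed

text \<open>The kernel of the map from S^n(M) to S^n(A) is a copy of S^n(Z_n X), on which the
  inclusion of the cycles is a chain map to \<open>X\<close>. Its extension to S^n(M) takes values
  in the cycles because the sphere has zero differential, and so it is a retraction.\<close>

lemma mod_splits_cycles:
  assumes X: "X \<in> ch_objects R" and A: "A \<in> mod_objects R" and sp: "splits (sphere n A) X"
  shows "mod_splits A (cycles X n)"
  unfolding mod_splits_def
proof (intro allI impI)
  fix f M g assume ses: "mod_ses R (cycles X n) f M g A"
  note D = mod_sesD[OF ses]
  have M: "M \<in> mod_objects R" using ses unfolding mod_ses_def by blast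
  let ?P = "sphere n M" and ?S = "sphere n A"
  note P = sphere_objects[OF M, of n] and S = sphere_objects[OF A, of n]
  interpret M: left_module R M by (rule D)
  interpret A: left_module R A by (rule D)
  have g0: "g \<zero>\<^bsub>M\<^esub> = \<zero>\<^bsub>A\<^esub>" by (rule mhom_zero[OF D(5) D(2) D(3)])
  let ?p = "\<lambda>k x. if k = n then g x else if k = n - 1 then \<zero>\<^bsub>chmod ?S (n - 1)\<^esub> else \<zero>\<^bsub>chmod ?S k\<^esub>"
  have p: "chom R ?P ?S ?p"
  proof (rule chom_two_degrees[OF S])
    show "mhom R (chmod ?P n) (chmod ?S n) g" using D(5) by (simp add: sphere_simps)
    show "mhom R (chmod ?P (n - 1)) (chmod ?S (n - 1)) (\<lambda>x. \<zero>\<^bsub>chmod ?S (n - 1)\<^esub>)"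
      by (rule mhom_const_zero[OF ch_objectsD(1)[OF S]])
  qed (use g0 mhomD(1)[OF D(5)] in \<open>simp_all add: sphere_simps\<close>)
  have surj: "?p k ` elts ?P k = elts ?S k" for k
    using D(8) by (auto simp: sphere_simps)
  let ?K = "cx_kernel ?P ?S ?p"
  have K: "gsub R ?P ?K" by (rule cx_kernel_gsub[OF p P S])
  have ker_n: "?K n = {m \<in> carrier M. g m = \<zero>\<^bsub>A\<^esub>}" "k \<noteq> n \<Longrightarrow> ?K k = {\<zero>\<^bsub>M\<^esub>}" for k
    by (auto simp: cx_kernel_def sphere_simps)
  let ?C = "subcx ?P ?K"
  have CM: "left_module R (chmod ?C n)" by (rule ch_objectsD(1)[OF subcx_objects[OF P K]])
  have inc: "mhom R (chmod ?C n) M (\<lambda>x. x)"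
    unfolding mhom_def by (simp add: ker_n sphere_simps)
  have im: "(\<lambda>x. x) ` elts ?C n \<subseteq> f ` carrier (cycles X n)"
    unfolding D(7) by (simp add: ker_n)
  \<comment> \<open>\<open>u\<close> inverts \<open>f\<close> on its image, which is the kernel in
    degree n.\<close>
  obtain u where u: "mhom R (chmod ?C n) (cycles X n) u" "\<And>x. x \<in> elts ?C n \<Longrightarrow> f (u x) = x"
    by (rule mhom_lift_mono[OF D(4) inc CM D(1) D(6) im]) (assumption | rule that)+
  have uC: "u x \<in> carrier (cycles X n)" if "x \<in> ?K n" for x using mhomD(1)[OF u(1)] that by simp
  have u': "mhom R (chmod ?C n) (chmod X n) u" using u(1) unfolding mhom_def cycles_eq by auto
  have u0: "u \<zero>\<^bsub>M\<^esub> = \<zero>\<^bsub>chmod X n\<^esub>"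
    using mhom_zero[OF u' CM ch_objectsD(1)[OF X]] by (simp add: sphere_simps(2))
  let ?phi = "\<lambda>k x. if k = n then u x else if k = n - 1 then \<zero>\<^bsub>chmod X (n - 1)\<^esub> else \<zero>\<^bsub>chmod X k\<^esub>"
  have "chom R ?C X ?phi"
  proof (rule chom_two_degrees[OF X u'])
    show "mhom R (chmod ?C (n - 1)) (chmod X (n - 1)) (\<lambda>x. \<zero>\<^bsub>chmod X (n - 1)\<^esub>)"
      by (rule mhom_const_zero[OF ch_objectsD(1)[OF X]])
    show "u (diff ?C (n + 1) x) = \<zero>\<^bsub>chmod X n\<^esub>" if "x \<in> elts ?C (n + 1)" for x
      using that u0 gsubD(3)[OF K, of x "n + 1"] by (simp add: sphere_simps(3))
    show "\<zero>\<^bsub>chmod X (n - 1)\<^esub> = diff X n (u x)" if "x \<in> elts ?C n" for x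
      using that uC[of x] by (simp add: carrier_cycles)
    show "diff X (n - 1) \<zero>\<^bsub>chmod X (n - 1)\<^esub> = \<zero>\<^bsub>chmod X (n - 2)\<^esub>"
      using mhom_zero[OF ch_objectsD(3)[OF X] ch_objectsD(1)[OF X] ch_objectsD(1)[OF X], of "n - 1"] by simp
  qed
  moreover have "extends ?P ?S ?p X" by (rule splits_imp_extends[OF sp X S P p surj])
  ultimately obtain \<psi> where psi: "chom R ?P X \<psi>" "\<And>k x. x \<in> ?K k \<Longrightarrow> \<psi> k x = ?phi k x"
    unfolding extends_def by blast
  have psiM: "\<psi> n m \<in> carrier (cycles X n)" if m: "m \<in> carrier M" for m
  proof -
    have mP: "m \<in> elts ?P n" using m by (simp add: sphere_simps)
    have "diff X n (\<psi> n m) = \<psi> (n - 1) \<zero>\<^bsub>M\<^esub>" using chomD(2)[OF psi(1) mP] mP by (simp add: sphere_simps(3))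
    also have "\<dots> = \<zero>\<^bsub>chmod X (n - 1)\<^esub>"
      using mhom_zero[OF chomD(1)[OF psi(1)] ch_objectsD(1)[OF P] ch_objectsD(1)[OF X], of "n - 1"]
      by (simp add: sphere_simps(2))
    finally show ?thesis using chomD(3)[OF psi(1) mP] by (simp add: carrier_cycles)
  qed
  have "mhom R M (cycles X n) (\<psi> n)"
    unfolding cycles_eq using chomD(1)[OF psi(1), of n] psiM
    by (intro mhom_into_restrict) (auto simp: sphere_simps carrier_cycles)
  moreover have "\<psi> n (f z) = z" if z: "z \<in> carrier (cycles X n)" for z
  proof -
    have fz: "f z \<in> ?K n" using z D(7) ker_n by blast
    then have "f (u (f z)) = f z" using u(2) by simp
    then have "u (f z) = z" using inj_onD[OF D(6)] uC[OF fz] z by blast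
    then show ?thesis using psi(2)[OF fz] by simp
  qed
  ultimately show "\<exists>s. mhom R A M s \<and> (\<forall>a\<in>carrier A. g (s a) = a)" by (rule mhom_section[OF ses])
qed

text \<open>The kernel of the map from D^n(M) to D^n(A) is a copy of D^n(X_n). The identity of X_n
  in degree n, with the differential in degree n - 1, is a chain map from it to \<open>X\<close>,
  and an extension of this map is a retraction in degree n.\<close>

lemma mod_splits_chmod:
  assumes X: "X \<in> ch_objects R" and A: "A \<in> mod_objects R" and sp: "splits (disk n A) X"
  shows "mod_splits A (chmod X n)"
  unfolding mod_splits_def
proof (intro allI impI)
  fix f M g assume ses: "mod_ses R (chmod X n) f M g A"
  note D = mod_sesD[OF ses]
  have M: "M \<in> mod_objects R" using ses unfolding mod_ses_def by blast
  let ?P = "disk n M" and ?S = "disk n A"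
  note P = disk_objects[OF M, of n] and S = disk_objects[OF A, of n]
  interpret M: left_module R M by (rule D)
  interpret A: left_module R A by (rule D)
  have g0: "g \<zero>\<^bsub>M\<^esub> = \<zero>\<^bsub>A\<^esub>" by (rule mhom_zero[OF D(5) D(2) D(3)])
  let ?p = "\<lambda>k x. if k = n then g x else if k = n - 1 then g x else \<zero>\<^bsub>chmod ?S k\<^esub>"
  have p: "chom R ?P ?S ?p"
  proof (rule chom_two_degrees[OF S])
    show "mhom R (chmod ?P n) (chmod ?S n) g" "mhom R (chmod ?P (n - 1)) (chmod ?S (n - 1)) g"
      using D(5) by (simp_all add: disk_simps)
  qed (use g0 mhomD(1)[OF D(5)] in \<open>simp_all add: disk_simps\<close>)
  have surj: "?p k ` elts ?P k = elts ?S k" for k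
    using D(8) by (auto simp: disk_simps)
  let ?K = "cx_kernel ?P ?S ?p"
  have K: "gsub R ?P ?K" by (rule cx_kernel_gsub[OF p P S])
  have ker_n: "?K n = {m \<in> carrier M. g m = \<zero>\<^bsub>A\<^esub>}" "?K (n - 1) = ?K n"
    by (auto simp: cx_kernel_def disk_simps)
  let ?C = "subcx ?P ?K"
  have CM: "left_module R (chmod ?C n)" by (rule ch_objectsD(1)[OF subcx_objects[OF P K]])
  have C_eq: "chmod ?C (n - 1) = chmod ?C n" by (simp add: chmod_subcx ker_n disk_simps)
  have inc: "mhom R (chmod ?C n) M (\<lambda>x. x)"
    unfolding mhom_def by (simp add: ker_n disk_simps)
  have im: "(\<lambda>x. x) ` elts ?C n \<subseteq> f ` elts X n"
    unfolding D(7) by (simp add: ker_n)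
  obtain u where u: "mhom R (chmod ?C n) (chmod X n) u" "\<And>x. x \<in> elts ?C n \<Longrightarrow> f (u x) = x"
    by (rule mhom_lift_mono[OF D(4) inc CM D(1) D(6) im]) (assumption | rule that)+
  have uC: "u x \<in> elts X n" if "x \<in> ?K n" for x using mhomD(1)[OF u(1)] that by simp
  have u0: "u \<zero>\<^bsub>M\<^esub> = \<zero>\<^bsub>chmod X n\<^esub>"
    using mhom_zero[OF u(1) CM ch_objectsD(1)[OF X]] by (simp add: disk_simps(2))
  let ?w = "\<lambda>x. diff X n (u x)"
  let ?phi = "\<lambda>k x. if k = n then u x else if k = n - 1 then ?w x else \<zero>\<^bsub>chmod X k\<^esub>"
  have "chom R ?C X ?phi"
  proof (rule chom_two_degrees[OF X u(1)])
    show "mhom R (chmod ?C (n - 1)) (chmod X (n - 1)) ?w"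
      unfolding C_eq by (rule mhom_comp[OF u(1) ch_objectsD(3)[OF X]])
    show "u (diff ?C (n + 1) x) = \<zero>\<^bsub>chmod X n\<^esub>" if "x \<in> elts ?C (n + 1)" for x
      using that u0 gsubD(3)[OF K, of x "n + 1"] by (simp add: disk_simps(3))
    show "?w (diff ?C n x) = diff X n (u x)" if "x \<in> elts ?C n" for x
      using that gsubD(3)[OF K, of x n] by (simp add: disk_simps(3))
    show "diff X (n - 1) (?w x) = \<zero>\<^bsub>chmod X (n - 2)\<^esub>" if "x \<in> elts ?C (n - 1)" for x
      using that ch_objectsD(4)[OF X uC[of x]] ker_n(2) by simp
  qed
  moreover have "extends ?P ?S ?p X" by (rule splits_imp_extends[OF sp X S P p surj])
  ultimately obtain \<psi> where psi: "chom R ?P X \<psi>" "\<And>k x. x \<in> ?K k \<Longrightarrow> \<psi> k x = ?phi k x"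
    unfolding extends_def by blast
  have "mhom R M (chmod X n) (\<psi> n)"
    using chomD(1)[OF psi(1), of n] by (simp add: disk_simps)
  moreover have "\<psi> n (f z) = z" if z: "z \<in> elts X n" for z
  proof -
    have fz: "f z \<in> ?K n" using z D(7) ker_n(1) by blast
    then have "f (u (f z)) = f z" using u(2) by simp
    then have "u (f z) = z" using inj_onD[OF D(6)] uC[OF fz] z by blast
    then show ?thesis using psi(2)[OF fz] by simp
  qed
  ultimately show "\<exists>s. mhom R A M s \<and> (\<forall>a\<in>carrier A. g (s a) = a)" by (rule mhom_section[OF ses])
qed

lemma right_perp_generators:
  assumes \<A>: "\<A> \<subseteq> mod_objects R" and \<B>: "\<B> \<subseteq> mod_objects R"
    and \<S>: "\<S> = {sphere n (regular_module R) | n. True} \<union> {sphere n M | n M. M \<in> \<A>} \<union> {disk n M | n M. M \<in> \<B>}"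
  shows "\<S> \<subseteq> ch_objects R"
    "right_perp (Ch R) \<S> = tilde_class R (right_perp (R_Mod R) \<B>) (right_perp (R_Mod R) \<A>)"
proof -
  show SO: "\<S> \<subseteq> ch_objects R"
    unfolding \<S> using sphere_objects[OF regular_module_objects] sphere_objects disk_objects \<A> \<B> by blast
  show "right_perp (Ch R) \<S> = tilde_class R (right_perp (R_Mod R) \<B>) (right_perp (R_Mod R) \<A>)"
    unfolding right_perp_Ch[OF SO] tilde_class_def right_perp_R_Mod[OF \<A>] right_perp_R_Mod[OF \<B>]
  proof (intro Collect_cong conj_cong refl)
    fix X assume X: "X \<in> ch_objects R"
    show "(\<forall>s\<in>\<S>. splits s X) \<longleftrightarrow> exact_complex X \<and> (\<forall>n. chmod X n \<in> {X \<in> mod_objects R. \<forall>A\<in>\<B>. mod_splits A X} \<and>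
        cycles X n \<in> {X \<in> mod_objects R. \<forall>A\<in>\<A>. mod_splits A X})" (is "?L \<longleftrightarrow> ?R")
    proof
      assume L: ?L
      have "exact_complex X" by (rule exact_if_splits_spheres[OF X]) (use L in \<open>auto simp: \<S>\<close>)
      moreover have "mod_splits A (chmod X n)" if "A \<in> \<B>" for A n
        by (rule mod_splits_chmod[OF X]) (use L \<B> that in \<open>auto simp: \<S>\<close>)
      moreover have "mod_splits A (cycles X n)" if "A \<in> \<A>" for A n
        by (rule mod_splits_cycles[OF X]) (use L \<A> that in \<open>auto simp: \<S>\<close>)
      ultimately show ?R using ch_objectsD(2)[OF X] cycles_objects[OF X] by blast
    next
      assume r: ?R
      have "splits (sphere n M) X" if "M \<in> \<A>" for n M
        by (rule splits_sphere) (use r \<A> that in auto)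
      moreover have "splits (disk n M) X" if "M \<in> \<B>" for n M
        by (rule splits_disk[OF X]) (use r \<B> that in auto)
      moreover have "splits (sphere n (regular_module R)) X" for n
        by (rule splits_sphere_regular) (use r in auto)
      ultimately show ?L unfolding \<S> by blast
    qed
  qed
qed

end

theorem proposition3p12:
  fixes R :: "'u ring"
    and \<U> \<V> \<X> \<Y> :: "('u, 'u) module set"
    and A :: "'i \<Rightarrow> ('u, 'u) module" and I :: "'i set"
    and B :: "'j \<Rightarrow> ('u, 'u) module" and J :: "'j set"
  assumes "grothendieck_universe TYPE('u)"
    and "ring R" and "small TYPE('u) (carrier R)"
    and "cotorsion_pair (R_Mod R) \<U> \<V>" and "cotorsion_pair (R_Mod R) \<X> \<Y>"
    and "\<U> \<subseteq> \<X>"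
    and "cogenerated_by TYPE('u) (R_Mod R) \<U> \<V> (A ` I)"
    and "cogenerated_by TYPE('u) (R_Mod R) \<X> \<Y> (B ` J)"
  defines "\<S> \<equiv> {sphere n (regular_module R) | n. True} \<union> {sphere n (A i) | n i. i \<in> I}
                 \<union> {disk n (B j) | n j. j \<in> J}"
  shows "cotorsion_pair (Ch R) (left_perp (Ch R) (tilde_class R \<Y> \<V>)) (tilde_class R \<Y> \<V>) \<and>
         cogenerated_by TYPE('u) (Ch R)
           (left_perp (Ch R) (tilde_class R \<Y> \<V>)) (tilde_class R \<Y> \<V>) \<S> \<and>
         complete_pair (Ch R) (left_perp (Ch R) (tilde_class R \<Y> \<V>)) (tilde_class R \<Y> \<V>)"
proof -
  interpret module_universe R
    unfolding module_universe_def universe_def module_universe_axioms_def using assms(1-3) by blast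
  define T where "T = tilde_class R \<Y> \<V>"
  \<comment> \<open>The members of the cogenerating sets are modules because they lie in left
    orthogonal classes.\<close>
  have "left_perp (R_Mod R) \<C> \<subseteq> mod_objects R" for \<C> by (auto simp: left_perp_def R_Mod_def)
  then have AO: "A ` I \<subseteq> mod_objects R" and BO: "B ` J \<subseteq> mod_objects R"
    using assms(4,5,7,8) unfolding cotorsion_pair_def cogenerated_by_def by blast+
  have perp: "right_perp (R_Mod R) (A ` I) = \<V>" "right_perp (R_Mod R) (B ` J) = \<Y>"
    and sm: "small TYPE('u) (A ` I)" "small TYPE('u) (B ` J)"
    using assms(7,8) unfolding cogenerated_by_def by auto
  have S: "\<S> = {sphere n (regular_module R) | n. True} \<union> {sphere n M | n M. M \<in> A ` I} \<union> {disk n M | n M. M \<in> B ` J}"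
    unfolding \<S>_def by blast
  note SO = right_perp_generators(1)[OF AO BO S]
  have ST: "right_perp (Ch R) \<S> = T"
    using right_perp_generators(2)[OF AO BO S] unfolding perp T_def .
  have TO: "T \<subseteq> ch_objects R" unfolding T_def tilde_class_def by blast
  \<comment> \<open>Images of products of small sets make the smallness of \<S> visible.\<close>
  have "\<S> = (\<lambda>n. sphere n (regular_module R)) ` UNIV \<union> (\<lambda>(n, M). sphere n M) ` (UNIV \<times> A ` I)
      \<union> (\<lambda>(n, M). disk n M) ` (UNIV \<times> B ` J)"
    unfolding S by (intro arg_cong2[of _ _ _ _ "(\<union>)"]) (auto simp: image_def)
  then have small: "small TYPE('u) \<S>"
    by (simp only:) (intro small_Un small_image[OF small_Times] small_image[OF small_int] small_int sm)
  have SL: "\<S> \<subseteq> left_perp (Ch R) T"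
  proof
    fix s assume s: "s \<in> \<S>"
    have "splits s Y" if "Y \<in> T" for Y
      using that s unfolding ST[symmetric] right_perp_Ch[OF SO] by blast
    then show "s \<in> left_perp (Ch R) T" unfolding left_perp_Ch[OF TO] using s SO by blast
  qed
  have LO: "left_perp (Ch R) T \<subseteq> ch_objects R" unfolding left_perp_Ch[OF TO] by blast
  \<comment> \<open>The formal Galois argument: \<open>T\<close> is the right orthogonal class of
    \<S>, and \<S> is contained in the left orthogonal class of \<open>T\<close>.\<close>
  have "right_perp (Ch R) (left_perp (Ch R) T) = T"
  proof
    show "right_perp (Ch R) (left_perp (Ch R) T) \<subseteq> T"
      using SL unfolding ST[symmetric] right_perp_def by blast
    have "splits A Y" if "A \<in> left_perp (Ch R) T" "Y \<in> T" for A Y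
      using that unfolding left_perp_Ch[OF TO] by blast
    then show "T \<subseteq> right_perp (Ch R) (left_perp (Ch R) T)"
      unfolding right_perp_Ch[OF LO] using TO by blast
  qed
  then have "cotorsion_pair (Ch R) (left_perp (Ch R) T) T" unfolding cotorsion_pair_def by simp
  moreover have "cogenerated_by TYPE('u) (Ch R) (left_perp (Ch R) T) T \<S>"
    unfolding cogenerated_by_def using small SL ST by blast
  moreover have "complete_pair (Ch R) (left_perp (Ch R) T) T"
    using complete_pair_Ch[OF small SO] unfolding ST .
  ultimately show ?thesis unfolding T_def by blast
qed

end
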